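(* Let $n\in\mathbb{N}$, $0<\alpha<n$, $1<p<\infty$, $0<\rho<\infty$, $\omega\in A_p^{\rm loc}$, and $E\subseteq\mathbb{R}^n$. Then $$R_{\alpha,p;\rho}^{\omega}\left(E\cap e_{\alpha,p;\rho}^{\omega}(E)\right)=0,$$ where $e_{\alpha,p;\rho}^{\omega}(E)$ is the set of points of $\mathbb{R}^n$ at which $E$ is $R_{\alpha,p;\rho}^{\omega}$-thin.
   Context: $|x|_\infty=\max_i|x_i|$; $Q_r(x)=\{y:|y-x|_\infty<r\}$; $p'=p/(p-1)$; $\omega(S)=\int_S\omega\,dx$. A weight is a locally integrable function $\omega\ge0$ on $\mathbb{R}^n$ with $\omega>0$ a.e. $A_p^{\rm loc}$ ($1<p<\infty$) is the class of weights with $\sup_{\ell(Q)\le1}\left(\frac{1}{|Q|}\int_Q\omega\right)\left(\frac{1}{|Q|}\int_Q\omega^{-\frac{1}{p-1}}\right)^{p-1}<\infty$, the supremum over cubes with sides parallel to the axes and side length $\ell(Q)\le1$ (replacing $1$ by any other $\rho\in(0,\infty)$ gives the same class). With $I_{\alpha,\rho}(x)=|x|_\infty^{\alpha-n}\chi_{\{|x|_\infty<\rho\}}$, $R_{\alpha,p;\rho}^{\omega}(E)=\inf\left\{\int_{\mathbb{R}^n}f^p\omega\,dx:\ f\ge0\text{ measurable},\ f\in L^p(\omega),\ I_{\alpha,\rho}\ast f\ge1\text{ on }E\right\}$. A set $E\subseteq\mathbb{R}^n$ is $R_{\alpha,p;\rho}^{\omega}$-thin at $a\in\mathbb{R}^n$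 if both $\int_0^\rho\left(\frac{t^{\alpha p}}{\omega(Q_t(a))}\right)^{p'-1}\frac{dt}{t}=\infty$ and $\int_0^\rho\left(\frac{t^{\alpha p}R_{\alpha,p;\rho}^{\omega}(E\cap Q_t(a))}{\omega(Q_t(a))}\right)^{p'-1}\frac{dt}{t}<\infty$. *)

theory Defs
  imports "HOL-Analysis.Analysis"
begin

definition cube :: "real \<Rightarrow> real ^ 'n \<Rightarrow> (real ^ 'n) set" where
  "cube r x = {y. infnorm (y - x) < r}"

text \<open>Real powers on \<open>[0,\<infinity>]\<close>; only used with positive exponents, so that
  \<open>0\<close> is sent to \<open>0\<close> and \<open>\<infinity>\<close> to \<open>\<infinity>\<close>.\<close>

definition ennpowr :: "ennreal \<Rightarrow> real \<Rightarrow> ennreal" where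
  "ennpowr x s = (if x = \<infinity> then \<infinity> else ennreal (enn2real x powr s))"

definition conj_exp :: "real \<Rightarrow> real" where
  "conj_exp p = p / (p - 1)"

definition weight :: "(real ^ 'n \<Rightarrow> real) \<Rightarrow> bool" where
  "weight \<omega> \<longleftrightarrow>
     (\<forall>K. compact K \<longrightarrow> \<omega> absolutely_integrable_on K) \<and>
     (\<forall>x. \<omega> x \<ge> 0) \<and> (AE x in lebesgue. \<omega> x > 0)"

definition weight_of :: "(real ^ 'n \<Rightarrow> real) \<Rightarrow> (real ^ 'n) set \<Rightarrow> ennreal" where
  "weight_of \<omega> S = (\<integral>\<^sup>+x\<in>S. ennreal (\<omega> x) \<partial>lebesgue)"

text \<open>The cube \<open>cube r x\<close> has side length \<open>2 * r\<close>. On the null set where a weight vanishes,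
  \<open>\<omega> x powr (- 1 / (p - 1))\<close> is \<open>0\<close> instead of \<open>\<infinity>\<close>, which does not affect the integral.\<close>

definition Ap_loc :: "real \<Rightarrow> (real ^ 'n \<Rightarrow> real) set" where
  "Ap_loc p = {\<omega>. weight \<omega> \<and>
     (SUP (x, r) \<in> {(x, r). 0 < r \<and> 2 * r \<le> 1}.
        (weight_of \<omega> (cube r x) / emeasure lebesgue (cube r x)) *
        ennpowr ((\<integral>\<^sup>+y\<in>cube r x. ennreal (\<omega> y powr (- 1 / (p - 1))) \<partial>lebesgue)
                  / emeasure lebesgue (cube r x)) (p - 1)) < \<infinity>}"

text \<open>At the origin the kernel below has the value \<open>0\<close> (as \<open>0 powr s = 0\<close>) instead of \<open>\<infinity>\<close>;
  a single point does not affect convolutions.\<close>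

definition riesz_kernel :: "real \<Rightarrow> real \<Rightarrow> real ^ 'n \<Rightarrow> real" where
  "riesz_kernel \<alpha> \<rho> x =
     infnorm x powr (\<alpha> - real CARD('n)) * indicator {x. infnorm x < \<rho>} x"

definition riesz_potential ::
  "real \<Rightarrow> real \<Rightarrow> (real ^ 'n \<Rightarrow> real) \<Rightarrow> real ^ 'n \<Rightarrow> ennreal" where
  "riesz_potential \<alpha> \<rho> f x =
     (\<integral>\<^sup>+y. ennreal (riesz_kernel \<alpha> \<rho> (x - y) * f y) \<partial>lebesgue)"

text \<open>For nonnegative measurable \<open>f\<close>, membership in \<open>L\<^sup>p(\<omega>)\<close> is finiteness of the integral.
  The infimum of the empty set is \<open>\<infinity>\<close>.\<close>

definition riesz_capacity ::
  "real \<Rightarrow> real \<Rightarrow> real \<Rightarrow> (real ^ 'n \<Rightarrow> real) \<Rightarrow> (real ^ 'n) set \<Rightarrow> ennreal" where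
  "riesz_capacity \<alpha> p \<rho> \<omega> E =
     Inf {(\<integral>\<^sup>+x. ennreal (f x powr p * \<omega> x) \<partial>lebesgue) | f.
            f \<in> borel_measurable lebesgue \<and> (\<forall>x. f x \<ge> 0) \<and>
            (\<integral>\<^sup>+x. ennreal (f x powr p * \<omega> x) \<partial>lebesgue) < \<infinity> \<and>
            (\<forall>x\<in>E. riesz_potential \<alpha> \<rho> f x \<ge> 1)}"

definition thin_at ::
  "real \<Rightarrow> real \<Rightarrow> real \<Rightarrow> (real ^ 'n \<Rightarrow> real) \<Rightarrow> (real ^ 'n) set \<Rightarrow> real ^ 'n \<Rightarrow> bool" where
  "thin_at \<alpha> p \<rho> \<omega> E a \<longleftrightarrow>
     (\<integral>\<^sup>+t\<in>{0<..<\<rho>}.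
        ennpowr (ennreal (t powr (\<alpha> * p)) / weight_of \<omega> (cube t a)) (conj_exp p - 1)
          / ennreal t \<partial>lebesgue) = \<infinity> \<and>
     (\<integral>\<^sup>+t\<in>{0<..<\<rho>}.
        ennpowr (ennreal (t powr (\<alpha> * p)) * riesz_capacity \<alpha> p \<rho> \<omega> (E \<inter> cube t a)
                   / weight_of \<omega> (cube t a)) (conj_exp p - 1)
          / ennreal t \<partial>lebesgue) < \<infinity>"

definition thin_points ::
  "real \<Rightarrow> real \<Rightarrow> real \<Rightarrow> (real ^ 'n \<Rightarrow> real) \<Rightarrow> (real ^ 'n) set \<Rightarrow> (real ^ 'n) set" where
  "thin_points \<alpha> p \<rho> \<omega> E = {a. thin_at \<alpha> p \<rho> \<omega> E a}"

end

theory Submission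
  imports Defs
begin

text \<open>
  Inside a small dyadic cube, points are coded by infinite words, and the cubes become the nodes of a
  tree with weights \<open>\<omega>(Q) \<ell>(Q)\<^bsup>- \<alpha> p\<^esup>\<close>. The Riesz capacity is compared with
  the capacity of this tree (minimize \<open>\<Sum> c(Q)\<^bsup>p\<^esup> \<omega>(Q) \<ell>(Q)\<^bsup>- \<alpha> p\<^esup>\<close> among
  \<open>c \<ge> 0\<close> with \<open>\<Sum> c(Q) \<ge> 1\<close> along every branch that meets the set). From \<open>c\<close> one gets
  a competitor for the Riesz capacity by taking the \<open>\<ell>\<^sup>p\<close> sum of the functions
  \<open>c(Q) \<ell>(Q)\<^bsup>- \<alpha>\<^esup>\<close> on \<open>Q\<close>. From \<open>f\<close> one gets a competitor
  for the tree by multiplying \<open>\<ell>(Q)\<^bsup>\<alpha>\<^esup>\<close> with the increments, along branches, of the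
  running maximum of the averages of \<open>f\<close>; its energy is controlled by Muckenhoupt's maximal theorem.

  On the tree the capacity \<open>\<kappa>(Q)\<close> of the part of \<open>E\<close> below \<open>Q\<close> satisfies the recursion of a
  network of nonlinear resistors: the equilibrium potential loses at \<open>Q\<close> the fraction
  \<open>\<theta>(Q) = (\<kappa>(Q) / w(Q))\<^bsup>1/(p-1)\<^esup>\<close> of what is left. At a thin point \<open>\<Sum> \<theta>\<close> converges along the
  branch, so that a positive part \<open>\<Prod> (1 - \<theta>)\<close> of the potential is never lost; but testing the
  equilibrium flow against a nearly minimal competitor shows that the energy that is left at level \<open>N\<close> tends
  to \<open>0\<close>, hence such points of \<open>E\<close> form a set of capacity zero.
\<close>

section \<open>Capacity on the tree of words\<close>

text \<open>Thinness bounds the Riesz capacity of \<open>E \<inter> cube t a\<close>, hence the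
  capacity of the part of \<open>E\<close> below a word as measured in the whole tree, whereas the
  recursion works with \<kappa>, measured inside the subtree. The first can be much smaller, since a
  competitor may also spend on the ancestors. The divergence of the first integral in
  \<open>thin_at\<close> closes this gap: by a Kronecker argument the ancestors contribute at most
  half of the potential far down the branch (\<open>\<kappa>_le_root\<close>). \<open>E\<close> is
  arbitrary, so no equilibrium measure and no minimiser is at hand. The flow and its potential are
  therefore built from the capacities attached to finite words, all identities stop at a level
  \<open>N\<close>, and near-minimal competitors replace minimisers. The averages of
  \<open>f\<close> cannot serve as tree values themselves: they need not decay along a branch, so
  the sum of their p-th powers may diverge. The increments of the running maximum have p-th powers
  with a bounded sum, and since side^\<alpha> decays geometrically, Abel summation shows that they
  still produce a fixed fraction of the potential.\<close>

lemma powr_tangent: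
  fixes a b p :: real
  assumes "1 < p" "0 \<le> a" "0 \<le> b"
  shows "a * b powr (p - 1) \<le> a powr p / p + (1 - 1 / p) * b powr p"
proof -
  have "a * b powr (p - 1) \<le> a powr p / p + (b powr (p - 1)) powr (p / (p - 1)) / (p / (p - 1))"
    using assms by (intro Youngs_inequality) (auto simp: field_simps)
  also have "(b powr (p - 1)) powr (p / (p - 1)) = b powr p"
    using assms by (simp add: powr_powr)
  also have "b powr p / (p / (p - 1)) = (1 - 1 / p) * b powr p"
    using assms by (simp add: field_simps)
  finally show ?thesis .
qed

section \<open>Finite words, infinite sequences and their prefixes\<close>

lemma finite_words: "finite {l :: 'a::finite list. length l = k}"
  using finite_lists_length_eq[of "UNIV :: 'a set" k] by simp

lemma sum_words_Suc:
  fixes g :: "'a::finite list \<Rightarrow> 'b::comm_monoid_add"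
  shows "(\<Sum>l | length l = Suc k. g l) = (\<Sum>a\<in>UNIV. \<Sum>l | length l = k. g (a # l))"
proof -
  have "(\<Sum>a\<in>UNIV. \<Sum>l | length l = k. g (a # l))
      = (\<Sum>(a, l)\<in>UNIV \<times> {l. length l = k}. g (a # l))"
    by (simp add: sum.cartesian_product)
  also have "\<dots> = (\<Sum>l | length l = Suc k. g l)"
    by (rule sum.reindex_bij_witness[of _ "\<lambda>l. (hd l, tl l)" "\<lambda>(a, l). a # l"])
       (auto simp: length_Suc_conv)
  finally show ?thesis by simp
qed

lemma sum_words_add:
  fixes g :: "'a::finite list \<Rightarrow> 'b::comm_monoid_add"
  shows "(\<Sum>l | length l = N + k. g l) = (\<Sum>l | length l = N. \<Sum>m | length m = k. g (l @ m))"
proof (induction N arbitrary: g)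
  case 0
  have "{l :: 'a list. length l = 0} = {[]}" by auto
  then show ?case by simp
next
  case (Suc N)
  show ?case
    by (simp add: sum_words_Suc Suc.IH del: length_0_conv)
qed

lemma sum_words_snoc:
  fixes g :: "'a::finite list \<Rightarrow> 'b::comm_monoid_add"
  shows "(\<Sum>l | length l = Suc k. g l) = (\<Sum>l | length l = k. \<Sum>a\<in>UNIV. g (l @ [a]))"
proof -
  have 0: "{l :: 'a list. length l = 0} = {[]}" by auto
  have "(\<Sum>m | length m = 1. h m) = (\<Sum>a\<in>UNIV. h [a])" for h :: "'a list \<Rightarrow> 'b"
    using sum_words_Suc[of h 0] 0 by simp
  then show ?thesis using sum_words_add[of g k 1] by simp
qed

definition conc :: "'a list \<Rightarrow> (nat \<Rightarrow> 'a) \<Rightarrow> nat \<Rightarrow> 'a" where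
  "conc l s = foldr case_nat l s"

lemma conc_simps [simp]: "conc [] s = s" "conc (a # l) s = case_nat a (conc l s)"
  by (auto simp: conc_def)

lemma conc_append: "conc (l @ m) s = conc l (conc m s)"
  by (simp add: conc_def)

definition pre :: "nat \<Rightarrow> (nat \<Rightarrow> 'a) \<Rightarrow> 'a list" where
  "pre k s = map s [0..<k]"

lemma length_pre [simp]: "length (pre k s) = k"
  by (simp add: pre_def)

lemma pre_0 [simp]: "pre 0 s = []"
  by (simp add: pre_def)

lemma pre_Suc: "pre (Suc k) s = pre k s @ [s k]"
  by (simp add: pre_def)

lemma take_pre: "i \<le> k \<Longrightarrow> take i (pre k s) = pre i s"
  by (simp add: pre_def take_map min_def)

lemma pre_Suc_case_nat [simp]: "pre (Suc k) (case_nat a s) = a # pre k s"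
  by (simp add: pre_def map_upt_Suc del: upt_Suc)

lemma pre_conc_add: "pre (length l + k) (conc l s) = l @ pre k s"
  by (induction l) auto

lemma pre_conc: "pre (length l) (conc l s) = l"
  using pre_conc_add[of l 0 s] by simp

lemma conc_pre: "conc (pre k s) (\<lambda>i. s (i + k)) = s"
proof (induction k)
  case (Suc k)
  have "case_nat (s k) (\<lambda>i. s (i + Suc k)) = (\<lambda>i. s (i + k))"
    by (auto split: nat.splits)
  then show ?case using Suc by (simp add: pre_Suc conc_append)
qed simp

text \<open>The prefix \<open>l\<close> is removed from the branches, so that a subtree is again a
  set of full sequences and every notion for the tree applies to it with the weight
  \<open>\<lambda>m. w (l @ m)\<close>.\<close>

definition subtree :: "'a list \<Rightarrow> (nat \<Rightarrow> 'a) set \<Rightarrow> (nat \<Rightarrow> 'a) set" where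
  "subtree l E = {s. conc l s \<in> E}"

lemma subtree_subtree: "subtree m (subtree l E) = subtree (l @ m) E"
  by (simp add: subtree_def conc_append)

lemma subtree_Nil [simp]: "subtree [] E = E"
  by (simp add: subtree_def)

section \<open>Energy, potential and capacity on the tree\<close>

definition lev :: "real \<Rightarrow> ('a::finite list \<Rightarrow> real) \<Rightarrow> ('a list \<Rightarrow> real) \<Rightarrow> nat \<Rightarrow> real" where
  "lev p w c k = (\<Sum>l | length l = k. c l powr p * w l)"

definition energy :: "real \<Rightarrow> ('a::finite list \<Rightarrow> real) \<Rightarrow> ('a list \<Rightarrow> real) \<Rightarrow> ennreal" where
  "energy p w c = (\<Sum>k. ennreal (lev p w c k))"

definition pot :: "('a list \<Rightarrow> real) \<Rightarrow> (nat \<Rightarrow> 'a) \<Rightarrow> ennreal" where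
  "pot c s = (\<Sum>k. ennreal (c (pre k s)))"

definition tcap :: "real \<Rightarrow> ('a::finite list \<Rightarrow> real) \<Rightarrow> (nat \<Rightarrow> 'a) set \<Rightarrow> ennreal" where
  "tcap p w E = Inf {energy p w c | c. (\<forall>l. 0 \<le> c l) \<and> (\<forall>s\<in>E. 1 \<le> pot c s)}"

lemma suminf_ennreal_head:
  fixes f :: "nat \<Rightarrow> ennreal"
  shows "suminf f = f 0 + (\<Sum>k. f (Suc k))"
  using suminf_offset[of f 1] by simp

lemma pot_case_nat: "pot c (case_nat a s) = ennreal (c []) + pot (\<lambda>l. c (a # l)) s"
  unfolding pot_def by (subst suminf_ennreal_head) simp

lemma pot_conc:
  assumes "\<And>l. 0 \<le> c l"
  shows "pot c (conc l s) = ennreal (\<Sum>i<length l. c (take i l)) + pot (\<lambda>m. c (l @ m)) s"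
  using assms
proof (induction l arbitrary: c)
  case (Cons a l)
  have "(\<Sum>i<length (a # l). c (take i (a # l))) = c [] + (\<Sum>i<length l. c (a # take i l))"
    by (simp add: sum.lessThan_Suc_shift del: sum.lessThan_Suc)
  then show ?case
    using Cons by (simp add: pot_case_nat sum_nonneg add.assoc)
qed simp

lemma lev_nonneg:
  assumes "\<And>l. 0 \<le> w l"
  shows "0 \<le> lev p w c k"
  unfolding lev_def using assms by (intro sum_nonneg) auto

lemma lev_0 [simp]: "lev p w c 0 = c [] powr p * w []"
proof -
  have "{l :: 'a list. length l = 0} = {[]}" by auto
  then show ?thesis by (simp add: lev_def)
qed

lemma lev_add:
  "lev p w c (N + k) = (\<Sum>l | length l = N. lev p (\<lambda>m. w (l @ m)) (\<lambda>m. c (l @ m)) k)"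
  unfolding lev_def by (rule sum_words_add)

lemma energy_tail:
  assumes "\<And>l. 0 \<le> w l"
  shows "(\<Sum>l | length l = N. energy p (\<lambda>m. w (l @ m)) (\<lambda>m. c (l @ m)))
       = (\<Sum>k. ennreal (lev p w c (N + k)))"
proof -
  have "(\<Sum>l | length l = N. energy p (\<lambda>m. w (l @ m)) (\<lambda>m. c (l @ m)))
      = (\<Sum>k. \<Sum>l | length l = N. ennreal (lev p (\<lambda>m. w (l @ m)) (\<lambda>m. c (l @ m)) k))"
    unfolding energy_def by (intro suminf_sum[symmetric]) simp
  also have "\<dots> = (\<Sum>k. ennreal (lev p w c (N + k)))"
    by (intro suminf_cong) (simp add: lev_add sum_ennreal lev_nonneg assms)
  finally show ?thesis .
qed

lemma energy_split:
  assumes "\<And>l. 0 \<le> w l"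
  shows "energy p w c = ennreal (\<Sum>k<N. lev p w c k)
       + (\<Sum>l | length l = N. energy p (\<lambda>m. w (l @ m)) (\<lambda>m. c (l @ m)))"
proof -
  have "energy p w c = (\<Sum>k. ennreal (lev p w c (k + N))) + (\<Sum>k<N. ennreal (lev p w c k))"
    unfolding energy_def by (rule suminf_offset) simp
  then show ?thesis
    by (simp add: energy_tail assms sum_ennreal lev_nonneg add.commute)
qed

lemma energy_head:
  assumes "\<And>l. 0 \<le> w l"
  shows "energy p w c = ennreal (c [] powr p * w [])
       + (\<Sum>a\<in>UNIV. energy p (\<lambda>m. w (a # m)) (\<lambda>m. c (a # m)))"
proof -
  have 0: "{l :: 'a list. length l = 0} = {[]}" by auto
  have "(\<Sum>m | length m = 1. h m) = (\<Sum>a\<in>UNIV. h [a])" for h :: "'a list \<Rightarrow> ennreal"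
    using sum_words_Suc[of h 0] 0 by simp
  then show ?thesis
    using energy_split[of w p c 1] assms by simp
qed

lemma energy_cmult:
  assumes "\<And>l. 0 \<le> w l" "\<And>l. 0 \<le> c l" "0 \<le> r"
  shows "energy p w (\<lambda>l. r * c l) = ennreal (r powr p) * energy p w c"
proof -
  have "lev p w (\<lambda>l. r * c l) k = r powr p * lev p w c k" for k
    using assms by (simp add: lev_def powr_mult sum_distrib_left mult.assoc)
  then show ?thesis
    using assms by (simp add: energy_def ennreal_mult' lev_nonneg)
qed

lemma pot_cmult:
  assumes "\<And>l. 0 \<le> c l" "0 \<le> r"
  shows "pot (\<lambda>l. r * c l) s = ennreal r * pot c s"
  using assms by (simp add: pot_def ennreal_mult')

lemma tcap_le_energy:
  assumes "\<And>l. 0 \<le> c l" "\<And>s. s \<in> E \<Longrightarrow> 1 \<le> pot c s"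
  shows "tcap p w E \<le> energy p w c"
  unfolding tcap_def using assms by (intro Inf_lower) auto

lemma tcap_le_energy_scaled:
  assumes w: "\<And>l. 0 \<le> w l" and c: "\<And>l. 0 \<le> c l" and r: "0 < r"
    and E: "\<And>s. s \<in> E \<Longrightarrow> ennreal r \<le> pot c s"
  shows "ennreal (r powr p) * tcap p w E \<le> energy p w c"
proof -
  have "tcap p w E \<le> energy p w (\<lambda>l. inverse r * c l)"
  proof (rule tcap_le_energy)
    fix s assume "s \<in> E"
    have "1 = ennreal (inverse r) * ennreal r"
      using r by (simp flip: ennreal_mult)
    also have "\<dots> \<le> ennreal (inverse r) * pot c s"
      using E[OF \<open>s \<in> E\<close>] by (intro mult_left_mono) auto
    also have "\<dots> = pot (\<lambda>l. inverse r * c l) s"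
      using c r by (subst pot_cmult) auto
    finally show "1 \<le> pot (\<lambda>l. inverse r * c l) s" .
  qed (use c r in auto)
  also have "\<dots> = ennreal (inverse r powr p) * energy p w c"
    using w c r by (intro energy_cmult) auto
  finally have "ennreal (r powr p) * tcap p w E
      \<le> ennreal (r powr p) * (ennreal (inverse r powr p) * energy p w c)"
    by (intro mult_left_mono) auto
  also have "\<dots> = ennreal ((r * inverse r) powr p) * energy p w c"
    using r by (subst powr_mult) (auto simp: ennreal_mult mult.assoc)
  finally show ?thesis using r by simp
qed

lemma tcap_near:
  assumes "tcap p w E < \<infinity>" "0 < \<epsilon>"
  obtains c where "\<And>l. 0 \<le> c l" "\<And>s. s \<in> E \<Longrightarrow> 1 \<le> pot c s"
    "energy p w c \<le> tcap p w E + ennreal \<epsilon>"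
proof -
  have "tcap p w E < tcap p w E + ennreal \<epsilon>"
    using assms by (simp add: ennreal_add_left_cancel_less)
  then obtain e where "e \<in> {energy p w c | c. (\<forall>l. 0 \<le> c l) \<and> (\<forall>s\<in>E. 1 \<le> pot c s)}"
    "e < tcap p w E + ennreal \<epsilon>"
    unfolding tcap_def Inf_less_iff by blast
  then show ?thesis using that by fastforce
qed

lemma tcap_le_root:
  assumes "\<And>l. 0 \<le> w l"
  shows "tcap p w E \<le> ennreal (w [])"
proof -
  let ?c = "\<lambda>l. if l = [] then 1 else 0 :: real"
  have "tcap p w E \<le> energy p w ?c"
  proof (rule tcap_le_energy)
    fix s
    show "1 \<le> pot ?c s"
      unfolding pot_def by (subst suminf_ennreal_head) simp
  qed auto
  also have "\<dots> = ennreal (w [])"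
    using assms by (subst energy_head) (auto simp: energy_def lev_def)
  finally show ?thesis .
qed

lemma tcap_finite: "(\<And>l. 0 \<le> w l) \<Longrightarrow> tcap p w E < \<infinity>"
  using tcap_le_root[of w p E] by (simp add: le_less_trans)

definition rcap :: "real \<Rightarrow> ('a::finite list \<Rightarrow> real) \<Rightarrow> (nat \<Rightarrow> 'a) set \<Rightarrow> real" where
  "rcap p w E = enn2real (tcap p w E)"

lemma rcap_nonneg [simp]: "0 \<le> rcap p w E"
  by (simp add: rcap_def)

lemma ennreal_rcap: "(\<And>l. 0 \<le> w l) \<Longrightarrow> ennreal (rcap p w E) = tcap p w E"
  using tcap_finite[of w p E] by (simp add: rcap_def)

lemma tcap_mono: "E \<subseteq> E' \<Longrightarrow> tcap p w E \<le> tcap p w E'"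
  unfolding tcap_def by (intro Inf_superset_mono) auto

text \<open>On the proper prefixes of \<open>l\<close> the competitor has collected a fixed amount
  F, so below \<open>l\<close> it still owes 1 - F. Divided by 1 - F, its restriction is a
  competitor for the subtree, and homogeneity of degree \<open>p\<close> gives the factor. The
  maximum with 0 covers F \<ge> 1, when nothing is owed.\<close>

lemma rcap_split_lower:
  assumes w: "\<And>l. 0 \<le> w l" and c: "\<And>l. 0 \<le> c l" and E: "\<And>s. s \<in> E \<Longrightarrow> 1 \<le> pot c s"
  shows "ennreal ((max 0 (1 - (\<Sum>i<length l. c (take i l)))) powr p * rcap p (\<lambda>m. w (l @ m)) (subtree l E))
      \<le> energy p (\<lambda>m. w (l @ m)) (\<lambda>m. c (l @ m))"
proof -
  define F where "F = (\<Sum>i<length l. c (take i l))"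
  have F0: "0 \<le> F" unfolding F_def using c by (intro sum_nonneg) auto
  show ?thesis
  proof (cases "F < 1")
    case True
    have "ennreal ((1 - F) powr p) * tcap p (\<lambda>m. w (l @ m)) (subtree l E)
        \<le> energy p (\<lambda>m. w (l @ m)) (\<lambda>m. c (l @ m))"
    proof (rule tcap_le_energy_scaled)
      fix s assume "s \<in> subtree l E"
      then have "1 \<le> pot c (conc l s)" using E by (auto simp: subtree_def)
      then have *: "1 \<le> ennreal F + pot (\<lambda>m. c (l @ m)) s"
        using pot_conc[of c l s] c F_def by auto
      show "ennreal (1 - F) \<le> pot (\<lambda>m. c (l @ m)) s"
      proof (cases "pot (\<lambda>m. c (l @ m)) s")
        case (real r)
        then have "ennreal 1 \<le> ennreal (F + r)" using * F0 by simp
        then have "1 \<le> F + r" using F0 real by (subst (asm) ennreal_le_iff) auto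
        then show ?thesis using real by simp
      qed simp
    qed (use w c True in auto)
    also have "tcap p (\<lambda>m. w (l @ m)) (subtree l E) = ennreal (rcap p (\<lambda>m. w (l @ m)) (subtree l E))"
      using w by (simp add: ennreal_rcap)
    finally show ?thesis using True by (simp add: F_def[symmetric] ennreal_mult)
  next
    case False
    then show ?thesis by (simp add: F_def[symmetric] max_def)
  qed
qed

text \<open>The competitor spends \<open>t\<close> at the root and uses 1 - t times a near-minimal
  competitor below each child. Minimisers need not exist, so each child is allowed an error that
  tends to 0 at the end.\<close>

lemma rcap_upper:
  assumes w: "\<And>l. 0 \<le> w l" and t: "0 \<le> t" "t \<le> 1"
  shows "rcap p w E \<le> t powr p * w [] + (1 - t) powr p * (\<Sum>a\<in>UNIV. rcap p (\<lambda>m. w (a # m)) (subtree [a] E))"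
proof -
  define n where "n = real (card (UNIV :: 'a set))"
  let ?k = "\<lambda>a. rcap p (\<lambda>m. w (a # m)) (subtree [a] E)"
  have *: "rcap p w E \<le> t powr p * w [] + (1 - t) powr p * (\<Sum>a\<in>UNIV. ?k a + \<epsilon>)" if "0 < \<epsilon>" for \<epsilon>
  proof -
    have "\<exists>c. (\<forall>l. 0 \<le> c l) \<and> (\<forall>s\<in>subtree [a] E. 1 \<le> pot c s) \<and>
        energy p (\<lambda>m. w (a # m)) c \<le> ennreal (?k a + \<epsilon>)" for a
      using tcap_near[of p "\<lambda>m. w (a # m)" "subtree [a] E" \<epsilon>] that
        ennreal_rcap[of "\<lambda>m. w (a # m)" p "subtree [a] E"] tcap_finite[of "\<lambda>m. w (a # m)" p "subtree [a] E"] w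
      by (metis ennreal_plus rcap_nonneg order_less_imp_le)
    then obtain C where C: "\<And>a l. 0 \<le> C a l" "\<And>a s. s \<in> subtree [a] E \<Longrightarrow> 1 \<le> pot (C a) s"
      "\<And>a. energy p (\<lambda>m. w (a # m)) (C a) \<le> ennreal (?k a + \<epsilon>)"
      by metis
    define c where "c l = (case l of [] \<Rightarrow> t | a # m \<Rightarrow> (1 - t) * C a m)" for l
    have c0: "0 \<le> c l" for l using t C by (auto simp: c_def split: list.splits)
    have "tcap p w E \<le> energy p w c"
    proof (rule tcap_le_energy)
      fix s assume "s \<in> E"
      obtain a s' where s: "s = case_nat a s'"
        using conc_pre[of 1 s] by (metis One_nat_def append_Nil conc_simps pre_0 pre_Suc)
      then have "s' \<in> subtree [a] E" using \<open>s \<in> E\<close> by (simp add: subtree_def)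
      have "1 = ennreal t + ennreal (1 - t) * 1" using t by (simp flip: ennreal_plus)
      also have "\<dots> \<le> ennreal t + ennreal (1 - t) * pot (C a) s'"
        using C(2)[OF \<open>s' \<in> subtree [a] E\<close>] by (intro add_left_mono mult_left_mono) auto
      also have "\<dots> = pot c s"
        unfolding s pot_case_nat using C(1) t by (subst pot_cmult[symmetric]) (auto simp: c_def)
      finally show "1 \<le> pot c s" .
    qed (rule c0)
    also have "\<dots> = ennreal (t powr p * w []) + (\<Sum>a\<in>UNIV. energy p (\<lambda>m. w (a # m)) (\<lambda>m. (1 - t) * C a m))"
      using w by (subst energy_head) (auto simp: c_def)
    also have "\<dots> = ennreal (t powr p * w []) + (\<Sum>a\<in>UNIV. ennreal ((1 - t) powr p) * energy p (\<lambda>m. w (a # m)) (C a))"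
      using w C t by (subst energy_cmult) auto
    also have "\<dots> \<le> ennreal (t powr p * w []) + (\<Sum>a\<in>UNIV. ennreal ((1 - t) powr p) * ennreal (?k a + \<epsilon>))"
      using C by (intro add_left_mono sum_mono mult_left_mono) auto
    also have "\<dots> = ennreal (t powr p * w [] + (\<Sum>a\<in>UNIV. (1 - t) powr p * (?k a + \<epsilon>)))"
      using that w by (simp add: sum_nonneg sum_ennreal flip: ennreal_mult ennreal_plus)
    finally have "ennreal (rcap p w E) \<le> ennreal (t powr p * w [] + (\<Sum>a\<in>UNIV. (1 - t) powr p * (?k a + \<epsilon>)))"
      using w by (simp add: ennreal_rcap)
    then show ?thesis
      using that w by (subst (asm) ennreal_le_iff) (auto intro!: add_nonneg_nonneg sum_nonneg simp: sum_distrib_left)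
  qed
  have "((\<lambda>\<epsilon>. t powr p * w [] + (1 - t) powr p * (\<Sum>a\<in>UNIV. ?k a + \<epsilon>)) \<longlongrightarrow>
     t powr p * w [] + (1 - t) powr p * (\<Sum>a\<in>UNIV. ?k a + 0)) (at_right 0)"
    by (intro tendsto_intros)
  then have "rcap p w E \<le> t powr p * w [] + (1 - t) powr p * (\<Sum>a\<in>UNIV. ?k a + 0)"
    using * by (intro tendsto_lowerbound[where F = "at_right 0"]) (auto simp: eventually_at_filter)
  then show ?thesis by simp
qed

section \<open>The recursion for the capacity of a word and its children\<close>

definition share :: "real \<Rightarrow> ('a::finite list \<Rightarrow> real) \<Rightarrow> (nat \<Rightarrow> 'a) set \<Rightarrow> real" where
  "share p w E = (rcap p w E / w []) powr (1 / (p - 1))"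

text \<open>A word with its children is a series-parallel network of nonlinear resistors,
  in which \<open>share\<close> is the part of the unit potential drop that falls on the root.\<close>

lemma rcap_recursion:
  fixes w :: "'a::finite list \<Rightarrow> real" and E :: "(nat \<Rightarrow> 'a) set"
  assumes p: "1 < p" and w: "\<And>l. 0 < w l"
  defines "S \<equiv> (\<Sum>a\<in>UNIV. rcap p (\<lambda>m. w (a # m)) (subtree [a] E))"
  shows "rcap p w E = w [] * share p w E powr (p - 1)"
    and "rcap p w E = S * (1 - share p w E) powr (p - 1)"
    and "0 \<le> share p w E" and "share p w E < 1"
proof -
  define q where "q = 1 / (p - 1)"
  define v where "v = w []"
  have q: "q * (p - 1) = 1" "(p - 1) * q = 1" "0 < q" using p by (auto simp: q_def)
  have v: "0 < v" by (simp add: v_def w)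
  have w0: "\<And>l. 0 \<le> w l" using w less_imp_le by blast
  have S: "0 \<le> S" by (simp add: S_def sum_nonneg)
  \<comment> \<open>This is the minimiser of t^p v + (1 - t)^p S, determined by v \<theta>^(p-1) = S
    (1 - \<theta>)^(p-1). The common value \<kappa> of the two sides is also the value of the
    minimum.\<close>
  define \<theta> where "\<theta> = S powr q / (v powr q + S powr q)"
  have vq: "0 < v powr q" using v by simp
  have \<theta>: "0 \<le> \<theta>" "\<theta> < 1" "1 - \<theta> = v powr q / (v powr q + S powr q)"
  proof -
    have D: "0 < v powr q + S powr q" using vq by (simp add: add_pos_nonneg)
    show "0 \<le> \<theta>" by (simp add: \<theta>_def)
    show "\<theta> < 1" "1 - \<theta> = v powr q / (v powr q + S powr q)"
      using D vq unfolding \<theta>_def by (simp_all add: divide_simps)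
  qed
  define \<kappa> where "\<kappa> = v * \<theta> powr (p - 1)"
  have pq: "(x powr q) powr (p - 1) = x" if "0 \<le> x" for x :: real
    using that q by (simp add: powr_powr)
  have 1: "v * \<theta> powr (p - 1) = v * S / (v powr q + S powr q) powr (p - 1)"
    unfolding \<theta>_def using v S by (simp add: powr_divide pq)
  have 2: "S * (1 - \<theta>) powr (p - 1) = v * S / (v powr q + S powr q) powr (p - 1)"
    unfolding \<theta>(3) using v S by (simp add: powr_divide pq)
  have e1: "\<kappa> = v * \<theta> powr (p - 1)" "\<kappa> = S * (1 - \<theta>) powr (p - 1)"
    using 1 2 by (auto simp: \<kappa>_def)
  have pp: "x powr p = x * x powr (p - 1)" if "0 \<le> x" for x :: real
    using that by (cases "x = 0") (auto simp: powr_diff)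
  have "rcap p w E \<le> \<theta> powr p * v + (1 - \<theta>) powr p * S"
    using rcap_upper[of w \<theta> p E] w0 \<theta> by (simp add: S_def v_def)
  also have "\<dots> = \<theta> * (v * \<theta> powr (p - 1)) + (1 - \<theta>) * (S * (1 - \<theta>) powr (p - 1))"
    using \<theta> by (simp add: pp algebra_simps)
  also have "\<dots> = \<kappa>" by (simp add: e1(1)[symmetric] e1(2)[symmetric] algebra_simps)
  finally have le: "rcap p w E \<le> \<kappa>" .
  have ge: "\<kappa> \<le> rcap p w E"
  proof -
    have "ennreal \<kappa> \<le> energy p w c" if c: "\<And>l. 0 \<le> c l" "\<And>s. s \<in> E \<Longrightarrow> 1 \<le> pot c s" for c
    proof -
      \<comment> \<open>A competitor may exceed 1 at the root. Cutting it off there does not raise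
        the energy and does not change what the children owe.\<close>
      define t where "t = min 1 (c [])"
      have t: "0 \<le> t" "t \<le> 1" "t \<le> c []" using c by (auto simp: t_def)
      have lo: "ennreal ((1 - t) powr p * rcap p (\<lambda>m. w (a # m)) (subtree [a] E))
          \<le> energy p (\<lambda>m. w (a # m)) (\<lambda>m. c (a # m))" for a
        using rcap_split_lower[of w c E "[a]" p] w0 c by (simp add: t_def max_def min_def split: if_splits)
      \<comment> \<open>The tangent lines at \<theta> and 1 - \<theta>. With the weights v and S
        their slopes in t cancel by \<open>e1\<close>, so they give a lower bound for the energy
        that is independent of t.\<close>
      have y1: "t * \<theta> powr (p - 1) \<le> t powr p / p + (1 - 1 / p) * \<theta> powr p"
        and y2: "(1 - t) * (1 - \<theta>) powr (p - 1) \<le> (1 - t) powr p / p + (1 - 1 / p) * (1 - \<theta>) powr p"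
        using powr_tangent p t \<theta> by auto
      have "\<kappa> = t * \<kappa> + (1 - t) * \<kappa>" by (simp add: algebra_simps)
      also have "\<dots> = v * (t * \<theta> powr (p - 1)) + S * ((1 - t) * (1 - \<theta>) powr (p - 1))"
        by (subst (1) e1(1), subst (1) e1(2)) (simp add: algebra_simps)
      also have "\<dots> \<le> v * (t powr p / p + (1 - 1 / p) * \<theta> powr p)
          + S * ((1 - t) powr p / p + (1 - 1 / p) * (1 - \<theta>) powr p)"
        using y1 y2 v S by (intro add_mono mult_left_mono) auto
      also have "\<dots> = (t powr p * v + (1 - t) powr p * S) / p
          + (1 - 1 / p) * (\<theta> * (v * \<theta> powr (p - 1)) + (1 - \<theta>) * (S * (1 - \<theta>) powr (p - 1)))"
        using \<theta> by (simp add: pp algebra_simps add_divide_distrib)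
      also have "\<dots> = (t powr p * v + (1 - t) powr p * S) / p + (1 - 1 / p) * \<kappa>"
        by (simp add: e1(1)[symmetric] e1(2)[symmetric] algebra_simps)
      finally have "\<kappa> / p \<le> (t powr p * v + (1 - t) powr p * S) / p"
        by (simp add: algebra_simps)
      then have "\<kappa> \<le> t powr p * v + (1 - t) powr p * S"
        using p by (simp add: divide_le_cancel)
      then have "ennreal \<kappa> \<le> ennreal (t powr p * v + (1 - t) powr p * S)"
        by (rule ennreal_leI)
      also have "\<dots> = ennreal (t powr p * v) + (\<Sum>a\<in>UNIV. ennreal ((1 - t) powr p * rcap p (\<lambda>m. w (a # m)) (subtree [a] E)))"
        using v by (simp add: S_def sum_distrib_left sum_nonneg)
      also have "\<dots> \<le> ennreal (c [] powr p * w []) + (\<Sum>a\<in>UNIV. energy p (\<lambda>m. w (a # m)) (\<lambda>m. c (a # m)))"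
        using lo t w0 p by (intro add_mono sum_mono ennreal_leI) (auto simp: v_def intro!: mult_right_mono powr_mono2)
      also have "\<dots> = energy p w c" using w0 by (subst energy_head) auto
      finally show ?thesis .
    qed
    then have "ennreal \<kappa> \<le> tcap p w E"
      unfolding tcap_def by (intro Inf_greatest) auto
    then show ?thesis using ennreal_rcap[of w p E] w0 by (metis ennreal_le_iff rcap_nonneg)
  qed
  from le ge have \<kappa>: "rcap p w E = \<kappa>" by simp
  have f: "share p w E = \<theta>"
    using v \<theta> q by (simp add: share_def \<kappa> e1(1) v_def[symmetric] powr_powr q_def[symmetric])
  show "rcap p w E = w [] * share p w E powr (p - 1)"
    and "rcap p w E = S * (1 - share p w E) powr (p - 1)"
    and "0 \<le> share p w E" and "share p w E < 1"
    using \<theta> e1 by (auto simp: f \<kappa> v_def)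
qed

lemma tcap_empty [simp]: "tcap p w {} = 0"
proof -
  have "tcap p w {} \<le> energy p w (\<lambda>_. 0)"
    by (rule tcap_le_energy) auto
  then show ?thesis by (simp add: energy_def lev_def)
qed

lemma rcap_empty [simp]: "rcap p w {} = 0"
  by (simp add: rcap_def)

lemma rcap_mono:
  assumes "\<And>l. 0 \<le> w l" "E \<subseteq> E'"
  shows "rcap p w E \<le> rcap p w E'"
  using tcap_mono[OF assms(2), of p w] ennreal_rcap[of w p E] ennreal_rcap[of w p E'] assms(1)
  by (metis ennreal_le_iff rcap_nonneg)

text \<open>Spend nothing on the first \<open>N\<close> levels: this is \<open>rcap_upper\<close>
  with t = 0, iterated.\<close>

lemma rcap_le_sum_words:
  assumes w: "\<And>l. 0 \<le> w l"
  shows "rcap p w E \<le> (\<Sum>l | length l = N. rcap p (\<lambda>m. w (l @ m)) (subtree l E))"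
proof (induction N)
  case 0
  have "{l :: 'a list. length l = 0} = {[]}" by auto
  then show ?case by simp
next
  case (Suc N)
  have "rcap p (\<lambda>m. w (l @ m)) (subtree l E)
      \<le> (\<Sum>a\<in>UNIV. rcap p (\<lambda>m. w ((l @ [a]) @ m)) (subtree (l @ [a]) E))" for l
    using rcap_upper[of "\<lambda>m. w (l @ m)" 0 p "subtree l E"] w by (simp add: subtree_subtree)
  then show ?case
    unfolding sum_words_snoc by (intro order_trans[OF Suc] sum_mono)
qed

section \<open>The equilibrium potential and the energy it leaves at level N\<close>

locale word_tree =
  fixes p :: real and w :: "'a::finite list \<Rightarrow> real" and E :: "(nat \<Rightarrow> 'a) set"
  assumes p: "1 < p" and w: "0 < w l"
begin

lemma w0: "0 \<le> w l"
  using w less_imp_le by blast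

definition \<kappa> :: "'a list \<Rightarrow> real" where
  "\<kappa> l = rcap p (\<lambda>m. w (l @ m)) (subtree l E)"

definition \<theta> :: "'a list \<Rightarrow> real" where
  "\<theta> l = share p (\<lambda>m. w (l @ m)) (subtree l E)"

text \<open>What the equilibrium competitor \<open>\<lambda>l. res l * \<theta> l\<close> has not
  yet spent of the unit potential when it arrives at \<open>l\<close>.\<close>

definition res :: "'a list \<Rightarrow> real" where
  "res l = (\<Prod>i<length l. 1 - \<theta> (take i l))"

text \<open>Since energy is homogeneous of degree \<open>p\<close>, this is the optimal energy for
  paying the amounts \<open>res l\<close> still due below the words of length
  \<open>N\<close>.\<close>

definition rest :: "nat \<Rightarrow> real" where
  "rest N = (\<Sum>l | length l = N. \<kappa> l * res l powr p)"

lemma \<kappa>_nonneg [simp]: "0 \<le> \<kappa> l"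
  by (simp add: \<kappa>_def)

lemma \<theta>: "0 \<le> \<theta> l" "\<theta> l < 1"
  using rcap_recursion[OF p, of "\<lambda>m. w (l @ m)" "subtree l E"] w by (auto simp: \<theta>_def)

lemma \<kappa>_eq: "\<kappa> l = w l * \<theta> l powr (p - 1)"
  using rcap_recursion[OF p, of "\<lambda>m. w (l @ m)" "subtree l E"] w by (auto simp: \<theta>_def \<kappa>_def)

lemma \<kappa>_eq_sum: "\<kappa> l = (\<Sum>a\<in>UNIV. \<kappa> (l @ [a])) * (1 - \<theta> l) powr (p - 1)"
  using rcap_recursion(2)[OF p, of "\<lambda>m. w (l @ m)" "subtree l E"] w by (simp add: \<theta>_def \<kappa>_def subtree_subtree)

lemma res_Nil [simp]: "res [] = 1"
  by (simp add: res_def)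

lemma res_snoc: "res (l @ [a]) = res l * (1 - \<theta> l)"
  by (simp add: res_def)

lemma res_pos: "0 < res l"
  unfolding res_def using \<theta> by (intro prod_pos) auto

lemma res_snoc_powr: "res (l @ [a]) powr r = res l powr r * (1 - \<theta> l) powr r"
  using res_pos[of l] \<theta>[of l] by (simp add: res_snoc powr_mult)

lemma powr_p: "0 \<le> x \<Longrightarrow> x powr p = x * x powr (p - 1)" for x :: real
  by (cases "x = 0") (auto simp: powr_diff)

lemma rest_0: "rest 0 = rcap p w E"
proof -
  have "{l :: 'a list. length l = 0} = {[]}" by auto
  then show ?thesis by (simp add: rest_def \<kappa>_def)
qed

text \<open>\<kappa> is divided in the proportion \<theta> to 1 - \<theta>. The first portion is the
  energy spent at the word itself, and by \<open>\<kappa>_eq_sum\<close> the second one is passed on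
  to the children.\<close>

lemma rest_Suc: "rest N = lev p w (\<lambda>l. res l * \<theta> l) N + rest (Suc N)"
proof -
  have "\<kappa> l * res l powr p = (res l * \<theta> l) powr p * w l + (\<Sum>a\<in>UNIV. \<kappa> (l @ [a]) * res (l @ [a]) powr p)" for l
  proof -
    have "\<kappa> l = \<theta> l * \<kappa> l + (1 - \<theta> l) * \<kappa> l" by (simp add: algebra_simps)
    also have "\<dots> = \<theta> l * (w l * \<theta> l powr (p - 1)) + (1 - \<theta> l) * ((\<Sum>a\<in>UNIV. \<kappa> (l @ [a])) * (1 - \<theta> l) powr (p - 1))"
      using \<kappa>_eq[of l] \<kappa>_eq_sum[of l] by simp
    also have "\<dots> = \<theta> l powr p * w l + (\<Sum>a\<in>UNIV. \<kappa> (l @ [a])) * (1 - \<theta> l) powr p"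
      using \<theta>[of l] by (simp add: powr_p)
    finally have "\<kappa> l * res l powr p = (\<theta> l powr p * w l + (\<Sum>a\<in>UNIV. \<kappa> (l @ [a])) * (1 - \<theta> l) powr p) * res l powr p"
      by simp
    also have "\<dots> = (res l * \<theta> l) powr p * w l + (\<Sum>a\<in>UNIV. \<kappa> (l @ [a]) * res (l @ [a]) powr p)"
      using \<theta>[of l] res_pos[of l]
      by (simp add: res_snoc_powr powr_mult distrib_left sum_distrib_left mult_ac)
    finally show ?thesis .
  qed
  then have "rest N = (\<Sum>l | length l = N. (res l * \<theta> l) powr p * w l
      + (\<Sum>a\<in>UNIV. \<kappa> (l @ [a]) * res (l @ [a]) powr p))"
    unfolding rest_def by (intro sum.cong refl)
  then show ?thesis
    by (simp only: rest_def lev_def sum_words_snoc sum.distrib)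
qed

lemma rest_eq: "rcap p w E = (\<Sum>k<N. lev p w (\<lambda>l. res l * \<theta> l) k) + rest N"
proof (induction N)
  case (Suc N)
  then show ?case using rest_Suc[of N] by simp
qed (simp add: rest_0)

text \<open>The flow \<open>\<kappa> l * res l powr (p - 1)\<close> is conserved at every word, so it can be
  tested against an arbitrary competitor \<open>f\<close>.\<close>

lemma flow_test:
  "rcap p w E = (\<Sum>k<N. \<Sum>l | length l = k. \<kappa> l * res l powr (p - 1) * f l)
     + (\<Sum>l | length l = N. \<kappa> l * res l powr (p - 1) * (1 - (\<Sum>i<length l. f (take i l))))"
proof (induction N)
  case 0
  have "{l :: 'a list. length l = 0} = {[]}" by auto
  then show ?case by (simp add: \<kappa>_def)
next
  case (Suc N)
  have "(\<Sum>a\<in>UNIV. \<kappa> (l @ [a]) * res (l @ [a]) powr (p - 1) * (1 - (\<Sum>i<length (l @ [a]). f (take i (l @ [a])))))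
      = \<kappa> l * res l powr (p - 1) * (1 - (\<Sum>i<length l. f (take i l)) - f l)" for l
  proof -
    have "(\<Sum>a\<in>UNIV. \<kappa> (l @ [a]) * res (l @ [a]) powr (p - 1) * (1 - (\<Sum>i<length (l @ [a]). f (take i (l @ [a])))))
      = (\<Sum>a\<in>UNIV. \<kappa> (l @ [a])) * (1 - \<theta> l) powr (p - 1) * (res l powr (p - 1) * (1 - (\<Sum>i<length l. f (take i l)) - f l))"
      unfolding sum_distrib_right by (intro sum.cong) (auto simp: res_snoc_powr diff_diff_eq)
    then show ?thesis by (simp flip: \<kappa>_eq_sum)
  qed
  then have "(\<Sum>l | length l = Suc N. \<kappa> l * res l powr (p - 1) * (1 - (\<Sum>i<length l. f (take i l))))
      = (\<Sum>l | length l = N. \<kappa> l * res l powr (p - 1) * (1 - (\<Sum>i<length l. f (take i l)) - f l))"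
    by (simp only: sum_words_snoc)
  also have "\<dots> = (\<Sum>l | length l = N. \<kappa> l * res l powr (p - 1) * (1 - (\<Sum>i<length l. f (take i l))))
      - (\<Sum>l | length l = N. \<kappa> l * res l powr (p - 1) * f l)"
    unfolding sum_subtractf[symmetric] by (intro sum.cong refl) (simp add: algebra_simps)
  finally show ?case using Suc by simp
qed

text \<open>Young's inequality in which the coefficient of r^p is halved at the price of a large
  constant D. With the full coefficient 1 - 1/p, the term \<open>rest N\<close> that
  \<open>rest_small\<close> has to bound would cancel.\<close>

lemma young_weighted:
  obtains D where "0 < D" "\<And>x r. 0 \<le> x \<Longrightarrow> 0 \<le> r \<Longrightarrow>
    x * r powr (p - 1) \<le> D * x powr p + (1 - 1 / p) / 2 * r powr p"
proof
  define t where "t = (1 / 2 :: real) powr (1 / p)"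
  have t: "0 < t" "t powr p = 1 / 2" using p by (auto simp: t_def powr_powr)
  define D where "D = (1 / t powr (p - 1)) powr p / p"
  show "0 < D" using t p by (simp add: D_def)
  fix x r :: real assume xr: "0 \<le> x" "0 \<le> r"
  have "x * r powr (p - 1) = (x * (1 / t powr (p - 1))) * (t * r) powr (p - 1)"
    using t xr by (simp add: powr_mult)
  also have "\<dots> \<le> (x * (1 / t powr (p - 1))) powr p / p + (1 - 1 / p) * (t * r) powr p"
    using t xr p by (intro powr_tangent) auto
  also have "\<dots> = D * x powr p + (1 - 1 / p) / 2 * r powr p"
    using t xr by (simp add: powr_mult D_def powr_divide)
  finally show "x * r powr (p - 1) \<le> D * x powr p + (1 - 1 / p) / 2 * r powr p" .
qed

text \<open>The flow is tested against a competitor \<open>f\<close> whose energy exceeds the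
  capacity by at most \<delta>. Young's inequality on the first \<open>N\<close> levels reproduces
  the capacity up to \<delta>, minus (1 - 1/p) \<open>rest N\<close>; the boundary term at level
  \<open>N\<close> gives back only half of this multiple of \<open>rest N\<close>, plus a multiple
  of the tail energy of \<open>f\<close>. That tail is small for large \<open>N\<close> because the
  energy of \<open>f\<close> is finite.\<close>

lemma rest_small:
  assumes "0 < \<epsilon>"
  shows "\<exists>N. rest N < \<epsilon>"
proof -
  define \<gamma> where "\<gamma> = (1 - 1 / p) / 2"
  have \<gamma>: "0 < \<gamma>" "1 - 1 / p = 2 * \<gamma>" using p by (auto simp: \<gamma>_def)
  obtain D where D: "0 < D" "\<And>x r. 0 \<le> x \<Longrightarrow> 0 \<le> r \<Longrightarrow>
    x * r powr (p - 1) \<le> D * x powr p + \<gamma> * r powr p"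
    using young_weighted unfolding \<gamma>_def by blast
  \<comment> \<open>The final estimate is \<gamma> * rest N < 2 * \<delta>, and this makes its
    right-hand side \<gamma> * \<epsilon>.\<close>
  define \<delta> where "\<delta> = \<epsilon> * \<gamma> / 2"
  have \<delta>: "0 < \<delta>" using assms \<gamma> by (simp add: \<delta>_def)
  obtain f where f: "\<And>l. 0 \<le> f l" "\<And>s. s \<in> E \<Longrightarrow> 1 \<le> pot f s"
    "energy p w f \<le> tcap p w E + ennreal \<delta>"
    using tcap_near[of p w E \<delta>] \<delta> tcap_finite[of w p E] w0 by blast
  define e where "e = enn2real (energy p w f)"
  have "energy p w f < \<infinity>"
    using f(3) tcap_finite[of w p E] w0 by (simp add: le_less_trans)
  then have e: "energy p w f = ennreal e" "0 \<le> e" by (auto simp: e_def)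
  have "ennreal e \<le> ennreal (rcap p w E + \<delta>)"
    using f(3) \<delta> e ennreal_rcap[of w p E] w0 by simp
  then have e_le: "e \<le> rcap p w E + \<delta>"
    using \<delta> by (subst (asm) ennreal_le_iff) auto
  have lev0: "0 \<le> lev p w f k" for k using w0 by (rule lev_nonneg)
  have "(\<lambda>k. ennreal (lev p w f k)) sums ennreal e"
    using summable_sums[OF summableI, of "\<lambda>k. ennreal (lev p w f k)"] e(1)
    by (simp add: energy_def)
  then have "(lev p w f) sums e" using lev0 e(2) by (subst (asm) sums_ennreal) auto
  then have "(\<lambda>N. e - (\<Sum>k<N. lev p w f k)) \<longlonglongrightarrow> e - e"
    unfolding sums_def by (intro tendsto_intros)
  then have "\<forall>\<^sub>F N in sequentially. e - (\<Sum>k<N. lev p w f k) < \<delta> / D"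
    using \<delta> D by (intro order_tendstoD(2)[of _ "e - e"]) auto
  then obtain N where N: "e - (\<Sum>k<N. lev p w f k) < \<delta> / D"
    using eventually_happens'[OF sequentially_bot] by blast
  define F where "F l = (\<Sum>i<length l. f (take i l))" for l
  define X where "X = (\<Sum>l | length l = N. \<kappa> l * (max 0 (1 - F l)) powr p)"
  \<comment> \<open>Whatever \<open>f\<close> still owes below level \<open>N\<close> costs at least
    \<open>X\<close>, so \<open>X\<close> is at most the tail of the energy of \<open>f\<close> and
    inherits its smallness.\<close>
  have "ennreal ((\<Sum>k<N. lev p w f k) + X) = ennreal (\<Sum>k<N. lev p w f k)
      + (\<Sum>l | length l = N. ennreal ((max 0 (1 - F l)) powr p * \<kappa> l))"
    using lev0 by (simp add: X_def sum_nonneg sum_ennreal mult.commute)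
  also have "\<dots> \<le> ennreal (\<Sum>k<N. lev p w f k)
      + (\<Sum>l | length l = N. energy p (\<lambda>m. w (l @ m)) (\<lambda>m. f (l @ m)))"
    unfolding F_def \<kappa>_def using w0 f by (intro add_left_mono sum_mono rcap_split_lower) auto
  also have "\<dots> = ennreal e" using energy_split[of w p f N] w0 e by simp
  finally have X_le: "(\<Sum>k<N. lev p w f k) + X \<le> e"
    using e(2) by (subst (asm) ennreal_le_iff) auto
  have X: "D * X \<le> \<delta>"
  proof -
    have "X \<le> \<delta> / D" using N X_le by linarith
    then show ?thesis using D by (simp add: field_simps)
  qed
  \<comment> \<open>The flow through \<open>l\<close> is w l * (res l * \<theta> l)^(p-1), so
    Young's inequality compares \<open>f l\<close> with the equilibrium value
    \<open>res l * \<theta> l\<close>.\<close>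
  have A: "(\<Sum>l | length l = k. \<kappa> l * res l powr (p - 1) * f l)
      \<le> lev p w f k / p + 2 * \<gamma> * lev p w (\<lambda>l. res l * \<theta> l) k" for k
  proof -
    have "\<kappa> l * res l powr (p - 1) * f l
        \<le> f l powr p * w l / p + 2 * \<gamma> * ((res l * \<theta> l) powr p * w l)" for l
    proof -
      have "\<kappa> l * res l powr (p - 1) * f l = w l * (f l * (res l * \<theta> l) powr (p - 1))"
        using res_pos[of l] \<theta>[of l] by (simp add: \<kappa>_eq powr_mult)
      also have "\<dots> \<le> w l * (f l powr p / p + 2 * \<gamma> * (res l * \<theta> l) powr p)"
        using w0 f res_pos[of l] \<theta>[of l] p powr_tangent[of p "f l" "res l * \<theta> l"]
        by (intro mult_left_mono) (auto simp: \<gamma>(2))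
      finally show ?thesis by (simp add: algebra_simps)
    qed
    then have "(\<Sum>l | length l = k. \<kappa> l * res l powr (p - 1) * f l)
      \<le> (\<Sum>l | length l = k. f l powr p * w l / p + 2 * \<gamma> * ((res l * \<theta> l) powr p * w l))"
      by (rule sum_mono)
    then show ?thesis
      by (simp add: lev_def sum.distrib sum_divide_distrib sum_distrib_left)
  qed
  have B: "(\<Sum>l | length l = N. \<kappa> l * res l powr (p - 1) * (1 - F l)) \<le> D * X + \<gamma> * rest N"
  proof -
    have "\<kappa> l * res l powr (p - 1) * (1 - F l)
        \<le> D * (\<kappa> l * (max 0 (1 - F l)) powr p) + \<gamma> * (\<kappa> l * res l powr p)" for l
    proof -
      have "\<kappa> l * res l powr (p - 1) * (1 - F l) \<le> \<kappa> l * res l powr (p - 1) * max 0 (1 - F l)"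
        by (intro mult_left_mono) auto
      also have "\<dots> = \<kappa> l * (max 0 (1 - F l) * res l powr (p - 1))" by simp
      also have "\<dots> \<le> \<kappa> l * (D * max 0 (1 - F l) powr p + \<gamma> * res l powr p)"
        using D(2)[of "max 0 (1 - F l)" "res l"] res_pos[of l] by (intro mult_left_mono) auto
      finally show ?thesis by (simp add: algebra_simps)
    qed
    then have "(\<Sum>l | length l = N. \<kappa> l * res l powr (p - 1) * (1 - F l))
        \<le> (\<Sum>l | length l = N. D * (\<kappa> l * (max 0 (1 - F l)) powr p) + \<gamma> * (\<kappa> l * res l powr p))"
      by (rule sum_mono)
    then show ?thesis by (simp add: X_def rest_def sum.distrib sum_distrib_left)
  qed
  have "rcap p w E \<le> (\<Sum>k<N. lev p w f k / p + 2 * \<gamma> * lev p w (\<lambda>l. res l * \<theta> l) k) + (D * X + \<gamma> * rest N)"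
    using flow_test[where N = N and f = f] add_mono[OF sum_mono[of "{..<N}", OF A] B] by (simp add: F_def)
  also have "\<dots> = (\<Sum>k<N. lev p w f k) / p + 2 * \<gamma> * (rcap p w E - rest N) + D * X + \<gamma> * rest N"
  proof -
    have "rcap p w E - rest N = (\<Sum>k<N. lev p w (\<lambda>l. res l * \<theta> l) k)" using rest_eq[of N] by simp
    then show ?thesis by (simp add: sum.distrib sum_divide_distrib sum_distrib_left)
  qed
  also have "\<dots> \<le> (rcap p w E + \<delta>) / p + 2 * \<gamma> * (rcap p w E - rest N) + \<delta> + \<gamma> * rest N"
  proof -
    have "0 \<le> X" by (simp add: X_def sum_nonneg)
    then have "(\<Sum>k<N. lev p w f k) \<le> rcap p w E + \<delta>"
      using X_le e_le by linarith
    then show ?thesis using X p by (intro add_mono divide_right_mono) auto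
  qed
  finally have "rcap p w E \<le> (1 / p + 2 * \<gamma>) * rcap p w E + \<delta> / p + \<delta> - \<gamma> * rest N"
    by (simp add: algebra_simps add_divide_distrib)
  moreover have "1 / p + 2 * \<gamma> = 1" using \<gamma> by simp
  moreover have "\<delta> / p < \<delta>" using \<delta> p by (simp add: field_simps)
  ultimately have "\<gamma> * rest N < 2 * \<delta>" by simp
  also have "\<dots> = \<gamma> * \<epsilon>" by (simp add: \<delta>_def)
  finally have "rest N < \<epsilon>" using \<gamma> by simp
  then show ?thesis ..
qed

text \<open>A word with \<open>res l < \<delta>\<close> lies on no branch of this set. At all other
  words of length \<open>N\<close> the factor (res l / \<delta>)^p is at least 1, so subadditivity
  over the level bounds the capacity by \<open>rest N / \<delta> powr p\<close>.\<close>

lemma tcap_res_ge: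
  assumes "0 < \<delta>"
  shows "tcap p w {s \<in> E. \<forall>k. \<delta> \<le> res (pre k s)} = 0"
proof -
  let ?A = "{s \<in> E. \<forall>k. \<delta> \<le> res (pre k s)}"
  have *: "rcap p w ?A \<le> rest N / \<delta> powr p" for N
  proof -
    have "rcap p (\<lambda>m. w (l @ m)) (subtree l ?A) \<le> \<kappa> l * res l powr p / \<delta> powr p" for l
    proof (cases "\<delta> \<le> res l")
      case True
      have "rcap p (\<lambda>m. w (l @ m)) (subtree l ?A) \<le> \<kappa> l"
        unfolding \<kappa>_def using w0 by (intro rcap_mono) (auto simp: subtree_def)
      also have "\<dots> = \<kappa> l * \<delta> powr p / \<delta> powr p" using assms by simp
      also have "\<dots> \<le> \<kappa> l * res l powr p / \<delta> powr p"
        using True assms p by (intro divide_right_mono mult_left_mono powr_mono2) auto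
      finally show ?thesis .
    next
      case False
      have "subtree l ?A = {}"
      proof -
        have "\<delta> \<le> res l" if "s \<in> subtree l ?A" for s
        proof -
          have "\<delta> \<le> res (pre (length l) (conc l s))" using that by (simp add: subtree_def)
          then show ?thesis by (simp add: pre_conc)
        qed
        then show ?thesis using False by blast
      qed
      then show ?thesis by simp
    qed
    then have "(\<Sum>l | length l = N. rcap p (\<lambda>m. w (l @ m)) (subtree l ?A))
       \<le> (\<Sum>l | length l = N. \<kappa> l * res l powr p / \<delta> powr p)" by (rule sum_mono)
    then show ?thesis
      using rcap_le_sum_words[of w p ?A N] w0 by (simp add: rest_def sum_divide_distrib)
  qed
  have "rcap p w ?A \<le> 0"
  proof (rule field_le_epsilon)
    fix e :: real assume "0 < e"
    then have "0 < e * \<delta> powr p" using assms by simp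
    from rest_small[OF this] obtain N where "rest N < e * \<delta> powr p" ..
    then have "rest N / \<delta> powr p < e" using assms by (simp add: pos_divide_less_eq)
    then show "rcap p w ?A \<le> 0 + e" using * [of N] by linarith
  qed
  then have "rcap p w ?A = 0" using rcap_nonneg[of p w ?A] by linarith
  then show ?thesis using ennreal_rcap[of w p ?A] w0 by simp
qed

end

text \<open>A variant of Kronecker's lemma. Beyond \<open>m\<close>, monotonicity bounds \<phi> k
  times the sum of d by a small tail of the convergent series. Divergence of the sum of d makes the
  block before \<open>m\<close> at most half of every later partial sum, so it costs only a factor
  2.\<close>

lemma monotone_mult_partial_sums_tendsto_0:
  fixes \<phi> d :: "nat \<Rightarrow> real"
  assumes \<phi>: "decseq \<phi>" "\<And>k. 0 \<le> \<phi> k" and d: "\<And>k. 0 \<le> d k"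
    and s: "summable (\<lambda>k. \<phi> k * d k)" and ns: "\<not> summable d"
  shows "(\<lambda>k. \<phi> k * (\<Sum>i<k. d i)) \<longlonglongrightarrow> 0"
proof (rule LIMSEQ_I)
  fix e :: real assume "0 < e"
  then have "0 < e / 2" by simp
  from suminf_exist_split[OF this s] obtain m
    where m: "\<And>n. m \<le> n \<Longrightarrow> norm (\<Sum>i. \<phi> (i + n) * d (i + n)) < e / 2" by blast
  have A: "\<phi> k * (\<Sum>i\<in>{m..<k}. d i) < e / 2" for k
  proof -
    have "\<phi> k * (\<Sum>i\<in>{m..<k}. d i) \<le> (\<Sum>i\<in>{m..<k}. \<phi> i * d i)"
      unfolding sum_distrib_left using \<phi> d
      by (intro sum_mono mult_right_mono) (auto simp: decseq_def)
    also have "\<dots> = (\<Sum>i\<in>{0..<k - m}. \<phi> (i + m) * d (i + m))"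
      by (rule sum.reindex_bij_witness[of _ "\<lambda>i. i + m" "\<lambda>i. i - m"]) auto
    also have "\<dots> \<le> (\<Sum>i. \<phi> (i + m) * d (i + m))"
      using \<phi> d s by (intro sum_le_suminf) (auto simp: summable_iff_shift[of "\<lambda>k. \<phi> k * d k" m])
    finally show ?thesis using m[of m] by simp
  qed
  define T where "T = (\<Sum>i<m. d i)"
  have "\<exists>K. 2 * T \<le> (\<Sum>i<K. d i)"
  proof (rule ccontr)
    assume "\<nexists>K. 2 * T \<le> (\<Sum>i<K. d i)"
    then have "summable d"
      using d by (intro summableI_nonneg_bounded[where x = "2 * T"]) (auto simp: not_le intro: less_imp_le)
    then show False using ns by simp
  qed
  then obtain K where K: "2 * T \<le> (\<Sum>i<K. d i)" ..
  show "\<exists>N. \<forall>k\<ge>N. norm (\<phi> k * (\<Sum>i<k. d i) - 0) < e"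
  proof (intro exI[of _ "max K m"] allI impI)
    fix k assume k: "max K m \<le> k"
    have split: "(\<Sum>i<k. d i) = T + (\<Sum>i\<in>{m..<k}. d i)"
      using k sum.atLeastLessThan_concat[of 0 m k d] by (simp add: T_def lessThan_atLeast0)
    have "(\<Sum>i<K. d i) \<le> (\<Sum>i<k. d i)" using k d by (intro sum_mono2) auto
    then have "T \<le> (\<Sum>i\<in>{m..<k}. d i)" using K split by linarith
    then have "\<phi> k * T \<le> \<phi> k * (\<Sum>i\<in>{m..<k}. d i)" using \<phi> by (intro mult_left_mono) auto
    then have "\<phi> k * (\<Sum>i<k. d i) < e"
      using A[of k] by (simp add: split distrib_left)
    moreover have "0 \<le> \<phi> k * (\<Sum>i<k. d i)" using \<phi> d by (simp add: sum_nonneg)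
    ultimately show "norm (\<phi> k * (\<Sum>i<k. d i) - 0) < e" by simp
  qed
qed

text \<open>Past an index where the tail sum is below 1/2, Weierstrass' inequality keeps the
  remaining product above 1/2; the finitely many earlier factors are positive.\<close>

lemma prod_one_minus_bounded_below:
  fixes \<theta> :: "nat \<Rightarrow> real"
  assumes \<theta>: "\<And>k. 0 \<le> \<theta> k" "\<And>k. \<theta> k < 1" and s: "summable \<theta>"
  shows "\<exists>\<delta>>0. \<forall>k. \<delta> \<le> (\<Prod>i<k. 1 - \<theta> i)"
proof -
  have "0 < (1 / 2 :: real)" by simp
  from suminf_exist_split[OF this s] obtain m
    where m: "\<And>n. m \<le> n \<Longrightarrow> norm (\<Sum>i. \<theta> (i + n)) < 1 / 2" by blast
  have A: "(\<Prod>i<m. 1 - \<theta> i) / 2 \<le> (\<Prod>i<k + m. 1 - \<theta> i)" for k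
  proof -
    have "(\<Sum>i<k. \<theta> (i + m)) \<le> (\<Sum>i. \<theta> (i + m))"
      using \<theta> s by (intro sum_le_suminf) (auto simp: summable_iff_shift[of \<theta> m])
    then have "1 / 2 \<le> 1 - (\<Sum>i<k. \<theta> (i + m))" using m[of m] by simp
    also have "\<dots> \<le> (\<Prod>i<k. 1 - \<theta> (i + m))"
      using \<theta> by (intro Weierstrass_prod_ineq) (auto intro: less_imp_le)
    finally have "(\<Prod>i<m. 1 - \<theta> i) * (1 / 2) \<le> (\<Prod>i<m. 1 - \<theta> i) * (\<Prod>i<k. 1 - \<theta> (i + m))"
      using \<theta> by (intro mult_left_mono prod_nonneg) (auto intro: less_imp_le)
    also have "\<dots> = (\<Prod>i<k + m. 1 - \<theta> i)"
      using prod.atLeastLessThan_concat[of 0 m "k + m" "\<lambda>i. 1 - \<theta> i"]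
        prod.shift_bounds_nat_ivl[of "\<lambda>i. 1 - \<theta> i" 0 m k]
      by (simp add: lessThan_atLeast0)
    finally show ?thesis by simp
  qed
  have "(\<Prod>i<m. 1 - \<theta> i) / 2 \<le> (\<Prod>i<k. 1 - \<theta> i)" for k
  proof -
    have "(\<Prod>i<m. 1 - \<theta> i) / 2 \<le> (\<Prod>i<k + m. 1 - \<theta> i)" by (rule A)
    also have "\<dots> \<le> (\<Prod>i<k. 1 - \<theta> i)"
    proof -
      have "(\<Prod>i<k + m. 1 - \<theta> i) = (\<Prod>i<k. 1 - \<theta> i) * (\<Prod>i\<in>{k..<k + m}. 1 - \<theta> i)"
        using prod.atLeastLessThan_concat[of 0 k "k + m" "\<lambda>i. 1 - \<theta> i"] by (simp add: lessThan_atLeast0)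
      also have "\<dots> \<le> (\<Prod>i<k. 1 - \<theta> i) * 1"
        using \<theta> by (intro mult_left_mono prod_nonneg prod_le_1) (auto intro: less_imp_le)
      finally show ?thesis by simp
    qed
    finally show ?thesis .
  qed
  moreover have "0 < (\<Prod>i<m. 1 - \<theta> i) / 2" using \<theta> by (simp add: prod_pos)
  ultimately show ?thesis by blast
qed

text \<open>Young's inequality against b = (\<tau> v)^(-1/(p-1)), the value with b^(p-1) = 1 /
  (\<tau> v). It replaces Hoelder's inequality: sums or integrals of x are bounded by an energy and
  a dual weight, with \<tau> free to balance them.\<close>

lemma young_weight:
  fixes p x v \<tau> :: real
  assumes p: "1 < p" and "0 < \<tau>" "0 \<le> x" "0 < v"
  shows "x \<le> \<tau> * (x powr p * v) + (\<tau> * v) powr (- 1 / (p - 1))"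
proof -
  define q where "q = 1 / (p - 1)"
  define b where "b = (\<tau> * v) powr (- q)"
  have tv: "0 < \<tau> * v" using assms by simp
  have qp: "q * (p - 1) = 1" using p by (simp add: q_def)
  then have e: "- q * (p - 1) = - 1" "- q * p = - 1 + - q" by (simp_all add: algebra_simps)
  have "b powr (p - 1) = (\<tau> * v) powr - 1" "b powr p = (\<tau> * v) powr - 1 * (\<tau> * v) powr - q"
    unfolding b_def powr_powr e by (simp_all only: powr_add)
  then have b: "b powr (p - 1) = 1 / (\<tau> * v)" "b powr p = (1 / (\<tau> * v)) * b" "0 < b"
    using assms by (simp_all add: b_def powr_minus_divide)
  have "x * (1 / (\<tau> * v)) \<le> x powr p / p + (1 - 1 / p) * ((1 / (\<tau> * v)) * b)"
    using powr_tangent[of p x b] p assms b by simp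
  also have "\<dots> \<le> x powr p + (1 / (\<tau> * v)) * b"
  proof (intro add_mono)
    show "x powr p / p \<le> x powr p" using p by (simp add: divide_le_eq mult_left_mono[of 1 p "x powr p", simplified])
    have "(1 - 1 / p) * ((1 / (\<tau> * v)) * b) \<le> 1 * ((1 / (\<tau> * v)) * b)"
      using p tv b by (intro mult_right_mono) auto
    then show "(1 - 1 / p) * ((1 / (\<tau> * v)) * b) \<le> (1 / (\<tau> * v)) * b" by simp
  qed
  finally have "x * (1 / (\<tau> * v)) * (\<tau> * v) \<le> (x powr p + (1 / (\<tau> * v)) * b) * (\<tau> * v)"
    using tv by (intro mult_right_mono) auto
  moreover have "x * (1 / (\<tau> * v)) * (\<tau> * v) = x"
    "(x powr p + (1 / (\<tau> * v)) * b) * (\<tau> * v) = \<tau> * (x powr p * v) + b"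
    using assms by (simp_all add: field_simps)
  ultimately show ?thesis by (simp add: b_def q_def)
qed

section \<open>Capacity inside a subtree against capacity measured from the root\<close>

context word_tree
begin

definition q :: real where "q = 1 / (p - 1)"

lemma q_pos: "0 < q"
  using p by (simp add: q_def)

lemma young_w:
  assumes "0 < \<tau>" "0 \<le> x" "0 < v"
  shows "x \<le> \<tau> * (x powr p * v) + (\<tau> * v) powr (- q)"
  using young_weight[OF p assms] by (simp add: q_def)

text \<open>By \<open>young_w\<close> the hypothesis prevents a near-minimal competitor for the
  branches through \<open>l\<close> from collecting more than 1/2 on the ancestors of
  \<open>l\<close>. It then owes at least 1/2 inside the subtree, which explains the factor
  2^p.\<close>

lemma \<kappa>_le_root:
  assumes "rcap p w {s \<in> E. pre (length l) s = l} powr q * (\<Sum>i<length l. w (take i l) powr (- q)) < 4 powr (- q - 1)"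
  shows "\<kappa> l \<le> 2 powr p * rcap p w {s \<in> E. pre (length l) s = l}"
proof -
  define A where "A = {s \<in> E. pre (length l) s = l}"
  define r where "r = rcap p w A"
  define T where "T = (\<Sum>i<length l. w (take i l) powr (- q))"
  have r0: "0 \<le> r" by (simp add: r_def)
  \<comment> \<open>The bound u stays strictly above r, both because only near-minimal competitors
    exist and because r may be 0, where the choice of \<tau> would break down. At the end u tends to
    r from the right.\<close>
  have *: "\<kappa> l \<le> 2 powr p * u" if u: "r < u" "u powr q * T < 4 powr (- q - 1)" for u
  proof -
    have u0: "0 < u" using r0 u by linarith
    obtain f where f: "\<And>l. 0 \<le> f l" "\<And>s. s \<in> A \<Longrightarrow> 1 \<le> pot f s"
      "energy p w f \<le> tcap p w A + ennreal (u - r)"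
      using tcap_near[of p w A "u - r"] u tcap_finite[of w p A] w0 by auto
    have "tcap p w A = ennreal r"
      using ennreal_rcap[of w p A] w0 by (simp add: r_def)
    then have "tcap p w A + ennreal (u - r) = ennreal u"
      using r0 u by (simp flip: ennreal_plus)
    then have en: "energy p w f \<le> ennreal u" using f by simp
    define F where "F = (\<Sum>i<length l. f (take i l))"
    have lev0: "0 \<le> lev p w f k" for k using w0 by (rule lev_nonneg)
    have split: "energy p w f = ennreal (\<Sum>k<length l. lev p w f k)
       + (\<Sum>m | length m = length l. energy p (\<lambda>n. w (m @ n)) (\<lambda>n. f (m @ n)))"
      using energy_split[of w p f "length l"] w0 by simp
    have "ennreal (\<Sum>k<length l. lev p w f k) \<le> ennreal u"
      by (rule order_trans[OF _ en]) (simp add: split)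
    then have levu: "(\<Sum>k<length l. lev p w f k) \<le> u" using u0 by (subst (asm) ennreal_le_iff) auto
    \<comment> \<open>The energy term becomes \<tau> * u = 1/4. The threshold 4^(-q-1) is what makes
      the other term at most 1/4 as well, since \<tau>^(-q) = (4 u)^q.\<close>
    define \<tau> where "\<tau> = 1 / (4 * u)"
    have \<tau>: "0 < \<tau>" using u0 by (simp add: \<tau>_def)
    have "F \<le> (\<Sum>i<length l. \<tau> * (f (take i l) powr p * w (take i l)) + (\<tau> * w (take i l)) powr (- q))"
      unfolding F_def using \<tau> f w by (intro sum_mono young_w) auto
    also have "\<dots> \<le> (\<Sum>i<length l. \<tau> * lev p w f i + \<tau> powr (- q) * w (take i l) powr (- q))"
    proof (intro sum_mono add_mono mult_left_mono)
      fix i assume "i \<in> {..<length l}"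
      then have "length (take i l) = i" by simp
      then show "f (take i l) powr p * w (take i l) \<le> lev p w f i"
        unfolding lev_def using w0 by (intro member_le_sum[of _ _ "\<lambda>l. f l powr p * w l"]) (auto simp: finite_words)
      show "(\<tau> * w (take i l)) powr (- q) \<le> \<tau> powr (- q) * w (take i l) powr (- q)"
        using \<tau> w0[of "take i l"] by (simp add: powr_mult)
    qed (use \<tau> in auto)
    also have "\<dots> = \<tau> * (\<Sum>i<length l. lev p w f i) + \<tau> powr (- q) * T"
      by (simp add: sum.distrib sum_distrib_left T_def)
    also have "\<dots> \<le> \<tau> * u + \<tau> powr (- q) * T"
      using levu \<tau> by (intro add_mono mult_left_mono) auto
    also have "\<tau> * u = 1 / 4" using u0 by (simp add: \<tau>_def)
    also have "\<tau> powr (- q) * T = 4 powr q * (u powr q * T)"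
      using u0 by (simp add: \<tau>_def powr_minus_divide powr_mult powr_divide)
    also have "\<dots> \<le> 4 powr q * 4 powr (- q - 1)"
      using u by (intro mult_left_mono) auto
    also have "\<dots> = 1 / 4" by (simp add: powr_add[symmetric] powr_minus_divide)
    finally have F: "F \<le> 1 / 2" by simp
    have "subtree l A = subtree l E"
      by (auto simp: subtree_def A_def pre_conc)
    have "ennreal ((max 0 (1 - F)) powr p * \<kappa> l) \<le> energy p (\<lambda>m. w (l @ m)) (\<lambda>m. f (l @ m))"
      using rcap_split_lower[of w f A l p] w0 f by (simp add: F_def \<kappa>_def \<open>subtree l A = subtree l E\<close>)
    also have "\<dots> \<le> (\<Sum>m | length m = length l. energy p (\<lambda>n. w (m @ n)) (\<lambda>n. f (m @ n)))"
      by (intro member_le_sum[of l _ "\<lambda>m. energy p (\<lambda>n. w (m @ n)) (\<lambda>n. f (m @ n))"]) (auto simp: finite_words)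
    also have "\<dots> \<le> energy p w f" unfolding split by simp
    finally have "ennreal ((max 0 (1 - F)) powr p * \<kappa> l) \<le> ennreal u" using en by simp
    then have "(max 0 (1 - F)) powr p * \<kappa> l \<le> u" using u0 by (subst (asm) ennreal_le_iff) auto
    moreover have "(1 / 2) powr p * \<kappa> l \<le> (max 0 (1 - F)) powr p * \<kappa> l"
      using F p by (intro mult_right_mono powr_mono2) auto
    ultimately have "(1 / 2) powr p * \<kappa> l \<le> u" by linarith
    then show ?thesis by (simp add: powr_divide field_simps)
  qed
  have "((\<lambda>u. u powr q * T) \<longlongrightarrow> r powr q * T) (at_right r)"
    using q_pos r0 by (intro tendsto_mult tendsto_powr' tendsto_intros) (auto simp: eventually_at_filter)
  then have "\<forall>\<^sub>F u in at_right r. u powr q * T < 4 powr (- q - 1)"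
    using assms by (intro order_tendstoD) (auto simp: r_def A_def T_def)
  moreover have "\<forall>\<^sub>F u in at_right r. r < u" by (simp add: eventually_at_filter)
  ultimately have "\<forall>\<^sub>F u in at_right r. \<kappa> l \<le> 2 powr p * u"
    by eventually_elim (rule *)
  moreover have "((\<lambda>u. 2 powr p * u) \<longlongrightarrow> 2 powr p * r) (at_right r)"
    by (intro tendsto_intros)
  ultimately have "\<kappa> l \<le> 2 powr p * r"
    by (intro tendsto_lowerbound[where F = "at_right r"]) auto
  then show ?thesis by (simp add: r_def A_def)
qed

text \<open>Both halves of thinness meet here. The Kronecker lemma with \<phi> = r^q and d = w^(-q)
  gives the hypothesis of \<open>\<kappa>_le_root\<close> for all large k. Hence \<theta> is
  dominated along the branch by a summable sequence, and the product of the 1 - \<theta> stays away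
  from 0.\<close>

lemma res_bounded_below:
  fixes s :: "nat \<Rightarrow> 'a"
  defines "r \<equiv> \<lambda>k. rcap p w {s' \<in> E. pre k s' = pre k s}"
  assumes sm: "summable (\<lambda>k. (r k / w (pre k s)) powr q)"
    and ns: "\<not> summable (\<lambda>k. w (pre k s) powr (- q))"
  shows "\<exists>\<delta>>0. \<forall>k. \<delta> \<le> res (pre k s)"
proof -
  have r0: "0 \<le> r k" for k by (simp add: r_def)
  have dec: "r (Suc k) \<le> r k" for k
    unfolding r_def using w0 by (intro rcap_mono) (auto simp: pre_Suc)
  have eq: "(r k / w (pre k s)) powr q = r k powr q * w (pre k s) powr (- q)" for k
    using r0[of k] w0[of "pre k s"] by (simp add: powr_divide powr_minus_divide)
  have "(\<lambda>k. r k powr q * (\<Sum>i<k. w (pre i s) powr (- q))) \<longlonglongrightarrow> 0"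
    using sm ns r0 dec q_pos unfolding eq
    by (intro monotone_mult_partial_sums_tendsto_0 decseq_SucI powr_mono2) auto
  then have "\<forall>\<^sub>F k in sequentially. r k powr q * (\<Sum>i<k. w (pre i s) powr (- q)) < 4 powr (- q - 1)"
    by (rule order_tendstoD) simp
  then have "\<forall>\<^sub>F k in sequentially. norm (\<theta> (pre k s)) \<le> (2 powr p) powr q * (r k / w (pre k s)) powr q"
  proof eventually_elim
    case (elim k)
    have "(\<Sum>i<k. w (pre i s) powr (- q)) = (\<Sum>i<length (pre k s). w (take i (pre k s)) powr (- q))"
      by (intro sum.cong) (auto simp: take_pre)
    then have "\<kappa> (pre k s) \<le> 2 powr p * r k"
      using elim \<kappa>_le_root[of "pre k s"] by (simp add: r_def)
    then have "(\<kappa> (pre k s) / w (pre k s)) powr q \<le> (2 powr p * r k / w (pre k s)) powr q"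
      using w0[of "pre k s"] q_pos by (intro powr_mono2 divide_right_mono divide_nonneg_nonneg) auto
    also have "\<dots> = (2 powr p) powr q * (r k / w (pre k s)) powr q"
      using r0[of k] w0[of "pre k s"] by (simp add: powr_mult powr_divide)
    finally show ?case
      using \<theta>[of "pre k s"] by (simp add: \<theta>_def share_def \<kappa>_def q_def)
  qed
  then have "summable (\<lambda>k. \<theta> (pre k s))"
    by (rule summable_comparison_test_ev) (intro summable_mult sm)
  then obtain \<delta> where \<delta>: "\<delta> > 0" "\<And>k. \<delta> \<le> (\<Prod>i<k. 1 - \<theta> (pre i s))"
    using prod_one_minus_bounded_below[of "\<lambda>k. \<theta> (pre k s)"] \<theta> by blast
  have "res (pre k s) = (\<Prod>i<k. 1 - \<theta> (pre i s))" for k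
    unfolding res_def by (intro prod.cong) (auto simp: take_pre)
  then show ?thesis using \<delta> by auto
qed

end

section \<open>Maximal functions of laminar families\<close>

definition laminar :: "'a set set \<Rightarrow> bool" where
  "laminar F \<longleftrightarrow> (\<forall>P\<in>F. \<forall>Q\<in>F. P \<inter> Q = {} \<or> P \<subseteq> Q \<or> Q \<subseteq> P)"

text \<open>Inserting the empty set makes the maximum range over a nonempty set and contributes the
  value 0, whatever \<open>A {}\<close> is.\<close>

definition lmax :: "'a set set \<Rightarrow> ('a set \<Rightarrow> real) \<Rightarrow> 'a \<Rightarrow> real" where
  "lmax F A x = Max ((\<lambda>P. A P * indicat_real P x) ` insert {} F)"

lemma lmax_nonneg: "finite F \<Longrightarrow> 0 \<le> lmax F A x"
  unfolding lmax_def by (intro Max_ge) auto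

lemma lmax_ge: "finite F \<Longrightarrow> P \<in> F \<Longrightarrow> x \<in> P \<Longrightarrow> A P \<le> lmax F A x"
  unfolding lmax_def by (intro Max_ge) (auto intro!: image_eqI[of _ _ P])

lemma lmax_cases:
  assumes "finite F"
  obtains "lmax F A x = 0" | P where "P \<in> F" "x \<in> P" "lmax F A x = A P"
proof -
  have "lmax F A x \<in> (\<lambda>P. A P * indicat_real P x) ` insert {} F"
    unfolding lmax_def using assms by (intro Max_in) auto
  then obtain P where P: "P \<in> insert {} F" "lmax F A x = A P * indicat_real P x" by (rule imageE)
  show ?thesis
  proof (cases "x \<in> P")
    case True
    then show ?thesis using P by (intro that(2)[of P]) auto
  next
    case False
    then show ?thesis using P by (intro that(1)) auto
  qed
qed

lemma lmax_measurable [measurable]: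
  assumes "finite F" "F \<subseteq> sets M"
  shows "lmax F A \<in> borel_measurable M"
  unfolding lmax_def using assms by (intro borel_measurable_Max borel_measurable_times borel_measurable_indicator) auto

text \<open>The maximal members with A P > 2t are disjoint by laminarity, so no covering constant
  appears. On each of them g \<le> g 1_{g > t} + t, and the term t absorbs half of 2t |P|;
  finiteness of the measure permits the subtraction.\<close>

lemma laminar_weak_type:
  fixes g :: "'a \<Rightarrow> real"
  assumes F: "finite F" "laminar F" "F \<subseteq> sets M" "\<And>P. P \<in> F \<Longrightarrow> emeasure M P < \<infinity>"
    and g [measurable]: "g \<in> borel_measurable M"
    and A: "\<And>P. P \<in> F \<Longrightarrow> ennreal (A P) * emeasure M P \<le> (\<integral>\<^sup>+x\<in>P. ennreal (g x) \<partial>M)"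
    and t: "0 < t"
  shows "ennreal t * emeasure M {x \<in> space M. 2 * t < lmax F A x}
    \<le> (\<integral>\<^sup>+x. ennreal (g x) * indicator {x. t < g x} x \<partial>M)"
proof -
  define F' where "F' = {P \<in> F. 2 * t < A P}"
  define G where "G = {P \<in> F'. \<forall>Q\<in>F'. P \<subseteq> Q \<longrightarrow> Q = P}"
  have fin: "finite F'" "finite G" using F by (auto simp: F'_def G_def)
  have G_sets: "P \<in> sets M" if "P \<in> G" for P using that F by (auto simp: G_def F'_def)
  have sub: "{x \<in> space M. 2 * t < lmax F A x} \<subseteq> \<Union>G"
  proof
    fix x assume "x \<in> {x \<in> space M. 2 * t < lmax F A x}"
    then obtain P where P: "P \<in> F'" "x \<in> P"
      using t by (cases rule: lmax_cases[OF F(1), of A x]) (auto simp: F'_def)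
    obtain Q where Q: "Q \<in> F'" "P \<subseteq> Q" "\<forall>R\<in>F'. Q \<subseteq> R \<longrightarrow> R = Q"
      using finite_has_maximal2[OF fin(1) P(1)] by auto
    then show "x \<in> \<Union>G" using P by (auto simp: G_def)
  qed
  have disj: "disjoint_family_on (\<lambda>P. P) G"
    unfolding disjoint_family_on_def
  proof (intro ballI impI)
    fix P Q assume PQ: "P \<in> G" "Q \<in> G" "P \<noteq> Q"
    then have "\<not> P \<subseteq> Q" "\<not> Q \<subseteq> P" "P \<in> F" "Q \<in> F" by (auto simp: G_def F'_def)
    then show "P \<inter> Q = {}" using F(2) by (auto simp: laminar_def)
  qed
  let ?h = "\<lambda>x. ennreal (g x) * indicator {x. t < g x} x"
  have one: "ennreal t * emeasure M P \<le> (\<integral>\<^sup>+x. ?h x * indicator P x \<partial>M)" if "P \<in> G" for P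
  proof -
    have P: "P \<in> F" "2 * t < A P" using that by (auto simp: G_def F'_def)
    then have [measurable]: "P \<in> sets M" using F by auto
    have "ennreal t * emeasure M P + ennreal t * emeasure M P = ennreal (2 * t) * emeasure M P"
      using t by (simp add: distrib_right[symmetric] ennreal_plus[symmetric] del: ennreal_plus)
    also have "\<dots> \<le> ennreal (A P) * emeasure M P"
      using P by (intro mult_right_mono ennreal_leI) auto
    also have "\<dots> \<le> (\<integral>\<^sup>+x\<in>P. ennreal (g x) \<partial>M)" by (rule A) fact
    also have "\<dots> \<le> (\<integral>\<^sup>+x. ?h x * indicator P x + ennreal t * indicator P x \<partial>M)"
      by (intro nn_integral_mono) (auto simp: indicator_def intro: ennreal_leI)
    also have "\<dots> = (\<integral>\<^sup>+x. ?h x * indicator P x \<partial>M) + ennreal t * emeasure M P"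
      by (subst nn_integral_add) (auto simp: nn_integral_cmult_indicator)
    finally show ?thesis
      using F(4)[OF P(1)] by (auto simp: ennreal_add_left_cancel_le add.commute ennreal_mult_eq_top_iff)
  qed
  have "ennreal t * emeasure M {x \<in> space M. 2 * t < lmax F A x} \<le> ennreal t * emeasure M (\<Union>G)"
    using sub fin G_sets by (intro mult_left_mono emeasure_mono) auto
  also have "emeasure M (\<Union>G) = (\<Sum>P\<in>G. emeasure M P)"
  proof -
    have "G \<subseteq> sets M" using G_sets by blast
    then show ?thesis using sum_emeasure[of "\<lambda>P. P" G M] fin disj by simp
  qed
  also have "ennreal t * \<dots> = (\<Sum>P\<in>G. ennreal t * emeasure M P)"
    by (simp add: sum_distrib_left)
  also have "\<dots> \<le> (\<Sum>P\<in>G. \<integral>\<^sup>+x. ?h x * indicator P x \<partial>M)"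
    by (intro sum_mono one)
  also have "\<dots> = (\<integral>\<^sup>+x. (\<Sum>P\<in>G. ?h x * indicator P x) \<partial>M)"
    using G_sets by (subst nn_integral_sum) (auto intro!: borel_measurable_times_ennreal)
  also have "\<dots> = (\<integral>\<^sup>+x. ?h x * indicator (\<Union>G) x \<partial>M)"
    using fin disj by (simp add: sum_distrib_left[symmetric] indicator_UN_disjoint[of G "\<lambda>P. P", simplified])
  also have "\<dots> \<le> (\<integral>\<^sup>+x. ?h x \<partial>M)"
    by (intro nn_integral_mono) (auto simp: indicator_def)
  finally show ?thesis .
qed

text \<open>A discrete layer-cake formula: the levels below t form a geometric progression, which is
  comparable with its last term. It spares the integration over a continuous level
  parameter.\<close>

lemma geometric_levels:
  fixes s r t :: real
  assumes "0 < s" "0 < r" "0 \<le> t"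
  shows "(\<Sum>i<K. if s * 2 ^ i < t then (s * 2 ^ i) powr r else 0) \<le> 2 powr r / (2 powr r - 1) * t powr r"
proof -
  define B where "B = 2 powr r / (2 powr r - 1)"
  have r2: "1 < 2 powr r" using assms by simp
  then have B: "0 < B" "B / 2 powr r + 1 = B"
  proof -
    have "B / 2 powr r = 1 / (2 powr r - 1)" using r2 assms by (simp add: B_def)
    then show "0 < B" "B / 2 powr r + 1 = B" using r2 assms by (simp_all add: B_def divide_simps)
  qed
  have closed: "(\<Sum>i\<le>j. (s * 2 ^ i) powr r) \<le> B * (s * 2 ^ j) powr r" for j
  proof (induction j)
    case 0
    have "1 \<le> B" using r2 by (simp add: B_def le_divide_eq)
    then show ?case using mult_right_mono[of 1 B "s powr r"] by simp
  next
    case (Suc j)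
    have "(s * 2 ^ Suc j) powr r = 2 powr r * (s * 2 ^ j) powr r"
      using assms by (simp add: powr_mult[symmetric] mult_ac)
    then have "(s * 2 ^ j) powr r = (s * 2 ^ Suc j) powr r / 2 powr r" by simp
    then have "(\<Sum>i\<le>Suc j. (s * 2 ^ i) powr r) \<le> B * ((s * 2 ^ Suc j) powr r / 2 powr r) + (s * 2 ^ Suc j) powr r"
      using Suc by simp
    also have "\<dots> = (B / 2 powr r + 1) * (s * 2 ^ Suc j) powr r" by (simp add: algebra_simps)
    finally show ?case using B by simp
  qed
  show ?thesis unfolding B_def[symmetric]
  proof (induction K)
    case (Suc K)
    show ?case
    proof (cases "s * 2 ^ K < t")
      case True
      have "(\<Sum>i<Suc K. if s * 2 ^ i < t then (s * 2 ^ i) powr r else 0) \<le> (\<Sum>i\<le>K. (s * 2 ^ i) powr r)"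
        unfolding lessThan_Suc_atMost by (intro sum_mono) auto
      also have "\<dots> \<le> B * (s * 2 ^ K) powr r" by (rule closed)
      also have "\<dots> \<le> B * t powr r" using True assms B by (intro mult_left_mono powr_mono2) auto
      finally show ?thesis .
    qed (use Suc in auto)
  qed (use B assms in auto)
qed

text \<open>In 4^p, one factor 2^p comes from the level 2t of the weak type estimate and one from
  rounding to dyadic levels. The other factor is the geometric series with ratio 2^(1-p).\<close>

definition doob_const :: "real \<Rightarrow> real" where
  "doob_const p = 4 powr p * (2 powr (p - 1) / (2 powr (p - 1) - 1))"

lemma doob_const_nonneg: "1 < p \<Longrightarrow> 0 \<le> doob_const p"
  unfolding doob_const_def by (intro mult_nonneg_nonneg divide_nonneg_nonneg) (auto simp: ge_one_powr_ge_zero)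

lemma laminar_maximal:
  fixes g :: "'a \<Rightarrow> real"
  assumes p: "1 < p"
    and F: "finite F" "laminar F" "F \<subseteq> sets M" "\<And>P. P \<in> F \<Longrightarrow> emeasure M P < \<infinity>"
    and g [measurable]: "g \<in> borel_measurable M" and g0: "\<And>x. 0 \<le> g x"
    and A0: "\<And>P. P \<in> F \<Longrightarrow> 0 \<le> A P"
    and A: "\<And>P. P \<in> F \<Longrightarrow> ennreal (A P) * emeasure M P \<le> (\<integral>\<^sup>+x\<in>P. ennreal (g x) \<partial>M)"
  shows "(\<integral>\<^sup>+x. ennreal (lmax F A x powr p) \<partial>M) \<le> ennreal (doob_const p) * (\<integral>\<^sup>+x. ennreal (g x powr p) \<partial>M)"
proof -
  define N where "N = insert 1 (A ` {P \<in> F. 0 < A P})"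
  have N: "finite N" "N \<noteq> {}" "\<And>v. v \<in> N \<Longrightarrow> 0 < v" using F by (auto simp: N_def)
  \<comment> \<open>The finite family takes finitely many positive values, all in \<open>N\<close>.
    The levels 2 s 2^i start below the least of them and by i = K pass the largest, so every
    positive value lies within a factor 2 above one of the levels with i < K.\<close>
  define s where "s = Min N / 3"
  have s: "0 < s" "\<And>v. v \<in> N \<Longrightarrow> 2 * s < v"
  proof -
    have "0 < Min N" using N by simp
    then show "0 < s" "\<And>v. v \<in> N \<Longrightarrow> 2 * s < v"
      using Min_le[OF N(1)] unfolding s_def by (auto, fastforce)
  qed
  obtain K where K: "Max N / (2 * s) < 2 ^ K" using real_arch_pow[of 2 "Max N / (2 * s)"] by auto
  have top: "v < 2 * (s * 2 ^ K)" if "v \<in> N" for v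
  proof -
    have "v \<le> Max N" using that N by simp
    also have "\<dots> < 2 * (s * 2 ^ K)" using K s by (simp add: field_simps)
    finally show ?thesis .
  qed
  let ?l = "\<lambda>i. s * 2 ^ i"
  have pt: "ennreal (lmax F A x powr p)
      \<le> (\<Sum>i<K. ennreal (4 powr p * ?l i powr p) * indicator {x \<in> space M. 2 * ?l i < lmax F A x} x)"
    if x: "x \<in> space M" for x
  proof (cases "lmax F A x = 0")
    case False
    then obtain P where P: "P \<in> F" "x \<in> P" "lmax F A x = A P"
      by (cases rule: lmax_cases[OF F(1), of A x]) auto
    define v where "v = A P"
    have "v \<noteq> 0" using False P v_def by simp
    then have v: "v \<in> N" using A0[OF P(1)] P(1) by (auto simp: N_def v_def)
    define j where "j = Max {i. i < K \<and> 2 * ?l i < v}"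
    have K0: "0 < K"
      using top[OF v] s(2)[OF v] by (cases K) auto
    have ne: "{i. i < K \<and> 2 * ?l i < v} \<noteq> {}" using K0 s(2)[OF v] by (auto intro!: exI[of _ 0])
    have fin: "finite {i. i < K \<and> 2 * ?l i < v}" by auto
    have j: "j < K" "2 * ?l j < v" using Max_in[OF fin ne] by (auto simp: j_def)
    have "v \<le> 2 * ?l (Suc j)"
    proof (cases "Suc j < K")
      case True
      show ?thesis
      proof (rule ccontr)
        assume "\<not> ?thesis"
        then have "Suc j \<le> j" unfolding j_def using True by (intro Max_ge[OF fin]) (auto simp: j_def[symmetric])
        then show False by simp
      qed
    next
      case False
      then have "Suc j = K" using j by simp
      then show ?thesis using top[OF v] by simp
    qed
    then have "v \<le> 4 * ?l j" by simp
    moreover have "0 < v" using N v by simp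
    ultimately have "v powr p \<le> (4 * ?l j) powr p" using p by (intro powr_mono2) auto
    also have "\<dots> = 4 powr p * ?l j powr p" using s by (simp add: powr_mult)
    finally have "ennreal (lmax F A x powr p) \<le> ennreal (4 powr p * ?l j powr p) * indicator {x \<in> space M. 2 * ?l j < lmax F A x} x"
      using j x P by (simp add: v_def ennreal_leI)
    also have "\<dots> \<le> (\<Sum>i<K. ennreal (4 powr p * ?l i powr p) * indicator {x \<in> space M. 2 * ?l i < lmax F A x} x)"
      using j by (intro member_le_sum[of j]) auto
    finally show ?thesis .
  qed simp
  have meas [measurable]: "lmax F A \<in> borel_measurable M" using F by (intro lmax_measurable)
  have "(\<integral>\<^sup>+x. ennreal (lmax F A x powr p) \<partial>M)
      \<le> (\<integral>\<^sup>+x. (\<Sum>i<K. ennreal (4 powr p * ?l i powr p) * indicator {x \<in> space M. 2 * ?l i < lmax F A x} x) \<partial>M)"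
    by (intro nn_integral_mono pt)
  also have "\<dots> = (\<Sum>i<K. ennreal (4 powr p * ?l i powr p) * emeasure M {x \<in> space M. 2 * ?l i < lmax F A x})"
    by (subst nn_integral_sum) (auto simp: nn_integral_cmult_indicator)
  also have "\<dots> = (\<Sum>i<K. ennreal (4 powr p * ?l i powr (p - 1)) * (ennreal (?l i) * emeasure M {x \<in> space M. 2 * ?l i < lmax F A x}))"
    using s by (intro sum.cong refl) (simp add: mult.assoc[symmetric] ennreal_mult[symmetric] powr_diff)
  also have "\<dots> \<le> (\<Sum>i<K. ennreal (4 powr p * ?l i powr (p - 1)) * (\<integral>\<^sup>+x. ennreal (g x) * indicator {x. ?l i < g x} x \<partial>M))"
    using s F A by (intro sum_mono mult_left_mono laminar_weak_type) auto
  also have "\<dots> = (\<integral>\<^sup>+x. (\<Sum>i<K. ennreal (4 powr p * ?l i powr (p - 1)) * (ennreal (g x) * indicator {x. ?l i < g x} x)) \<partial>M)"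
    by (subst nn_integral_sum) (auto simp: nn_integral_cmult)
  also have "\<dots> \<le> (\<integral>\<^sup>+x. ennreal (doob_const p) * ennreal (g x powr p) \<partial>M)"
  proof (intro nn_integral_mono)
    fix x
    have "(\<Sum>i<K. ennreal (4 powr p * ?l i powr (p - 1)) * (ennreal (g x) * indicator {x. ?l i < g x} x))
        = (\<Sum>i<K. ennreal (4 powr p * g x * (if ?l i < g x then ?l i powr (p - 1) else 0)))"
      using g0[of x] by (intro sum.cong refl) (auto simp: ennreal_mult' mult_ac)
    also have "\<dots> = ennreal (4 powr p * g x * (\<Sum>i<K. if ?l i < g x then ?l i powr (p - 1) else 0))"
      using g0[of x] by (subst sum_ennreal) (auto simp: sum_distrib_left)
    also have "\<dots> \<le> ennreal (4 powr p * g x * (2 powr (p - 1) / (2 powr (p - 1) - 1) * g x powr (p - 1)))"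
      using g0[of x] s p by (intro ennreal_leI mult_left_mono geometric_levels) auto
    also have "4 powr p * g x * (2 powr (p - 1) / (2 powr (p - 1) - 1) * g x powr (p - 1)) = doob_const p * g x powr p"
      using g0[of x] by (cases "g x = 0") (auto simp: doob_const_def powr_diff)
    finally show "(\<Sum>i<K. ennreal (4 powr p * ?l i powr (p - 1)) * (ennreal (g x) * indicator {x. ?l i < g x} x))
       \<le> ennreal (doob_const p) * ennreal (g x powr p)"
      using doob_const_nonneg[OF p] by (simp add: ennreal_mult)
  qed
  also have "\<dots> = ennreal (doob_const p) * (\<integral>\<^sup>+x. ennreal (g x powr p) \<partial>M)"
    by (intro nn_integral_cmult) measurable
  finally show ?thesis .
qed

lemma lmax_powr_mono:
  assumes "finite F" "0 < r" "0 < s" "0 \<le> C"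
    and "\<And>P. P \<in> F \<Longrightarrow> 0 \<le> A P" "\<And>P. P \<in> F \<Longrightarrow> 0 \<le> B P"
    and le: "\<And>P. P \<in> F \<Longrightarrow> A P powr r \<le> C * B P powr s"
  shows "lmax F A x powr r \<le> C * lmax F B x powr s"
proof (cases rule: lmax_cases[OF assms(1), of A x])
  case 1
  then show ?thesis using assms by simp
next
  case (2 P)
  have "lmax F A x powr r \<le> C * B P powr s" using le[OF 2(1)] 2 by simp
  also have "\<dots> \<le> C * lmax F B x powr s"
    using assms 2 lmax_ge[OF assms(1) 2(1) 2(2), of B] by (intro mult_left_mono powr_mono2) auto
  finally show ?thesis .
qed

text \<open>Lerner's argument: with \<open>\<sigma> = \<omega> powr (- 1 / (p - 1))\<close>, the averages of \<open>f\<close> are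
  controlled by averages with respect to \<open>\<omega>\<close> of the maximal function of \<open>f / \<sigma>\<close> with respect
  to \<open>\<sigma>\<close>, so that the unweighted maximal theorem is applied once to each of the two measures.\<close>

lemma muckenhoupt_laminar:
  fixes \<omega> f :: "'a \<Rightarrow> real"
  assumes p: "1 < p"
    and F: "finite F" "laminar F" "F \<subseteq> sets M"
    and \<omega> [measurable]: "\<omega> \<in> borel_measurable M" and \<omega>0: "\<And>x. 0 \<le> \<omega> x" and \<omega>_pos: "AE x in M. 0 < \<omega> x"
    and f [measurable]: "f \<in> borel_measurable M" and f0: "\<And>x. 0 \<le> f x"
    and pos: "\<And>P. P \<in> F \<Longrightarrow> 0 < b P" "\<And>P. P \<in> F \<Longrightarrow> 0 < w P" "\<And>P. P \<in> F \<Longrightarrow> 0 < v P"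
    and b: "\<And>P. P \<in> F \<Longrightarrow> emeasure M P = ennreal (b P)"
    and w: "\<And>P. P \<in> F \<Longrightarrow> (\<integral>\<^sup>+x\<in>P. ennreal (\<omega> x) \<partial>M) = ennreal (w P)"
    and v: "\<And>P. P \<in> F \<Longrightarrow> (\<integral>\<^sup>+x\<in>P. ennreal (\<omega> x powr (- 1 / (p - 1))) \<partial>M) = ennreal (v P)"
    and K: "\<And>P. P \<in> F \<Longrightarrow> v P powr (p - 1) * w P \<le> K * b P powr p" "0 \<le> K"
    and A0: "\<And>P. P \<in> F \<Longrightarrow> 0 \<le> A P"
    and A: "\<And>P. P \<in> F \<Longrightarrow> ennreal (A P * b P) \<le> (\<integral>\<^sup>+x\<in>P. ennreal (f x) \<partial>M)"
  defines "p' \<equiv> p / (p - 1)"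
  shows "(\<integral>\<^sup>+x. ennreal (lmax F A x powr p * \<omega> x) \<partial>M)
    \<le> ennreal (K powr p' * (doob_const p' * doob_const p)) * (\<integral>\<^sup>+x. ennreal (f x powr p * \<omega> x) \<partial>M)"
proof -
  have p': "1 < p'" "(p - 1) * p' = p" using p by (auto simp: p'_def field_simps)
  define \<sigma> where "\<sigma> x = \<omega> x powr (- 1 / (p - 1))" for x
  have [measurable]: "\<sigma> \<in> borel_measurable M" unfolding \<sigma>_def by measurable
  have \<sigma>0: "0 \<le> \<sigma> x" for x by (simp add: \<sigma>_def)
  have sets: "P \<in> sets M" if "P \<in> F" for P using that F by auto
  \<comment> \<open>If \<open>A P\<close> is the average of f over P, then \<open>m P\<close> is the
    average of f / \<sigma> with respect to \<sigma>, and \<open>B P\<close> is the average with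
    respect to \<omega> of the constant \<open>m P\<close>^(p-1) divided by \<omega>. The condition
    \<open>K\<close> then says precisely that A^p \<le> K^p' B^p'.\<close>
  define m where "m P = A P * b P / v P" for P
  define B where "B P = m P powr (p - 1) * b P / w P" for P
  have m0: "0 \<le> m P" "0 \<le> B P" if "P \<in> F" for P
    using A0[OF that] pos[OF that] by (auto simp: m_def B_def)
  have mxm: "0 \<le> lmax F m x" for x using F(1) by (rule lmax_nonneg)
  have [measurable]: "lmax F m \<in> borel_measurable M" "lmax F A \<in> borel_measurable M" "lmax F B \<in> borel_measurable M"
    using F by (auto intro: lmax_measurable)
  have e\<sigma>: "emeasure (density M (\<lambda>x. ennreal (\<sigma> x))) P = ennreal (v P)" if "P \<in> F" for P
    using sets[OF that] v[OF that] by (simp add: emeasure_density \<sigma>_def)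
  have e\<omega>: "emeasure (density M (\<lambda>x. ennreal (\<omega> x))) P = ennreal (w P)" if "P \<in> F" for P
    using sets[OF that] w[OF that] by (simp add: emeasure_density)
  have pw: "\<omega> x powr (- 1 / (p - 1)) * (\<omega> x powr (1 / (p - 1))) = 1"
    "(f x / \<sigma> x) powr p * \<sigma> x = f x powr p * \<omega> x"
    "(lmax F m x powr (p - 1) / \<omega> x) powr p' * \<omega> x = lmax F m x powr p * \<sigma> x"
    if "0 < \<omega> x" for x
  proof -
    have s: "0 < \<sigma> x" using that by (simp add: \<sigma>_def)
    have e: "- 1 / (p - 1) * (1 - p) = 1" using p by (simp add: divide_simps)
    have "\<sigma> x powr (1 - p) = \<omega> x"
      unfolding \<sigma>_def powr_powr e using that by simp
    moreover have "(f x / \<sigma> x) powr p * \<sigma> x = f x powr p * \<sigma> x powr (1 - p)"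
      using s f0[of x] by (simp add: powr_divide powr_diff)
    ultimately show "(f x / \<sigma> x) powr p * \<sigma> x = f x powr p * \<omega> x" by simp
    show "\<omega> x powr (- 1 / (p - 1)) * (\<omega> x powr (1 / (p - 1))) = 1"
      using that by (simp add: powr_add[symmetric])
    have "1 - p' = - 1 / (p - 1)" using p by (simp add: p'_def field_simps)
    then have "\<sigma> x = \<omega> x powr (1 - p')" by (simp add: \<sigma>_def)
    then show "(lmax F m x powr (p - 1) / \<omega> x) powr p' * \<omega> x = lmax F m x powr p * \<sigma> x"
      using that mxm[of x] by (simp add: powr_divide powr_powr p'(2) powr_diff[of "\<omega> x" 1 p'])
  qed
  have "(\<integral>\<^sup>+x. ennreal (lmax F A x powr p * \<omega> x) \<partial>M)
      \<le> (\<integral>\<^sup>+x. ennreal (K powr p') * ennreal (lmax F B x powr p' * \<omega> x) \<partial>M)"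
  proof (intro nn_integral_mono)
    fix x
    have "lmax F A x powr p \<le> K powr p' * lmax F B x powr p'"
    proof (rule lmax_powr_mono)
      fix P assume P: "P \<in> F"
      note ps = pos[OF P]
      have "A P = m P * (v P / b P)" using ps by (simp add: m_def)
      then have "A P powr p = m P powr p * (v P / b P) powr p"
        using m0[OF P] ps powr_mult[of "m P" "v P / b P" p] by simp
      also have "(v P / b P) powr p = ((v P / b P) powr (p - 1)) powr p'"
        using p' by (simp add: powr_powr)
      also have "\<dots> \<le> (K * (b P / w P)) powr p'"
      proof (rule powr_mono2)
        have "(v P / b P) powr (p - 1) = v P powr (p - 1) / b P powr (p - 1)"
          using ps by (simp add: powr_divide)
        also have "\<dots> = v P powr (p - 1) * w P * (b P / (b P powr p * w P))"
          using ps by (simp add: powr_diff)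
        also have "\<dots> \<le> K * b P powr p * (b P / (b P powr p * w P))"
          using K ps P by (intro mult_right_mono) auto
        also have "\<dots> = K * (b P / w P)" using ps by simp
        finally show "(v P / b P) powr (p - 1) \<le> K * (b P / w P)" .
      qed (use p' ps in auto)
      also have "\<dots> = K powr p' * (b P / w P) powr p'"
        using K ps powr_mult[of K "b P / w P" p'] by simp
      also have "m P powr p * (K powr p' * (b P / w P) powr p') = K powr p' * B P powr p'"
      proof -
        have "B P powr p' = (m P powr (p - 1)) powr p' * (b P / w P) powr p'"
          using ps powr_mult[of "m P powr (p - 1)" "b P / w P" p'] by (simp add: B_def)
        also have "(m P powr (p - 1)) powr p' = m P powr p" by (simp only: powr_powr p'(2))
        finally show ?thesis by simp
      qed
      finally show "A P powr p \<le> K powr p' * B P powr p'"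
        using m0[OF P] by (simp add: mult_left_mono)
    qed (use F p p' A0 m0 in auto)
    then have "lmax F A x powr p * \<omega> x \<le> K powr p' * (lmax F B x powr p' * \<omega> x)"
      using \<omega>0[of x] by (simp add: mult.assoc[symmetric] mult_right_mono)
    then show "ennreal (lmax F A x powr p * \<omega> x) \<le> ennreal (K powr p') * ennreal (lmax F B x powr p' * \<omega> x)"
      using \<omega>0[of x] by (subst ennreal_mult[symmetric]) (auto intro: ennreal_leI)
  qed
  also have "\<dots> = ennreal (K powr p') * (\<integral>\<^sup>+x. ennreal (lmax F B x powr p') \<partial>density M (\<lambda>x. ennreal (\<omega> x)))"
    using \<omega>0 by (simp add: nn_integral_cmult nn_integral_density ennreal_mult' mult.commute)
  \<comment> \<open>First use of the maximal theorem, for the measure \<omega> and the exponent p'.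
    Its right-hand side is built so that its p'-th power times \<omega> is \<open>lmax F m\<close>^p
    \<sigma>, ready for the second use with \<sigma> and p.\<close>
  also have "(\<integral>\<^sup>+x. ennreal (lmax F B x powr p') \<partial>density M (\<lambda>x. ennreal (\<omega> x)))
     \<le> ennreal (doob_const p') * (\<integral>\<^sup>+x. ennreal ((lmax F m x powr (p - 1) / \<omega> x) powr p') \<partial>density M (\<lambda>x. ennreal (\<omega> x)))"
  proof (rule laminar_maximal)
    fix P assume P: "P \<in> F"
    note [measurable] = sets[OF P]
    show "emeasure (density M (\<lambda>x. ennreal (\<omega> x))) P < \<infinity>" using P by (simp add: e\<omega>)
    have "ennreal (B P) * emeasure (density M (\<lambda>x. ennreal (\<omega> x))) P = ennreal (m P powr (p - 1)) * emeasure M P"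
      using m0[OF P] pos[OF P] P by (simp add: e\<omega> b B_def flip: ennreal_mult)
    also have "\<dots> = (\<integral>\<^sup>+x\<in>P. ennreal (m P powr (p - 1)) \<partial>M)"
      by (simp add: nn_integral_cmult_indicator)
    also have "\<dots> \<le> (\<integral>\<^sup>+x\<in>P. ennreal (lmax F m x powr (p - 1)) \<partial>M)"
      using m0[OF P] p by (intro nn_integral_mono)
        (auto simp: indicator_def intro!: ennreal_leI powr_mono2 lmax_ge F P)
    also have "\<dots> = (\<integral>\<^sup>+x. ennreal (\<omega> x) * (ennreal (lmax F m x powr (p - 1) / \<omega> x) * indicator P x) \<partial>M)"
      using \<omega>_pos by (intro nn_integral_cong_AE) (auto simp: ennreal_mult[symmetric] mult.assoc[symmetric])
    also have "\<dots> = (\<integral>\<^sup>+x\<in>P. ennreal (lmax F m x powr (p - 1) / \<omega> x) \<partial>density M (\<lambda>x. ennreal (\<omega> x)))"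
      by (subst nn_integral_density) auto
    finally show "ennreal (B P) * emeasure (density M (\<lambda>x. ennreal (\<omega> x))) P
      \<le> (\<integral>\<^sup>+x\<in>P. ennreal (lmax F m x powr (p - 1) / \<omega> x) \<partial>density M (\<lambda>x. ennreal (\<omega> x)))" .
  qed (use p' F m0 \<omega>0 in auto)
  also have "(\<integral>\<^sup>+x. ennreal ((lmax F m x powr (p - 1) / \<omega> x) powr p') \<partial>density M (\<lambda>x. ennreal (\<omega> x)))
      = (\<integral>\<^sup>+x. ennreal (\<omega> x) * ennreal ((lmax F m x powr (p - 1) / \<omega> x) powr p') \<partial>M)"
    by (subst nn_integral_density) auto
  also have "\<dots> = (\<integral>\<^sup>+x. ennreal (\<sigma> x) * ennreal (lmax F m x powr p) \<partial>M)"
    using \<omega>_pos by (intro nn_integral_cong_AE)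
      (auto simp: pw ennreal_mult[symmetric] \<sigma>0 mult.commute[of "\<omega> _"] mult.commute[of "\<sigma> _"])
  also have "\<dots> = (\<integral>\<^sup>+x. ennreal (lmax F m x powr p) \<partial>density M (\<lambda>x. ennreal (\<sigma> x)))"
    by (subst nn_integral_density) auto
  also have "\<dots> \<le> ennreal (doob_const p) * (\<integral>\<^sup>+x. ennreal ((f x / \<sigma> x) powr p) \<partial>density M (\<lambda>x. ennreal (\<sigma> x)))"
  proof (rule laminar_maximal)
    fix P assume P: "P \<in> F"
    note [measurable] = sets[OF P]
    show "emeasure (density M (\<lambda>x. ennreal (\<sigma> x))) P < \<infinity>" using P by (simp add: e\<sigma>)
    have "ennreal (m P) * emeasure (density M (\<lambda>x. ennreal (\<sigma> x))) P = ennreal (A P * b P)"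
      using m0[OF P] pos[OF P] P by (simp add: e\<sigma> m_def flip: ennreal_mult)
    also have "\<dots> \<le> (\<integral>\<^sup>+x\<in>P. ennreal (f x) \<partial>M)" by (rule A[OF P])
    also have "\<dots> = (\<integral>\<^sup>+x. ennreal (\<sigma> x) * (ennreal (f x / \<sigma> x) * indicator P x) \<partial>M)"
      using \<omega>_pos f0 by (intro nn_integral_cong_AE)
        (auto simp: ennreal_mult[symmetric] mult.assoc[symmetric] \<sigma>_def)
    also have "\<dots> = (\<integral>\<^sup>+x\<in>P. ennreal (f x / \<sigma> x) \<partial>density M (\<lambda>x. ennreal (\<sigma> x)))"
      by (subst nn_integral_density) auto
    finally show "ennreal (m P) * emeasure (density M (\<lambda>x. ennreal (\<sigma> x))) P
      \<le> (\<integral>\<^sup>+x\<in>P. ennreal (f x / \<sigma> x) \<partial>density M (\<lambda>x. ennreal (\<sigma> x)))" .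
  qed (use p F m0 \<sigma>0 f0 in auto)
  also have "(\<integral>\<^sup>+x. ennreal ((f x / \<sigma> x) powr p) \<partial>density M (\<lambda>x. ennreal (\<sigma> x)))
      = (\<integral>\<^sup>+x. ennreal (\<sigma> x) * ennreal ((f x / \<sigma> x) powr p) \<partial>M)"
    by (subst nn_integral_density) auto
  also have "\<dots> = (\<integral>\<^sup>+x. ennreal (f x powr p * \<omega> x) \<partial>M)"
    using \<omega>_pos by (intro nn_integral_cong_AE)
      (auto simp: pw ennreal_mult[symmetric] \<sigma>0 mult.commute[of "\<sigma> _"])
  finally show ?thesis
    using doob_const_nonneg[OF p] doob_const_nonneg[OF p'(1)]
    by (simp add: mult.assoc ennreal_mult mult_left_mono)
qed

section \<open>Dyadic cells and their shifts by a third\<close>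

lemma infnorm_less_iff:
  fixes x :: "real ^ 'n"
  shows "infnorm x < r \<longleftrightarrow> (\<forall>i. \<bar>x $ i\<bar> < r)"
proof -
  have "infnorm x = Max (range (\<lambda>i. \<bar>x $ i\<bar>))"
    unfolding infnorm_cart by (subst cSup_eq_Max[symmetric]) (auto simp: full_SetCompr_eq)
  then show ?thesis by simp
qed

lemma cube_eq_box: "cube r (x :: real ^ 'n) = box (\<chi> i. x $ i - r) (\<chi> i. x $ i + r)"
  by (auto simp: cube_def infnorm_less_iff mem_box_cart abs_less_iff algebra_simps; smt (verit))

lemma emeasure_box_cart:
  fixes a :: "real ^ 'n"
  assumes "0 \<le> r" "\<And>i. b $ i - a $ i = r"
  shows "emeasure lborel (box a b) = ennreal (r ^ CARD('n))" "emeasure lborel (cbox a b) = ennreal (r ^ CARD('n))"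
proof -
  have le: "a $ i \<le> b $ i" for i using assms(1) assms(2)[of i] by linarith
  have le': "u \<in> Basis \<Longrightarrow> a \<bullet> u \<le> b \<bullet> u" for u
    using le by (auto simp: Basis_vec_def inner_axis)
  have "(\<Prod>u\<in>Basis. (b - a) \<bullet> u) = (\<Prod>u\<in>(Basis :: (real ^ 'n) set). r)"
    using assms by (intro prod.cong) (auto simp: Basis_vec_def inner_axis)
  then have "(\<Prod>u\<in>Basis. (b - a) \<bullet> u) = r ^ CARD('n)" by simp
  then show "emeasure lborel (box a b) = ennreal (r ^ CARD('n))" "emeasure lborel (cbox a b) = ennreal (r ^ CARD('n))"
    using le' by (simp_all add: emeasure_lborel_box emeasure_lborel_cbox)
qed

lemma cube_measurable [measurable]: "cube r (x :: real ^ 'n) \<in> sets lebesgue"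
  by (simp add: cube_eq_box)

lemma emeasure_cube:
  assumes "0 \<le> r"
  shows "emeasure lebesgue (cube r (x :: real ^ 'n)) = ennreal ((2 * r) ^ CARD('n))"
proof -
  have "emeasure lborel (cube r x) = ennreal ((2 * r) ^ CARD('n))"
    unfolding cube_eq_box using assms by (intro emeasure_box_cart) auto
  then show ?thesis by (simp add: cube_eq_box)
qed

text \<open>The shifts by a third are chosen so that the grid of level \<open>Suc j\<close> refines the grid of
  level \<open>j\<close>, and so that in each coordinate the points of the grids with and without shift
  are at distance at least a third of the side length.\<close>

definition grid_shift :: "'n set \<Rightarrow> nat \<Rightarrow> 'n \<Rightarrow> real" where
  "grid_shift S j i = (if i \<in> S then (- 1) ^ j / 3 else 0)"

text \<open>Half-open cubes of side 2^(-j), named by any of their points. Equality of floors makes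
  cells of one grid and level equal or disjoint, without boundary cases.\<close>

definition cell :: "'n set \<Rightarrow> nat \<Rightarrow> real ^ 'n \<Rightarrow> (real ^ 'n) set" where
  "cell S j x = {y. \<forall>i. \<lfloor>2 ^ j * y $ i - grid_shift S j i\<rfloor> = \<lfloor>2 ^ j * x $ i - grid_shift S j i\<rfloor>}"

lemma cell_self [simp]: "x \<in> cell S j x"
  by (simp add: cell_def)

lemma cell_eq: "y \<in> cell S j x \<Longrightarrow> cell S j y = cell S j x"
  by (auto simp: cell_def)

lemma cell_sandwich:
  fixes x :: "real ^ 'n" and S :: "'n set" and j :: nat
  defines "z \<equiv> \<lambda>i. \<lfloor>2 ^ j * x $ i - grid_shift S j i\<rfloor>"
  defines "a \<equiv> (\<chi> i. (z i + grid_shift S j i) / 2 ^ j)" and "b \<equiv> (\<chi> i. (z i + 1 + grid_shift S j i) / 2 ^ j)"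
  shows "cell S j x = {y. \<forall>i. a $ i \<le> y $ i \<and> y $ i < b $ i}"
    and "box a b \<subseteq> cell S j x" and "cell S j x \<subseteq> cbox a b" and "b $ i - a $ i = 1 / 2 ^ j"
proof -
  have "\<lfloor>2 ^ j * y $ i - grid_shift S j i\<rfloor> = z i \<longleftrightarrow> a $ i \<le> y $ i \<and> y $ i < b $ i" for y i
    by (auto simp: a_def b_def floor_eq_iff field_simps)
  then show eq: "cell S j x = {y. \<forall>i. a $ i \<le> y $ i \<and> y $ i < b $ i}"
    by (auto simp: cell_def z_def)
  show "box a b \<subseteq> cell S j x" "cell S j x \<subseteq> cbox a b"
    unfolding eq by (auto simp: mem_box_cart less_imp_le)
  show "b $ i - a $ i = 1 / 2 ^ j" by (simp add: a_def b_def diff_divide_distrib[symmetric])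
qed

lemma cell_borel [measurable]: "cell S j (x :: real ^ 'n) \<in> sets borel"
proof -
  have "{y :: real ^ 'n. \<forall>i\<in>UNIV. a $ i \<le> y $ i \<and> y $ i < b $ i} \<in> sets borel" for a b :: "real ^ 'n"
    by measurable
  then show ?thesis unfolding cell_sandwich(1) by simp
qed

lemma cell_lebesgue [measurable]: "cell S j (x :: real ^ 'n) \<in> sets lebesgue"
  using cell_borel by (simp add: sets_completionI_sets)

lemma emeasure_cell: "emeasure lebesgue (cell S j (x :: real ^ 'n)) = ennreal ((1 / 2 ^ j) ^ CARD('n))"
proof (rule antisym)
  note ab = cell_sandwich[where x = x and S = S and j = j]
  have "emeasure lborel (cell S j x) \<le> ennreal ((1 / 2 ^ j) ^ CARD('n))"
    using emeasure_mono[OF ab(3), of lborel] emeasure_box_cart(2)[OF _ ab(4)] by simp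
  then show "emeasure lebesgue (cell S j x) \<le> ennreal ((1 / 2 ^ j) ^ CARD('n))" by simp
  have "ennreal ((1 / 2 ^ j) ^ CARD('n)) \<le> emeasure lborel (cell S j x)"
    using emeasure_mono[OF ab(2), of lborel] emeasure_box_cart(1)[OF _ ab(4)] by simp
  then show "ennreal ((1 / 2 ^ j) ^ CARD('n)) \<le> emeasure lebesgue (cell S j x)" by simp
qed

lemma cell_subset_cube: "cell S j (x :: real ^ 'n) \<subseteq> cube (1 / 2 ^ j) x"
proof
  fix y assume y: "y \<in> cell S j x"
  have "\<bar>y $ i - x $ i\<bar> < 1 / 2 ^ j" for i
  proof -
    have "\<lfloor>2 ^ j * y $ i - grid_shift S j i\<rfloor> = \<lfloor>2 ^ j * x $ i - grid_shift S j i\<rfloor>"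
      using y by (simp add: cell_def)
    then have "\<bar>2 ^ j * y $ i - 2 ^ j * x $ i\<bar> < 1" by linarith
    then have "2 ^ j * \<bar>y $ i - x $ i\<bar> < 1" by (simp add: abs_mult flip: right_diff_distrib)
    then show ?thesis by (simp add: field_simps)
  qed
  then show "y \<in> cube (1 / 2 ^ j) x" by (simp add: cube_def infnorm_less_iff)
qed

lemma floor_double_half: "\<lfloor>u\<rfloor> = \<lfloor>2 * u\<rfloor> div 2" for u :: real
  by linarith

lemma floor_double: "\<lfloor>2 * u\<rfloor> = 2 * \<lfloor>u\<rfloor> + (if odd \<lfloor>2 * u\<rfloor> then 1 else 0)" for u :: real
  using floor_double_half[of u] by (auto elim!: oddE evenE)

text \<open>Twice the shift (-1)^j / 3 differs from the next shift -(-1)^j / 3 by the integer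
  (-1)^j. The floor at level j is therefore determined by the floor at level j + 1, also for shifted
  coordinates.\<close>

lemma cell_Suc_subset: "cell S (Suc j) x \<subseteq> cell S j x"
proof
  fix y assume y: "y \<in> cell S (Suc j) x"
  have "\<lfloor>2 ^ j * y $ i - grid_shift S j i\<rfloor> = \<lfloor>2 ^ j * x $ i - grid_shift S j i\<rfloor>" for i
  proof -
    define c :: int where "c = (if i \<in> S then (- 1) ^ j else 0)"
    have "2 ^ Suc j * t - grid_shift S (Suc j) i = 2 * (2 ^ j * t - grid_shift S j i) + of_int c" for t :: real
      by (simp add: grid_shift_def c_def algebra_simps)
    then have "\<lfloor>2 ^ Suc j * t - grid_shift S (Suc j) i\<rfloor> = \<lfloor>2 * (2 ^ j * t - grid_shift S j i)\<rfloor> + c" for t :: real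
      by (simp only: floor_add_int)
    moreover have "\<lfloor>2 ^ Suc j * y $ i - grid_shift S (Suc j) i\<rfloor> = \<lfloor>2 ^ Suc j * x $ i - grid_shift S (Suc j) i\<rfloor>"
      using y by (simp add: cell_def)
    ultimately have "\<lfloor>2 * (2 ^ j * y $ i - grid_shift S j i)\<rfloor> = \<lfloor>2 * (2 ^ j * x $ i - grid_shift S j i)\<rfloor>"
      by simp
    then show ?thesis by (subst (1 2) floor_double_half) simp
  qed
  then show "y \<in> cell S j x" by (simp add: cell_def)
qed

lemma cell_antimono: "j \<le> k \<Longrightarrow> cell S k x \<subseteq> cell S j x"
  by (induction rule: dec_induct) (use cell_Suc_subset in blast)+

lemma laminar_cells: "laminar {cell S j x | j x. P j x}"
proof -
  have *: "cell S j x \<inter> cell S k y = {} \<or> cell S k y \<subseteq> cell S j x" if "j \<le> k" for j k x y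
  proof (cases "cell S j x \<inter> cell S k y = {}")
    case False
    then obtain t where "t \<in> cell S j x" "t \<in> cell S k y" by blast
    then show ?thesis using cell_eq cell_antimono[OF that, of S t] by metis
  qed simp
  show ?thesis
    unfolding laminar_def using * by (smt (verit, best) Int_commute linorder_le_cases mem_Collect_eq)
qed

text \<open>A cube centred at x need not lie in the cell of x. Taking all centres in the cell gives
  a set that contains these cubes but depends on the cell only, so that it can be attached to a
  word.\<close>

definition nbhd :: "nat \<Rightarrow> real ^ 'n \<Rightarrow> (real ^ 'n) set" where
  "nbhd j x = (\<Union>t\<in>cell {} j x. cube (1 / 2 ^ j) t)"

lemma nbhd_measurable [measurable]: "nbhd j (x :: real ^ 'n) \<in> sets lebesgue"
proof -
  have "open (nbhd j x)" by (auto simp: nbhd_def cube_eq_box)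
  then show ?thesis by simp
qed

lemma nbhd_cong: "y \<in> cell {} j x \<Longrightarrow> nbhd j y = nbhd j x"
  by (simp add: nbhd_def cell_eq)

lemma cube_subset_nbhd: "cube (1 / 2 ^ j) x \<subseteq> nbhd j x"
  unfolding nbhd_def by (rule UN_upper) simp

text \<open>If the window crosses an integer, it stays within 3/16 of it, whereas the points of the
  shifted grid have distance at least 1/3 from the integers.\<close>

lemma one_third_trick:
  fixes lo s :: real
  assumes "\<bar>s\<bar> = 1 / 3"
  shows "(\<forall>u. lo < u \<and> u < lo + 3 / 16 \<longrightarrow> \<lfloor>u\<rfloor> = \<lfloor>lo\<rfloor>) \<or> (\<forall>u. lo < u \<and> u < lo + 3 / 16 \<longrightarrow> \<lfloor>u - s\<rfloor> = \<lfloor>lo - s\<rfloor>)"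
proof (cases "lo + 3 / 16 \<le> of_int \<lfloor>lo\<rfloor> + 1")
  case True
  have "\<lfloor>u\<rfloor> = \<lfloor>lo\<rfloor>" if "lo < u" "u < lo + 3 / 16" for u
    using that True by linarith
  then show ?thesis by blast
next
  case False
  define m where "m = \<lfloor>lo\<rfloor> + 1"
  have m: "of_int m - 3 / 16 < lo" "lo < of_int m" using False unfolding m_def by linarith+
  have "\<lfloor>u - s\<rfloor> = \<lfloor>lo - s\<rfloor>" if "lo < u" "u < lo + 3 / 16" for u
  proof (cases "0 \<le> s")
    case True
    then have "\<lfloor>u - s\<rfloor> = m - 1" "\<lfloor>lo - s\<rfloor> = m - 1"
      using assms m that by (auto simp: floor_eq_iff)
    then show ?thesis by simp
  next
    case False
    then have "\<lfloor>u - s\<rfloor> = m" "\<lfloor>lo - s\<rfloor> = m"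
      using assms m that by (auto simp: floor_eq_iff)
    then show ?thesis by simp
  qed
  then show ?thesis by blast
qed

text \<open>Four levels down, a cell with a margin of one side length on each side has width 3/16 in
  units of level j; four is the least loss k with 3 / 2^k < 1/3. The shift is chosen separately in
  each coordinate, which is why grids are indexed by sets of coordinates.\<close>

lemma nbhd_subset_cell:
  fixes x :: "real ^ 'n"
  shows "\<exists>S. nbhd (j + 4) x \<subseteq> cell S j x"
proof -
  define lo :: "'n \<Rightarrow> real" where "lo i = (of_int \<lfloor>2 ^ (j + 4) * x $ i\<rfloor> - 1) / 16" for i
  define S where "S = {i. \<not> (\<forall>u. lo i < u \<and> u < lo i + 3 / 16 \<longrightarrow> \<lfloor>u\<rfloor> = \<lfloor>lo i\<rfloor>)}"
  have S: "\<lfloor>u - grid_shift S j i\<rfloor> = \<lfloor>lo i - grid_shift S j i\<rfloor>" if "lo i < u" "u < lo i + 3 / 16" for u i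
  proof (cases "i \<in> S")
    case True
    have "\<bar>(- 1) ^ j / 3 :: real\<bar> = 1 / 3" by (simp add: abs_divide power_abs)
    from one_third_trick[OF this, of "lo i"] show ?thesis
      using True that by (auto simp: S_def grid_shift_def)
  next
    case False
    then show ?thesis using that by (auto simp: S_def grid_shift_def)
  qed
  have near: "lo i < 2 ^ j * y $ i \<and> 2 ^ j * y $ i < lo i + 3 / 16" if y: "y \<in> nbhd (j + 4) x" for y i
  proof -
    obtain t where t: "t \<in> cell {} (j + 4) x" "infnorm (y - t) < 1 / 2 ^ (j + 4)"
      using y by (auto simp: nbhd_def cube_def)
    have "\<lfloor>2 ^ (j + 4) * t $ i\<rfloor> = \<lfloor>2 ^ (j + 4) * x $ i\<rfloor>" using t(1) by (simp add: cell_def grid_shift_def)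
    moreover have "\<bar>y $ i - t $ i\<bar> < 1 / 2 ^ (j + 4)" using t(2) by (simp add: infnorm_less_iff)
    then have "2 ^ (j + 4) * \<bar>y $ i - t $ i\<bar> < 1" by (simp add: field_simps)
    then have "\<bar>2 ^ (j + 4) * y $ i - 2 ^ (j + 4) * t $ i\<bar> < 1"
      by (simp add: abs_mult flip: right_diff_distrib)
    moreover have "2 ^ (j + 4) * y $ i = 16 * (2 ^ j * y $ i)" by (simp add: power_add)
    moreover have "(of_int \<lfloor>X\<rfloor> - 1) / 16 < u \<and> u < (of_int \<lfloor>X\<rfloor> - 1) / 16 + 3 / 16"
      if "\<lfloor>T\<rfloor> = \<lfloor>X\<rfloor>" "\<bar>Y - T\<bar> < 1" "Y = 16 * u" for X Y T u :: real
    proof -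
      have "of_int \<lfloor>X\<rfloor> - 1 < Y" "Y < of_int \<lfloor>X\<rfloor> + 2" using that(1,2) by linarith+
      then show ?thesis using that(3) by (simp add: field_simps)
    qed
    ultimately show ?thesis unfolding lo_def by blast
  qed
  have "nbhd (j + 4) x \<subseteq> cell S j x"
  proof
    fix y assume y: "y \<in> nbhd (j + 4) x"
    have x: "x \<in> nbhd (j + 4) x"
      using cube_subset_nbhd[of "j + 4" x] by (auto simp: cube_def infnorm_0)
    show "y \<in> cell S j x"
      using S near[OF y] near[OF x] by (simp add: cell_def)
  qed
  then show ?thesis ..
qed

section \<open>Local Muckenhoupt weights\<close>

lemma infnorm_cube_bounded: "bounded (cube r (x :: real ^ 'n))"
  by (simp add: cube_eq_box)

lemma cell_bounded: "bounded (cell S j (x :: real ^ 'n))"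
  using cell_subset_cube infnorm_cube_bounded by (rule bounded_subset[rotated])

lemma cell_subset_nbhd: "cell {} j x \<subseteq> nbhd j x"
  by (auto simp: nbhd_def cube_def infnorm_0)

lemma set_nn_integral_mono_set:
  fixes g :: "'a \<Rightarrow> ennreal"
  assumes "A \<subseteq> B"
  shows "(\<integral>\<^sup>+x\<in>A. g x \<partial>M) \<le> (\<integral>\<^sup>+x\<in>B. g x \<partial>M)"
  using assms by (intro nn_integral_mono) (auto simp: indicator_def)

lemma set_nn_integral_pos:
  assumes [measurable]: "g \<in> borel_measurable M" "B \<in> sets M"
    and "AE x in M. (0 :: real) < g x" "emeasure M B \<noteq> 0"
  shows "0 < (\<integral>\<^sup>+x\<in>B. ennreal (g x) \<partial>M)"
proof (rule ccontr)
  assume "\<not> ?thesis"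
  then have "(\<integral>\<^sup>+x\<in>B. ennreal (g x) \<partial>M) = 0" by simp
  then have "AE x in M. ennreal (g x) * indicator B x = 0" by (subst (asm) nn_integral_0_iff_AE) auto
  with assms(3) have "AE x in M. x \<notin> B" by eventually_elim (auto simp: indicator_def)
  then have "emeasure M B = 0" by (subst (asm) AE_iff_measurable[of B]) (use sets.sets_into_space[OF assms(2)] in auto)
  then show False using assms by simp
qed

locale local_Ap =
  fixes p :: real and \<omega> :: "real ^ 'n \<Rightarrow> real"
  assumes p: "1 < p" and Ap: "\<omega> \<in> Ap_loc p"
begin

abbreviation pnorm :: "(real ^ 'n \<Rightarrow> real) \<Rightarrow> ennreal" where
  "pnorm f \<equiv> \<integral>\<^sup>+x. ennreal (f x powr p * \<omega> x) \<partial>lebesgue"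

definition \<sigma> :: "real ^ 'n \<Rightarrow> real" where
  "\<sigma> x = \<omega> x powr (- 1 / (p - 1))"

definition dual_of :: "(real ^ 'n) set \<Rightarrow> ennreal" where
  "dual_of B = (\<integral>\<^sup>+x\<in>B. ennreal (\<sigma> x) \<partial>lebesgue)"

lemma \<omega>_nonneg: "0 \<le> \<omega> x"
  using Ap by (simp add: Ap_loc_def weight_def)

lemma \<omega>_pos: "AE x in lebesgue. 0 < \<omega> x"
  using Ap by (simp add: Ap_loc_def weight_def)

lemma \<sigma>_nonneg: "0 \<le> \<sigma> x"
  by (simp add: \<sigma>_def)

lemma \<sigma>_pos: "AE x in lebesgue. 0 < \<sigma> x"
  using \<omega>_pos by eventually_elim (simp add: \<sigma>_def)

lemma \<omega>_integrable: "compact K \<Longrightarrow> integrable lebesgue (\<lambda>x. indicat_real K x * \<omega> x)"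
  using Ap by (simp add: Ap_loc_def weight_def set_integrable_def)

lemma \<omega>_measurable [measurable]: "\<omega> \<in> borel_measurable lebesgue"
proof (rule borel_measurable_LIMSEQ_real)
  show "(\<lambda>x. indicat_real (cball 0 (real i)) x * \<omega> x) \<in> borel_measurable lebesgue" for i
    using \<omega>_integrable[of "cball 0 (real i)"] by auto
  show "(\<lambda>i. indicat_real (cball 0 (real i)) x * \<omega> x) \<longlonglongrightarrow> \<omega> x" for x
  proof (rule tendsto_eventually)
    obtain N where "norm x \<le> real N" using real_arch_simple by blast
    then show "\<forall>\<^sub>F i in sequentially. indicat_real (cball 0 (real i)) x * \<omega> x = \<omega> x"
      unfolding eventually_sequentially by (intro exI[of _ N]) (auto simp: indicator_def)
  qed
qed

lemma \<sigma>_measurable [measurable]: "\<sigma> \<in> borel_measurable lebesgue"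
  unfolding \<sigma>_def by measurable

lemma weight_of_mono: "A \<subseteq> B \<Longrightarrow> weight_of \<omega> A \<le> weight_of \<omega> B"
  unfolding weight_of_def by (rule set_nn_integral_mono_set)

lemma dual_of_mono: "A \<subseteq> B \<Longrightarrow> dual_of A \<le> dual_of B"
  unfolding dual_of_def by (rule set_nn_integral_mono_set)

lemma weight_of_pos: "B \<in> sets lebesgue \<Longrightarrow> emeasure lebesgue B \<noteq> 0 \<Longrightarrow> 0 < weight_of \<omega> B"
  unfolding weight_of_def using \<omega>_pos by (intro set_nn_integral_pos) auto

lemma dual_of_pos: "B \<in> sets lebesgue \<Longrightarrow> emeasure lebesgue B \<noteq> 0 \<Longrightarrow> 0 < dual_of B"
  unfolding dual_of_def using \<sigma>_pos by (intro set_nn_integral_pos) auto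

lemma weight_of_finite:
  assumes "bounded B"
  shows "weight_of \<omega> B < \<infinity>"
proof -
  obtain r where r: "B \<subseteq> cball 0 r"
    using bounded_subset_ballD[OF assms, of 0] ball_subset_cball by blast
  have "weight_of \<omega> (cball 0 r) = (\<integral>\<^sup>+x. ennreal (norm (indicat_real (cball 0 r) x * \<omega> x)) \<partial>lebesgue)"
    unfolding weight_of_def using \<omega>_nonneg
    by (intro nn_integral_cong) (auto simp: indicator_def)
  also have "\<dots> < \<infinity>"
    using \<omega>_integrable[of "cball 0 r"] by (simp add: integrable_iff_bounded)
  finally show ?thesis using weight_of_mono[OF r] by (rule le_less_trans[rotated])
qed

text \<open>The local condition with the averages multiplied out. An infinite dual integral is
  excluded because the weight of the cube is positive, so that the product in \<open>Ap_loc\<close>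
  would be infinite.\<close>

lemma Ap_cube:
  obtains K where "0 < K"
    "\<And>r x. 0 < r \<Longrightarrow> 2 * r \<le> 1 \<Longrightarrow> dual_of (cube r x) < \<infinity>"
    "\<And>r x. 0 < r \<Longrightarrow> 2 * r \<le> 1 \<Longrightarrow>
      enn2real (dual_of (cube r x)) powr (p - 1) * enn2real (weight_of \<omega> (cube r x)) \<le> K * ((2 * r) ^ CARD('n)) powr p"
proof -
  define Z where "Z = (SUP (x, r) \<in> {(x :: real ^ 'n, r). 0 < r \<and> 2 * r \<le> 1}.
        (weight_of \<omega> (cube r x) / emeasure lebesgue (cube r x)) *
        ennpowr ((\<integral>\<^sup>+y\<in>cube r x. ennreal (\<omega> y powr (- 1 / (p - 1))) \<partial>lebesgue)
                  / emeasure lebesgue (cube r x)) (p - 1))"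
  have Z: "Z < \<infinity>" using Ap by (simp add: Ap_loc_def Z_def)
  define K where "K = enn2real Z + 1"
  have K: "0 < K" by (simp add: K_def add_nonneg_pos)
  have ZK: "Z \<le> ennreal K" using Z by (simp add: K_def)
  have main: "dual_of (cube r x) < \<infinity> \<and>
      enn2real (dual_of (cube r x)) powr (p - 1) * enn2real (weight_of \<omega> (cube r x)) \<le> K * ((2 * r) ^ CARD('n)) powr p"
    if r: "0 < r" "2 * r \<le> 1" for r and x :: "real ^ 'n"
  proof -
    define c where "c = (2 * r) ^ CARD('n)"
    have c: "0 < c" "emeasure lebesgue (cube r x) = ennreal c" using r emeasure_cube[of r x] by (auto simp: c_def)
    have le: "(weight_of \<omega> (cube r x) / ennreal c) * ennpowr (dual_of (cube r x) / ennreal c) (p - 1) \<le> ennreal K"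
    proof -
      have "(weight_of \<omega> (cube r x) / ennreal c) * ennpowr (dual_of (cube r x) / ennreal c) (p - 1) \<le> Z"
        unfolding Z_def c(2)[symmetric] dual_of_def \<sigma>_def
        using r by (intro SUP_upper2[of "(x, r)"]) auto
      then show ?thesis using ZK by simp
    qed
    have fW: "weight_of \<omega> (cube r x) < \<infinity>" by (intro weight_of_finite infnorm_cube_bounded)
    have pW: "0 < weight_of \<omega> (cube r x)" using c by (intro weight_of_pos) auto
    obtain w where w: "weight_of \<omega> (cube r x) = ennreal w" "0 < w"
      using fW pW by (cases "weight_of \<omega> (cube r x)") auto
    have fD: "dual_of (cube r x) < \<infinity>"
    proof (rule ccontr)
      assume "\<not> ?thesis"
      then have "dual_of (cube r x) = \<infinity>" by (simp add: less_top[symmetric])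
      then have "dual_of (cube r x) / ennreal c = \<infinity>" using c by (simp add: ennreal_top_divide)
      then have "(weight_of \<omega> (cube r x) / ennreal c) * ennpowr (dual_of (cube r x) / ennreal c) (p - 1) = \<infinity>"
        using w c by (simp add: ennpowr_def divide_ennreal ennreal_mult_top)
      then show False using le by (simp add: top_unique)
    qed
    obtain v where v: "dual_of (cube r x) = ennreal v" "0 \<le> v"
      using fD by (cases "dual_of (cube r x)") auto
    have "w / c * (v / c) powr (p - 1) \<le> K"
      using le w v c K by (simp add: ennpowr_def divide_ennreal ennreal_mult[symmetric])
    moreover have "c powr p = c * c powr (p - 1)" using c by (simp add: powr_diff)
    ultimately have "w * v powr (p - 1) / c powr p \<le> K"
      using c v by (simp add: powr_divide)
    then have "v powr (p - 1) * w \<le> K * c powr p"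
      using c by (simp add: pos_divide_le_eq mult.commute)
    then show ?thesis using fD w v by (simp add: c_def)
  qed
  show ?thesis by (rule that[OF K]) (use main in auto)
qed

text \<open>The condition speaks of cubes of side at most 1 only; compactness reduces a bounded set
  to finitely many of them.\<close>

lemma dual_of_finite:
  assumes "bounded B"
  shows "dual_of B < \<infinity>"
proof -
  let ?c = "\<lambda>x :: real ^ 'n. cube (1 / 2) x"
  have fin: "dual_of (?c x) < \<infinity>" for x
    using Ap_cube by (metis divide_pos_pos field_sum_of_halves mult_2 order_refl zero_less_numeral zero_less_one)
  have "compact (closure B)" using assms by (simp add: compact_closure)
  moreover have "closure B \<subseteq> (\<Union>x\<in>closure B. ?c x)" by (auto simp: cube_def infnorm_0)
  moreover have "open (?c x)" for x by (simp add: cube_eq_box open_box)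
  ultimately obtain T where T: "finite T" "closure B \<subseteq> (\<Union>x\<in>T. ?c x)"
    by (metis compactE_image)
  have "B \<subseteq> (\<Union>x\<in>T. ?c x)" using T(2) closure_subset by blast
  then have "dual_of B \<le> (\<integral>\<^sup>+y. (\<Sum>x\<in>T. ennreal (\<sigma> y) * indicator (?c x) y) \<partial>lebesgue)"
    unfolding dual_of_def
  proof (intro nn_integral_mono)
    fix y assume sub: "B \<subseteq> (\<Union>x\<in>T. ?c x)"
    show "ennreal (\<sigma> y) * indicator B y \<le> (\<Sum>x\<in>T. ennreal (\<sigma> y) * indicator (?c x) y)"
    proof (cases "y \<in> B")
      case True
      then obtain x where "x \<in> T" "y \<in> ?c x" using sub by blast
      then have "ennreal (\<sigma> y) \<le> ennreal (\<sigma> y) * indicator (?c x) y" by simp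
      also have "\<dots> \<le> (\<Sum>x\<in>T. ennreal (\<sigma> y) * indicator (?c x) y)"
        using \<open>x \<in> T\<close> T(1) by (intro member_le_sum) auto
      finally show ?thesis using True by simp
    qed simp
  qed
  also have "\<dots> = (\<Sum>x\<in>T. dual_of (?c x))"
    unfolding dual_of_def by (subst nn_integral_sum) auto
  also have "\<dots> < \<infinity>" using T(1) fin by (simp add: less_top)
  finally show ?thesis .
qed

lemma set_nn_integral_le_young:
  assumes [measurable]: "f \<in> borel_measurable lebesgue" "B \<in> sets lebesgue" and f: "\<And>x. 0 \<le> f x" and \<tau>: "0 < \<tau>"
  shows "(\<integral>\<^sup>+x\<in>B. ennreal (f x) \<partial>lebesgue)
    \<le> ennreal \<tau> * (\<integral>\<^sup>+x\<in>B. ennreal (f x powr p * \<omega> x) \<partial>lebesgue) + ennreal (\<tau> powr (- 1 / (p - 1))) * dual_of B"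
proof -
  have "(\<integral>\<^sup>+x\<in>B. ennreal (f x) \<partial>lebesgue)
    \<le> (\<integral>\<^sup>+x. ennreal \<tau> * (ennreal (f x powr p * \<omega> x) * indicator B x)
        + ennreal (\<tau> powr (- 1 / (p - 1))) * (ennreal (\<sigma> x) * indicator B x) \<partial>lebesgue)"
  proof (intro nn_integral_mono_AE)
    show "AE x in lebesgue. ennreal (f x) * indicator B x
      \<le> ennreal \<tau> * (ennreal (f x powr p * \<omega> x) * indicator B x)
        + ennreal (\<tau> powr (- 1 / (p - 1))) * (ennreal (\<sigma> x) * indicator B x)"
      using \<omega>_pos
    proof eventually_elim
      case (elim x)
      have "f x \<le> \<tau> * (f x powr p * \<omega> x) + (\<tau> * \<omega> x) powr (- 1 / (p - 1))"
        using p \<tau> f elim by (intro young_weight)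
      also have "(\<tau> * \<omega> x) powr (- 1 / (p - 1)) = \<tau> powr (- 1 / (p - 1)) * \<sigma> x"
        using \<tau> elim by (simp add: \<sigma>_def powr_mult)
      finally have "ennreal (f x) \<le> ennreal (\<tau> * (f x powr p * \<omega> x) + \<tau> powr (- 1 / (p - 1)) * \<sigma> x)"
        by (rule ennreal_leI)
      also have "\<dots> = ennreal \<tau> * ennreal (f x powr p * \<omega> x) + ennreal (\<tau> powr (- 1 / (p - 1))) * ennreal (\<sigma> x)"
        using \<tau> \<omega>_nonneg[of x] \<sigma>_nonneg[of x] by (simp add: ennreal_mult)
      finally show ?case by (simp add: indicator_def)
    qed
  qed
  also have "\<dots> = ennreal \<tau> * (\<integral>\<^sup>+x\<in>B. ennreal (f x powr p * \<omega> x) \<partial>lebesgue) + ennreal (\<tau> powr (- 1 / (p - 1))) * dual_of B"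
    unfolding dual_of_def by (subst nn_integral_add) (auto simp: nn_integral_cmult)
  finally show ?thesis .
qed

text \<open>\<open>set_nn_integral_le_young\<close> with f = 1 and \<tau> = |Q| / (2 \<omega>(Q))
  absorbs half of |Q| and leaves (|Q| / 2)^p \<le> \<omega>(Q) \<sigma>(cube)^(p-1). Multiplied by
  \<omega>(cube), the right-hand side is controlled by \<open>Ap_cube\<close>.\<close>

lemma doubling:
  assumes M: "0 < M"
  obtains D where "0 < D"
    "\<And>r x Q. 0 < r \<Longrightarrow> 2 * r \<le> 1 \<Longrightarrow> Q \<in> sets lebesgue \<Longrightarrow> Q \<subseteq> cube r x \<Longrightarrow>
      emeasure lebesgue (cube r x) \<le> ennreal M * emeasure lebesgue Q \<Longrightarrow>
      weight_of \<omega> (cube r x) \<le> ennreal D * weight_of \<omega> Q"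
proof -
  obtain K where K: "0 < K"
    "\<And>r x. 0 < r \<Longrightarrow> 2 * r \<le> 1 \<Longrightarrow> dual_of (cube r x) < \<infinity>"
    "\<And>r x. 0 < r \<Longrightarrow> 2 * r \<le> 1 \<Longrightarrow>
      enn2real (dual_of (cube r x)) powr (p - 1) * enn2real (weight_of \<omega> (cube r x)) \<le> K * ((2 * r) ^ CARD('n)) powr p"
    using Ap_cube by metis
  have "weight_of \<omega> (cube r x) \<le> ennreal (2 powr p * K * M powr p) * weight_of \<omega> Q"
    if r: "0 < r" "2 * r \<le> 1" and Q [measurable]: "Q \<in> sets lebesgue" and sub: "Q \<subseteq> cube r x"
      and M': "emeasure lebesgue (cube r x) \<le> ennreal M * emeasure lebesgue Q" for r x Q
  proof -
    define c where "c = (2 * r) ^ CARD('n)"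
    have c: "0 < c" "emeasure lebesgue (cube r x) = ennreal c" using r emeasure_cube[of r x] by (auto simp: c_def)
    have "emeasure lebesgue Q \<le> ennreal c" using emeasure_mono[OF sub, of lebesgue] c by simp
    then obtain d where d: "emeasure lebesgue Q = ennreal d" "0 \<le> d"
      by (cases "emeasure lebesgue Q") (auto simp: top_unique)
    have cM: "c \<le> M * d"
      using M' c d M by (simp add: ennreal_mult[symmetric])
    then have d0: "0 < d" using c M d by (metis dual_order.strict_trans1 mult_zero_right order_le_less)
    have fW: "weight_of \<omega> (cube r x) < \<infinity>" by (intro weight_of_finite infnorm_cube_bounded)
    have WQ: "weight_of \<omega> Q \<le> weight_of \<omega> (cube r x)" using sub by (rule weight_of_mono)
    have pQ: "0 < weight_of \<omega> Q" using d d0 by (intro weight_of_pos) auto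
    obtain w where w: "weight_of \<omega> (cube r x) = ennreal w" "0 < w"
      using fW WQ pQ by (cases "weight_of \<omega> (cube r x)") (auto dest: less_le_trans)
    obtain u where u: "weight_of \<omega> Q = ennreal u" "0 < u"
      using w WQ pQ by (cases "weight_of \<omega> Q") (auto simp: top_unique)
    obtain v where v: "dual_of (cube r x) = ennreal v" "0 \<le> v"
      using K(2)[OF r, of x] by (cases "dual_of (cube r x)") auto
    have Apv: "v powr (p - 1) * w \<le> K * c powr p"
      using K(3)[OF r, of x] v w by (simp add: c_def)
    define \<tau> where "\<tau> = d / (2 * u)"
    have \<tau>: "0 < \<tau>" using d0 u by (simp add: \<tau>_def)
    have "ennreal d = (\<integral>\<^sup>+x\<in>Q. ennreal 1 \<partial>lebesgue)" using d by simp
    also have "\<dots> \<le> ennreal \<tau> * (\<integral>\<^sup>+x\<in>Q. ennreal (1 powr p * \<omega> x) \<partial>lebesgue)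
        + ennreal (\<tau> powr (- 1 / (p - 1))) * dual_of Q"
      using \<tau> by (intro set_nn_integral_le_young) auto
    also have "\<dots> \<le> ennreal \<tau> * ennreal u + ennreal (\<tau> powr (- 1 / (p - 1))) * ennreal v"
      using dual_of_mono[OF sub] v u by (intro add_mono mult_left_mono) (auto simp: weight_of_def)
    also have "\<dots> = ennreal (\<tau> * u + \<tau> powr (- 1 / (p - 1)) * v)"
      using \<tau> u v by (simp add: ennreal_mult)
    finally have "d \<le> \<tau> * u + \<tau> powr (- 1 / (p - 1)) * v"
      using \<tau> u v by (subst (asm) ennreal_le_iff) auto
    moreover have "\<tau> * u = d / 2" using u by (simp add: \<tau>_def)
    ultimately have "d / 2 \<le> \<tau> powr (- 1 / (p - 1)) * v" by simp
    then have "(d / 2) powr (p - 1) \<le> (\<tau> powr (- 1 / (p - 1)) * v) powr (p - 1)"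
      using d0 p by (intro powr_mono2) auto
    also have "\<dots> = \<tau> powr (- 1 / (p - 1) * (p - 1)) * v powr (p - 1)"
      using v by (simp add: powr_mult powr_powr)
    also have "- 1 / (p - 1) * (p - 1) = - 1" using p by simp
    also have "\<tau> powr (- 1) = 2 * u / d" using d0 u by (simp add: powr_minus_divide \<tau>_def)
    finally have "(d / 2) powr (p - 1) * (d / 2) \<le> u * v powr (p - 1)"
      using d0 by (simp add: field_simps)
    moreover have "(d / 2) powr (p - 1) * (d / 2) = (d / 2) powr p" using d0 by (simp add: powr_diff)
    ultimately have "(d / 2) powr p * w \<le> u * (v powr (p - 1) * w)"
      using w by (simp add: mult.assoc[symmetric] mult_right_mono)
    also have "\<dots> \<le> u * (K * c powr p)" using Apv u by (intro mult_left_mono) auto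
    also have "\<dots> \<le> u * (K * (M * d) powr p)"
      using cM c K u p by (intro mult_left_mono powr_mono2) auto
    also have "\<dots> = (d / 2) powr p * (2 powr p * K * M powr p * u)"
      using d0 M by (simp add: powr_mult powr_divide)
    finally have "w \<le> 2 powr p * K * M powr p * u" using d0 by simp
    then show ?thesis
      using w u K M by (simp add: ennreal_mult[symmetric] ennreal_leI)
  qed
  moreover have "0 < 2 powr p * K * M powr p" using K M by simp
  ultimately show ?thesis using that by blast
qed

end

section \<open>Coding of a dyadic cube by words\<close>

text \<open>\<open>5 \<le> k0\<close> leaves room for the four levels lost in
  \<open>nbhd_subset_cell\<close>: the larger cells then have level at least 1 and fit into cubes of
  side 1. \<open>1 / 2 ^ k0 < \<rho>\<close> places all points of a root cell within reach of the
  truncated kernel.\<close>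

locale riesz_root = local_Ap p \<omega> for p :: real and \<omega> :: "real ^ 'n \<Rightarrow> real" +
  fixes \<alpha> \<rho> :: real and k0 :: nat and x0 :: "real ^ 'n"
  assumes \<alpha>: "0 < \<alpha>" "\<alpha> < real CARD('n)" and \<rho>: "0 < \<rho>"
    and k0: "5 \<le> k0" "1 / 2 ^ k0 < \<rho>"
begin

definition Q0 :: "(real ^ 'n) set" where
  "Q0 = cell {} k0 x0"

definition side :: "nat \<Rightarrow> real" where
  "side k = 1 / 2 ^ (k0 + k)"

text \<open>The letter at position k collects the coordinates whose binary digit of place k0 + k + 1
  is 1.\<close>

definition code :: "real ^ 'n \<Rightarrow> nat \<Rightarrow> 'n set" where
  "code x k = {i. odd \<lfloor>2 ^ (k0 + Suc k) * x $ i\<rfloor>}"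

definition dyad :: "'n set list \<Rightarrow> (real ^ 'n) set" where
  "dyad l = {x \<in> Q0. pre (length l) (code x) = l}"

definition wt :: "'n set list \<Rightarrow> real" where
  "wt l = enn2real (weight_of \<omega> (dyad l)) * side (length l) powr (- (\<alpha> * p))"

lemma side_pos [simp]: "0 < side k"
  by (simp add: side_def)

lemma side_neq_0 [simp]: "side k \<noteq> 0"
  by (simp add: side_def)

lemma side_Suc: "side (Suc k) = side k / 2"
  by (simp add: side_def)

lemma side_eq: "side k = side 0 * (1 / 2) ^ k"
  by (simp add: side_def power_add power_divide)

lemma Q0_cell: "x \<in> Q0 \<Longrightarrow> Q0 = cell {} k0 x"
  by (simp add: Q0_def cell_eq)

lemma mem_cell_empty: "y \<in> cell {} j x \<longleftrightarrow> (\<forall>i. \<lfloor>2 ^ j * y $ i\<rfloor> = \<lfloor>2 ^ j * x $ i\<rfloor>)"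
  by (simp add: cell_def grid_shift_def)

lemma code_cell:
  assumes "x \<in> Q0" "y \<in> Q0"
  shows "pre k (code y) = pre k (code x) \<longleftrightarrow> y \<in> cell {} (k0 + k) x"
proof (induction k)
  case 0
  then show ?case using assms Q0_cell by simp
next
  case (Suc k)
  have "y \<in> cell {} (k0 + Suc k) x \<longleftrightarrow> y \<in> cell {} (k0 + k) x \<and> code y k = code x k"
  proof
    assume *: "y \<in> cell {} (k0 + Suc k) x"
    have "y \<in> cell {} (k0 + k) x"
      using * cell_Suc_subset[of "{}" "k0 + k" x] by auto
    moreover have "code y k = code x k"
      using * by (simp add: code_def mem_cell_empty)
    ultimately show "y \<in> cell {} (k0 + k) x \<and> code y k = code x k" ..
  next
    assume *: "y \<in> cell {} (k0 + k) x \<and> code y k = code x k"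
    show "y \<in> cell {} (k0 + Suc k) x"
      unfolding mem_cell_empty
    proof
      fix i
      have "\<lfloor>2 * (2 ^ (k0 + k) * y $ i)\<rfloor> = \<lfloor>2 * (2 ^ (k0 + k) * x $ i)\<rfloor>"
        using * floor_double[of "2 ^ (k0 + k) * y $ i"] floor_double[of "2 ^ (k0 + k) * x $ i"]
        by (auto simp: code_def mem_cell_empty set_eq_iff mult.assoc)
      then show "\<lfloor>2 ^ (k0 + Suc k) * y $ i\<rfloor> = \<lfloor>2 ^ (k0 + Suc k) * x $ i\<rfloor>"
        by (simp add: mult.assoc)
    qed
  qed
  then show ?case using Suc by (simp add: pre_Suc)
qed

lemma dyad_pre: "x \<in> Q0 \<Longrightarrow> dyad (pre k (code x)) = cell {} (k0 + k) x"
  using code_cell[of x] cell_antimono[of k0 "k0 + k" "{}" x] Q0_cell[of x] by (auto simp: dyad_def)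

lemma mem_dyad_pre: "x \<in> Q0 \<Longrightarrow> x \<in> dyad (pre k (code x))"
  by (simp add: dyad_def)

lemma dyad_Q0: "dyad l \<subseteq> Q0"
  by (auto simp: dyad_def)

lemma dyad_cell:
  assumes "x \<in> dyad l"
  shows "dyad l = cell {} (k0 + length l) x"
proof -
  have x: "x \<in> Q0" "l = pre (length l) (code x)" using assms by (auto simp: dyad_def)
  show ?thesis by (subst x(2)) (rule dyad_pre[OF x(1)])
qed

text \<open>All words must occur, since \<open>word_tree\<close> needs positive weights throughout.
  The witness is the lower corner of the child cell, whose scaled coordinates are the integers
  \<open>N i\<close>.\<close>

lemma dyad_nonempty: "\<exists>x. x \<in> dyad l"
proof (induction l rule: rev_induct)
  case Nil
  have "x0 \<in> dyad []" by (simp add: dyad_def Q0_def)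
  then show ?case ..
next
  case (snoc a l)
  then obtain x where x: "x \<in> dyad l" ..
  define N where "N i = 2 * \<lfloor>2 ^ (k0 + length l) * x $ i\<rfloor> + (if i \<in> a then 1 else 0)" for i
  define y :: "real ^ 'n" where "y = (\<chi> i. of_int (N i) / 2 ^ (k0 + Suc (length l)))"
  have fl: "\<lfloor>2 ^ (k0 + Suc (length l)) * y $ i\<rfloor> = N i" for i by (simp add: y_def)
  have "y \<in> dyad l"
    unfolding dyad_cell[OF x] mem_cell_empty
  proof
    fix i
    have "\<lfloor>2 ^ (k0 + length l) * y $ i\<rfloor> = \<lfloor>2 * (2 ^ (k0 + length l) * y $ i)\<rfloor> div 2"
      by (rule floor_double_half)
    also have "\<dots> = N i div 2" using fl[of i] by (simp add: mult.assoc)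
    also have "\<dots> = \<lfloor>2 ^ (k0 + length l) * x $ i\<rfloor>" by (simp add: N_def)
    finally show "\<lfloor>2 ^ (k0 + length l) * y $ i\<rfloor> = \<lfloor>2 ^ (k0 + length l) * x $ i\<rfloor>" .
  qed
  moreover have "code y (length l) = a"
    unfolding code_def fl by (auto simp: N_def)
  ultimately have "y \<in> dyad (l @ [a])" by (auto simp: dyad_def pre_Suc)
  then show ?case ..
qed

definition rep :: "'n set list \<Rightarrow> real ^ 'n" where
  "rep l = (SOME x. x \<in> dyad l)"

lemma rep: "rep l \<in> dyad l"
  unfolding rep_def using dyad_nonempty by (rule someI_ex)

lemma dyad_eq: "dyad l = cell {} (k0 + length l) (rep l)"
  using rep by (rule dyad_cell)

lemma dyad_lebesgue [measurable]: "dyad l \<in> sets lebesgue"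
  unfolding dyad_eq by (rule cell_lebesgue)

lemma Q0_lebesgue [measurable]: "Q0 \<in> sets lebesgue"
  unfolding Q0_def by (rule cell_lebesgue)

lemma emeasure_dyad: "emeasure lebesgue (dyad l) = ennreal (side (length l) ^ CARD('n))"
  unfolding dyad_eq side_def by (rule emeasure_cell)

lemma weight_of_cell:
  obtains w where "weight_of \<omega> (cell S j x) = ennreal w" "0 < w"
proof -
  have "emeasure lebesgue (cell S j x) \<noteq> 0" unfolding emeasure_cell by simp
  then have "0 < weight_of \<omega> (cell S j x)" by (intro weight_of_pos) auto
  moreover have "weight_of \<omega> (cell S j x) < \<infinity>" by (intro weight_of_finite cell_bounded)
  ultimately show ?thesis using that by (cases "weight_of \<omega> (cell S j x)") auto
qed

lemma weight_dyad: "weight_of \<omega> (dyad l) = ennreal (wt l * side (length l) powr (\<alpha> * p))"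
  and wt_pos: "0 < wt l"
proof -
  obtain w where w: "weight_of \<omega> (dyad l) = ennreal w" "0 < w"
    unfolding dyad_eq by (rule weight_of_cell)
  then have wt: "wt l = w * side (length l) powr (- (\<alpha> * p))" by (simp add: wt_def)
  show "0 < wt l" using w by (simp add: wt)
  have "wt l * side (length l) powr (\<alpha> * p) = w"
    unfolding wt by (simp add: mult.assoc powr_add[symmetric])
  then show "weight_of \<omega> (dyad l) = ennreal (wt l * side (length l) powr (\<alpha> * p))" using w by simp
qed

lemma sum_words_weight:
  assumes "\<And>l. 0 \<le> g l"
  shows "(\<Sum>l | length l = k. ennreal (g l) * weight_of \<omega> (dyad l))
    = (\<integral>\<^sup>+x\<in>Q0. ennreal (g (pre k (code x)) * \<omega> x) \<partial>lebesgue)"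
proof -
  have "(\<integral>\<^sup>+x\<in>Q0. ennreal (g (pre k (code x)) * \<omega> x) \<partial>lebesgue)
      = (\<integral>\<^sup>+x. (\<Sum>l | length l = k. ennreal (g l) * (ennreal (\<omega> x) * indicator (dyad l) x)) \<partial>lebesgue)"
  proof (intro nn_integral_cong)
    fix x
    show "ennreal (g (pre k (code x)) * \<omega> x) * indicator Q0 x
      = (\<Sum>l | length l = k. ennreal (g l) * (ennreal (\<omega> x) * indicator (dyad l) x))"
    proof (cases "x \<in> Q0")
      case True
      have "(\<Sum>l | length l = k. ennreal (g l) * (ennreal (\<omega> x) * indicator (dyad l) x))
          = (\<Sum>l | length l = k. if l = pre k (code x) then ennreal (g l) * ennreal (\<omega> x) else 0)"
        using True by (intro sum.cong refl) (auto simp: dyad_def)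
      also have "\<dots> = ennreal (g (pre k (code x))) * ennreal (\<omega> x)"
        by (subst sum.delta) (auto simp: finite_words)
      finally show ?thesis using True assms by (simp add: ennreal_mult' \<omega>_nonneg)
    next
      case False
      then have "x \<notin> dyad l" for l using dyad_Q0 by blast
      then show ?thesis using False by simp
    qed
  qed
  also have "\<dots> = (\<Sum>l | length l = k. ennreal (g l) * weight_of \<omega> (dyad l))"
    unfolding weight_of_def by (subst nn_integral_sum) (auto simp: nn_integral_cmult)
  finally show ?thesis by simp
qed

lemma measurable_pre_code [measurable]: "(\<lambda>x. g (pre k (code x)) * indicat_real Q0 x) \<in> borel_measurable lebesgue"
proof -
  have "(\<lambda>x. g (pre k (code x)) * indicat_real Q0 x) = (\<lambda>x. \<Sum>l | length l = k. g l * indicat_real (dyad l) x)"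
  proof
    fix x
    show "g (pre k (code x)) * indicat_real Q0 x = (\<Sum>l | length l = k. g l * indicat_real (dyad l) x)"
    proof (cases "x \<in> Q0")
      case True
      have "(\<Sum>l | length l = k. g l * indicat_real (dyad l) x)
          = (\<Sum>l | length l = k. if l = pre k (code x) then g l else 0)"
        using True by (intro sum.cong refl) (auto simp: dyad_def)
      then show ?thesis using True by (simp add: sum.delta finite_words)
    next
      case False
      then have "x \<notin> dyad l" for l using dyad_Q0 by blast
      then show ?thesis using False by simp
    qed
  qed
  then show ?thesis by simp
qed

end

section \<open>The tree capacity is dominated by the Riesz capacity\<close>

primrec runmax :: "(nat \<Rightarrow> real) \<Rightarrow> nat \<Rightarrow> real" where
  "runmax a 0 = 0"
| "runmax a (Suc k) = max (runmax a k) (a k)"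

lemma runmax_nonneg: "0 \<le> runmax a k"
  by (induction k) auto

lemma runmax_cong: "(\<And>i. i < k \<Longrightarrow> a i = b i) \<Longrightarrow> runmax a k = runmax b k"
  by (induction k) auto

lemma runmax_cases: "runmax a k = 0 \<or> (\<exists>i<k. runmax a k = a i)"
  by (induction k) (auto simp: max_def less_Suc_eq)

lemma runmax_ge: "i < k \<Longrightarrow> a i \<le> runmax a k"
  by (induction k) (auto simp: less_Suc_eq)

lemma powr_superadditive:
  fixes x y p :: real
  assumes "1 \<le> p" "0 \<le> x" "0 \<le> y"
  shows "x powr p + y powr p \<le> (x + y) powr p"
proof -
  have pp: "t powr p = t * t powr (p - 1)" if "0 \<le> t" for t :: real
    using that by (cases "t = 0") (auto simp: powr_diff)
  have "x * x powr (p - 1) \<le> x * (x + y) powr (p - 1)" "y * y powr (p - 1) \<le> y * (x + y) powr (p - 1)"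
    using assms by (auto intro!: mult_left_mono powr_mono2)
  then show ?thesis using assms by (simp add: pp distrib_right)
qed

lemma runmax_increments_powr:
  assumes "1 \<le> p"
  shows "(\<Sum>k<N. (runmax a (Suc k) - runmax a k) powr p) \<le> runmax a N powr p"
proof (induction N)
  case (Suc N)
  have "(\<Sum>k<Suc N. (runmax a (Suc k) - runmax a k) powr p)
      \<le> runmax a N powr p + (runmax a (Suc N) - runmax a N) powr p"
    using Suc by (simp del: runmax.simps)
  also have "\<dots> \<le> (runmax a N + (runmax a (Suc N) - runmax a N)) powr p"
    using assms runmax_nonneg[of a N] by (intro powr_superadditive) auto
  finally show ?case by (simp del: runmax.simps)
qed simp

text \<open>Abel summation turns the increments back into values of the running maximum with the
  factor 1 - r; the boundary term is nonnegative and each value dominates the corresponding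
  \<open>a k\<close>.\<close>

lemma runmax_increments_geometric:
  assumes r: "0 \<le> r" "r < 1"
  shows "(1 - r) * (\<Sum>k<N. r ^ k * a k) \<le> (\<Sum>k<N. r ^ k * (runmax a (Suc k) - runmax a k))"
proof -
  have eq: "(\<Sum>k<N. r ^ k * (runmax a (Suc k) - runmax a k))
      = (1 - r) * (\<Sum>k<N. r ^ k * runmax a (Suc k)) + r ^ N * runmax a N"
    by (induction N) (simp_all del: runmax.simps(2) add: algebra_simps)
  have "(1 - r) * (\<Sum>k<N. r ^ k * a k) \<le> (1 - r) * (\<Sum>k<N. r ^ k * runmax a (Suc k))"
    using r runmax_ge[of _ _ a] by (intro mult_left_mono sum_mono) auto
  also have "\<dots> \<le> (1 - r) * (\<Sum>k<N. r ^ k * runmax a (Suc k)) + r ^ N * runmax a N"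
    using r runmax_nonneg[of a N] by simp
  finally show ?thesis unfolding eq .
qed

lemma runmax_increments_suminf:
  assumes r: "0 \<le> r" "r < 1" and a: "\<And>k. 0 \<le> a k"
  shows "ennreal (1 - r) * (\<Sum>k. ennreal (r ^ k * a k)) \<le> (\<Sum>k. ennreal (r ^ k * (runmax a (Suc k) - runmax a k)))"
proof -
  have "(\<Sum>k<N. ennreal (1 - r) * ennreal (r ^ k * a k)) \<le> (\<Sum>k. ennreal (r ^ k * (runmax a (Suc k) - runmax a k)))" for N
  proof -
    have "(\<Sum>k<N. ennreal (1 - r) * ennreal (r ^ k * a k)) = ennreal ((1 - r) * (\<Sum>k<N. r ^ k * a k))"
      unfolding sum_distrib_left[symmetric] using r a
      by (subst sum_ennreal) (simp_all add: ennreal_mult[symmetric] sum_nonneg)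
    also have "\<dots> \<le> ennreal (\<Sum>k<N. r ^ k * (runmax a (Suc k) - runmax a k))"
      using r by (intro ennreal_leI runmax_increments_geometric)
    also have "\<dots> = (\<Sum>k<N. ennreal (r ^ k * (runmax a (Suc k) - runmax a k)))"
      using r by (intro sum_ennreal[symmetric]) auto
    also have "\<dots> \<le> (\<Sum>k. ennreal (r ^ k * (runmax a (Suc k) - runmax a k)))"
      by (intro sum_le_suminf) auto
    finally show ?thesis .
  qed
  then have "(\<Sum>k. ennreal (1 - r) * ennreal (r ^ k * a k)) \<le> (\<Sum>k. ennreal (r ^ k * (runmax a (Suc k) - runmax a k)))"
    by (intro suminf_le_const) auto
  then show ?thesis by simp
qed

context riesz_root
begin

text \<open>For x in the cell of \<open>l\<close> the cube about x of radius equal to the side lies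
  in this set, but in general not in \<open>dyad l\<close>; hence averages over \<open>Nb l\<close>
  bound the potential.\<close>

definition Nb :: "'n set list \<Rightarrow> (real ^ 'n) set" where
  "Nb l = nbhd (k0 + length l) (rep l)"

lemma Nb_lebesgue [measurable]: "Nb l \<in> sets lebesgue"
  by (simp add: Nb_def nbhd_measurable)

lemma Nb_pre: "x \<in> Q0 \<Longrightarrow> Nb (pre k (code x)) = nbhd (k0 + k) x"
  unfolding Nb_def using rep[of "pre k (code x)"] by (simp add: nbhd_cong dyad_pre)

lemma side_nonneg [simp]: "0 \<le> side k"
  by (simp add: side_def)

lemma side_LIMSEQ: "side \<longlonglongrightarrow> 0"
proof -
  have "(\<lambda>k. side 0 * (1 / 2) ^ k) \<longlonglongrightarrow> side 0 * 0"
    by (intro tendsto_mult tendsto_const LIMSEQ_realpow_zero) auto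
  then show ?thesis by (subst side_eq[abs_def]) simp
qed

lemma side_decreasing: "j \<le> k \<Longrightarrow> side k \<le> side j"
  by (simp add: side_def frac_le)

lemma side_between:
  assumes "0 < t" "t < side 0"
  obtains k where "side (Suc k) \<le> t" "t < side k"
proof -
  have "\<exists>k. side k \<le> t"
    using order_tendstoD(2)[OF side_LIMSEQ assms(1)] by (auto simp: eventually_sequentially intro: less_imp_le)
  then have *: "side (LEAST k. side k \<le> t) \<le> t" by (rule LeastI_ex)
  define m where "m = (LEAST k. side k \<le> t)"
  have "m \<noteq> 0"
  proof
    assume "m = 0"
    then show False using * assms(2) by (simp add: m_def)
  qed
  then obtain k where k: "m = Suc k" by (cases m) auto
  have "\<not> side k \<le> t" using not_less_Least[of k "\<lambda>k. side k \<le> t"] k by (simp add: m_def)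
  then show ?thesis using that[of k] * k by (simp add: m_def)
qed

text \<open>The kernel decreases with the distance, so on each shell between
  \<open>side (Suc k)\<close> and \<open>side k\<close> it is at most its value at the inner radius.
  The far part, beyond \<open>side 0\<close>, is not seen by the tree and is treated
  separately.\<close>

lemma riesz_potential_le:
  fixes x :: "real ^ 'n"
  assumes [measurable]: "f \<in> borel_measurable lebesgue" and f: "\<And>x. 0 \<le> f x"
  shows "riesz_potential \<alpha> \<rho> f x
    \<le> ennreal (side 0 powr (\<alpha> - real CARD('n))) * (\<integral>\<^sup>+y\<in>cube \<rho> x. ennreal (f y) \<partial>lebesgue)
      + (\<Sum>k. ennreal (side (Suc k) powr (\<alpha> - real CARD('n))) * (\<integral>\<^sup>+y\<in>cube (side k) x. ennreal (f y) \<partial>lebesgue))"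
proof -
  let ?e = "\<alpha> - real CARD('n)"
  have e: "?e < 0" using \<alpha> by simp
  let ?far = "\<lambda>y. ennreal (side 0 powr ?e) * (ennreal (f y) * indicator (cube \<rho> x) y)"
  let ?near = "\<lambda>k y. ennreal (side (Suc k) powr ?e) * (ennreal (f y) * indicator (cube (side k) x) y)"
  have "riesz_potential \<alpha> \<rho> f x \<le> (\<integral>\<^sup>+y. ?far y + (\<Sum>k. ?near k y) \<partial>lebesgue)"
    unfolding riesz_potential_def
  proof (intro nn_integral_mono)
    fix y
    define t where "t = infnorm (x - y)"
    have t: "t = infnorm (y - x)" "0 \<le> t" by (simp_all add: t_def infnorm_sub infnorm_pos_le)
    consider "t = 0 \<or> \<rho> \<le> t" | "side 0 \<le> t" "t < \<rho>" | "0 < t" "t < side 0" "t < \<rho>" using t by linarith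
    then show "ennreal (riesz_kernel \<alpha> \<rho> (x - y) * f y) \<le> ?far y + (\<Sum>k. ?near k y)"
    proof cases
      case 1
      then have "riesz_kernel \<alpha> \<rho> (x - y) = 0" by (auto simp: riesz_kernel_def t_def[symmetric])
      then show ?thesis by simp
    next
      case 2
      then have "riesz_kernel \<alpha> \<rho> (x - y) = t powr ?e" by (simp add: riesz_kernel_def t_def[symmetric])
      also have "\<dots> \<le> side 0 powr ?e" using 2 e by (intro powr_mono2') auto
      finally have "ennreal (riesz_kernel \<alpha> \<rho> (x - y) * f y) \<le> ennreal (side 0 powr ?e * f y)"
        using f by (intro ennreal_leI mult_right_mono) auto
      also have "\<dots> = ?far y" using 2 t f by (simp add: cube_def ennreal_mult)
      finally show ?thesis by (rule order_trans) simp
    next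
      case 3
      then obtain k where k: "side (Suc k) \<le> t" "t < side k" using side_between by blast
      have "riesz_kernel \<alpha> \<rho> (x - y) = t powr ?e" using 3 by (simp add: riesz_kernel_def t_def[symmetric])
      also have "\<dots> \<le> side (Suc k) powr ?e" using k e by (intro powr_mono2') auto
      finally have "ennreal (riesz_kernel \<alpha> \<rho> (x - y) * f y) \<le> ennreal (side (Suc k) powr ?e * f y)"
        using f by (intro ennreal_leI mult_right_mono) auto
      also have "\<dots> = ?near k y" using k t f by (simp add: cube_def ennreal_mult)
      also have "\<dots> \<le> (\<Sum>k. ?near k y)"
        using sum_le_suminf[of "\<lambda>k. ?near k y" "{k}"] by simp
      finally show ?thesis by (rule order_trans) simp
    qed
  qed
  also have "\<dots> = (\<integral>\<^sup>+y. ?far y \<partial>lebesgue) + (\<Sum>k. \<integral>\<^sup>+y. ?near k y \<partial>lebesgue)"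
    by (subst nn_integral_add) (auto simp: nn_integral_suminf)
  finally show ?thesis by (simp add: nn_integral_cmult)
qed

text \<open>The competitor for the tree capacity built from \<open>f\<close>: the increments of the running
  maximum of the averages of \<open>f\<close> along the chain of dyadic cubes. They sum up to the running maximum, so
  the sum of their \<open>p\<close>-th powers is at most its \<open>p\<close>-th power.\<close>

definition avg :: "(real ^ 'n \<Rightarrow> real) \<Rightarrow> 'n set list \<Rightarrow> real" where
  "avg f l = enn2real (\<integral>\<^sup>+y\<in>Nb l. ennreal (f y) \<partial>lebesgue) / side (length l) ^ CARD('n)"

definition incr :: "(real ^ 'n \<Rightarrow> real) \<Rightarrow> 'n set list \<Rightarrow> real" where
  "incr f l = runmax (\<lambda>i. avg f (take i l)) (Suc (length l)) - runmax (\<lambda>i. avg f (take i l)) (length l)"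

lemma avg_nonneg: "0 \<le> avg f l"
  by (simp add: avg_def)

lemma incr_nonneg: "0 \<le> incr f l"
  by (simp add: incr_def)

lemma incr_pre:
  "incr f (pre k s) = runmax (\<lambda>i. avg f (pre i s)) (Suc k) - runmax (\<lambda>i. avg f (pre i s)) k"
proof -
  have "runmax (\<lambda>i. avg f (take i (pre k s))) m = runmax (\<lambda>i. avg f (pre i s)) m" if "m \<le> Suc k" for m
    using that by (intro runmax_cong) (simp add: take_pre)
  then show ?thesis by (simp add: incr_def del: runmax.simps)
qed

lemma Nb_bounded: "bounded (Nb l)"
proof -
  have "4 \<le> k0 + length l" using k0 by simp
  then obtain j where j: "k0 + length l = j + 4" by (metis add.commute le_Suc_ex)
  then obtain S where "nbhd (k0 + length l) (rep l) \<subseteq> cell S j (rep l)"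
    using nbhd_subset_cell by metis
  then show ?thesis unfolding Nb_def using cell_bounded bounded_subset by blast
qed

lemma set_nn_integral_finite:
  assumes [measurable]: "f \<in> borel_measurable lebesgue" "B \<in> sets lebesgue" and f: "\<And>x. 0 \<le> f x"
    and fin: "pnorm f < \<infinity>" and B: "bounded B"
  shows "(\<integral>\<^sup>+x\<in>B. ennreal (f x) \<partial>lebesgue) < \<infinity>"
proof -
  have "(\<integral>\<^sup>+x\<in>B. ennreal (f x) \<partial>lebesgue)
    \<le> ennreal 1 * (\<integral>\<^sup>+x\<in>B. ennreal (f x powr p * \<omega> x) \<partial>lebesgue) + ennreal (1 powr (- 1 / (p - 1))) * dual_of B"
    using f by (intro set_nn_integral_le_young) auto
  also have "\<dots> \<le> pnorm f + dual_of B"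
    by (auto intro!: add_mono nn_integral_mono simp: indicator_def)
  also have "\<dots> < \<infinity>" using fin dual_of_finite[OF B] by simp
  finally show ?thesis .
qed

text \<open>The k-th term is at most a constant times side^\<alpha> times the k-th average. As
  side^\<alpha> is geometric with ratio 2^(-\<alpha>) < 1, \<open>runmax_increments_suminf\<close>
  replaces averages by increments; the constant combines its loss 1 - 2^(-\<alpha>) with the inner
  radius \<open>side (Suc k)\<close>.\<close>

lemma near_potential_le:
  assumes fm: "f \<in> borel_measurable lebesgue" and f: "\<And>x. 0 \<le> f x"
    and fin: "pnorm f < \<infinity>" and x: "x \<in> Q0"
  shows "(\<Sum>k. ennreal (side (Suc k) powr (\<alpha> - real CARD('n))) * (\<integral>\<^sup>+y\<in>cube (side k) x. ennreal (f y) \<partial>lebesgue))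
    \<le> ennreal (2 powr (real CARD('n) - \<alpha>) / (1 - 2 powr (- \<alpha>))) * (\<Sum>k. ennreal (side k powr \<alpha> * incr f (pre k (code x))))"
proof -
  define n where "n = real CARD('n)"
  define r where "r = 2 powr (- \<alpha>)"
  have r: "0 \<le> r" "r < 1" using \<alpha> by (auto simp: r_def powr_less_one)
  define a where "a k = avg f (pre k (code x))" for k
  define H where "H = 2 powr (n - \<alpha>) * side 0 powr \<alpha>"
  have a0: "0 \<le> a k" for k by (simp add: a_def avg_nonneg)
  have lenr: "side k powr \<alpha> = side 0 powr \<alpha> * r ^ k" for k
  proof -
    have "side k powr \<alpha> = side 0 powr \<alpha> * ((1 / 2) ^ k) powr \<alpha>" by (subst side_eq) (simp add: powr_mult)
    also have "((1 / 2) ^ k) powr \<alpha> = r ^ k"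
      by (simp add: r_def powr_minus_divide powr_power powr_divide power_one_over[symmetric] powr_realpow[symmetric] powr_powr mult.commute)
    finally show ?thesis .
  qed
  have "ennreal (side (Suc k) powr (\<alpha> - n)) * (\<integral>\<^sup>+y\<in>cube (side k) x. ennreal (f y) \<partial>lebesgue) \<le> ennreal H * ennreal (r ^ k * a k)" for k
  proof -
    have "(\<integral>\<^sup>+y\<in>cube (side k) x. ennreal (f y) \<partial>lebesgue) \<le> (\<integral>\<^sup>+y\<in>Nb (pre k (code x)). ennreal (f y) \<partial>lebesgue)"
      using cube_subset_nbhd[of "k0 + k" x] by (intro set_nn_integral_mono_set) (simp add: Nb_pre[OF x] side_def)
    also have "\<dots> = ennreal (a k * side k ^ CARD('n))"
      using set_nn_integral_finite[OF fm Nb_lebesgue f fin Nb_bounded, of "pre k (code x)"]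
      by (simp add: a_def avg_def)
    finally have "ennreal (side (Suc k) powr (\<alpha> - n)) * (\<integral>\<^sup>+y\<in>cube (side k) x. ennreal (f y) \<partial>lebesgue)
      \<le> ennreal (side (Suc k) powr (\<alpha> - n)) * ennreal (a k * side k ^ CARD('n))"
      by (intro mult_left_mono) auto
    also have "\<dots> = ennreal (side (Suc k) powr (\<alpha> - n) * (a k * side k powr n))"
      using a0[of k] by (simp add: ennreal_mult[symmetric] n_def powr_realpow)
    also have "side (Suc k) powr (\<alpha> - n) * (a k * side k powr n) = H * (r ^ k * a k)"
    proof -
      have "side (Suc k) powr (\<alpha> - n) = side k powr (\<alpha> - n) * 2 powr (n - \<alpha>)"
        by (simp add: side_Suc powr_divide powr_diff)
      moreover have "side k powr (\<alpha> - n) * side k powr n = side k powr \<alpha>" by (simp add: powr_add[symmetric])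
      ultimately have "side (Suc k) powr (\<alpha> - n) * (a k * side k powr n) = side k powr \<alpha> * (2 powr (n - \<alpha>) * a k)"
        by (simp add: algebra_simps)
      then show ?thesis by (simp add: lenr[of k] H_def mult_ac)
    qed
    also have "ennreal (H * (r ^ k * a k)) = ennreal H * ennreal (r ^ k * a k)"
      using a0[of k] r by (intro ennreal_mult) (auto simp: H_def)
    finally show ?thesis .
  qed
  then have "(\<Sum>k. ennreal (side (Suc k) powr (\<alpha> - n)) * (\<integral>\<^sup>+y\<in>cube (side k) x. ennreal (f y) \<partial>lebesgue))
     \<le> (\<Sum>k. ennreal H * ennreal (r ^ k * a k))"
    by (intro suminf_le) auto
  also have "\<dots> = ennreal H * (\<Sum>k. ennreal (r ^ k * a k))" by simp
  also have "(\<Sum>k. ennreal (r ^ k * a k))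
      = ennreal (1 / (1 - r)) * (ennreal (1 - r) * (\<Sum>k. ennreal (r ^ k * a k)))"
    using r by (simp add: mult.assoc[symmetric] ennreal_mult[symmetric])
  also have "ennreal H * \<dots> \<le> ennreal H * (ennreal (1 / (1 - r)) * (\<Sum>k. ennreal (r ^ k * (runmax a (Suc k) - runmax a k))))"
    using r a0 by (intro mult_left_mono runmax_increments_suminf) auto
  also have "\<dots> = ennreal (2 powr (n - \<alpha>) / (1 - r)) * (ennreal (side 0 powr \<alpha>) * (\<Sum>k. ennreal (r ^ k * (runmax a (Suc k) - runmax a k))))"
    using r by (simp add: H_def mult.assoc[symmetric] ennreal_mult[symmetric])
  also have "ennreal (side 0 powr \<alpha>) * (\<Sum>k. ennreal (r ^ k * (runmax a (Suc k) - runmax a k)))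
     = (\<Sum>k. ennreal (side k powr \<alpha> * incr f (pre k (code x))))"
    unfolding ennreal_suminf_cmult[symmetric]
  proof (intro suminf_cong)
    fix k
    show "ennreal (side 0 powr \<alpha>) * ennreal (r ^ k * (runmax a (Suc k) - runmax a k))
      = ennreal (side k powr \<alpha> * incr f (pre k (code x)))"
      using r by (simp add: incr_pre lenr[of k] a_def[abs_def] ennreal_mult[symmetric] mult.assoc)
  qed
  finally show ?thesis by (simp add: n_def r_def)
qed

end

lemma laminar_subset: "laminar G \<Longrightarrow> F \<subseteq> G \<Longrightarrow> laminar F"
  unfolding laminar_def by blast

section \<open>Energy of the increments and comparison of the capacities\<close>

context riesz_root
begin

lemma Ap_cell:
  obtains K where "0 < K"
    "\<And>S j x. 1 \<le> j \<Longrightarrow> enn2real (dual_of (cell S j x)) powr (p - 1) * enn2real (weight_of \<omega> (cell S j x))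
      \<le> K * ((1 / 2 ^ j) ^ CARD('n)) powr p"
proof -
  obtain K where K: "0 < K"
    "\<And>r x. 0 < r \<Longrightarrow> 2 * r \<le> 1 \<Longrightarrow>
      enn2real (dual_of (cube r x)) powr (p - 1) * enn2real (weight_of \<omega> (cube r x)) \<le> K * ((2 * r) ^ CARD('n)) powr p"
    using Ap_cube by metis
  have "enn2real (dual_of (cell S j x)) powr (p - 1) * enn2real (weight_of \<omega> (cell S j x))
      \<le> K * (2 ^ CARD('n)) powr p * ((1 / 2 ^ j) ^ CARD('n)) powr p" if j: "1 \<le> j" for S j x
  proof -
    define r :: real where "r = 1 / 2 ^ j"
    have "(2 :: real) ^ 1 \<le> 2 ^ j" using j by (intro power_increasing) auto
    then have r: "0 < r" "2 * r \<le> 1" by (auto simp: r_def field_simps)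
    have sub: "cell S j x \<subseteq> cube r x" unfolding r_def by (rule cell_subset_cube)
    have "enn2real (dual_of (cell S j x)) \<le> enn2real (dual_of (cube r x))"
      using dual_of_mono[OF sub] dual_of_finite[OF infnorm_cube_bounded, of r x] by (simp add: enn2real_mono)
    moreover have "enn2real (weight_of \<omega> (cell S j x)) \<le> enn2real (weight_of \<omega> (cube r x))"
      using weight_of_mono[OF sub] weight_of_finite[OF infnorm_cube_bounded, of r x] by (simp add: enn2real_mono)
    ultimately have "enn2real (dual_of (cell S j x)) powr (p - 1) * enn2real (weight_of \<omega> (cell S j x))
        \<le> enn2real (dual_of (cube r x)) powr (p - 1) * enn2real (weight_of \<omega> (cube r x))"
      using p by (intro mult_mono powr_mono2) auto
    also have "\<dots> \<le> K * ((2 * r) ^ CARD('n)) powr p" using K(2)[OF r] .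
    also have "((2 * r) ^ CARD('n)) powr p = (2 ^ CARD('n)) powr p * (r ^ CARD('n)) powr p"
      using r by (simp add: power_mult_distrib powr_mult)
    finally show ?thesis by (simp add: r_def mult.assoc)
  qed
  moreover have "0 < K * (2 ^ CARD('n)) powr p" using K by simp
  ultimately show ?thesis using that by blast
qed

lemma dual_of_cell:
  obtains v where "dual_of (cell S j x) = ennreal v" "0 < v"
proof -
  have "emeasure lebesgue (cell S j x) \<noteq> 0" unfolding emeasure_cell by simp
  then have "0 < dual_of (cell S j x)" by (intro dual_of_pos) auto
  moreover have "dual_of (cell S j x) < \<infinity>" by (intro dual_of_finite cell_bounded)
  ultimately show ?thesis using that by (cases "dual_of (cell S j x)") auto
qed

lemma measurable_weighted [measurable]:
  "(\<lambda>x. ennreal (g (pre k (code x)) * \<omega> x) * indicator Q0 x) \<in> borel_measurable lebesgue"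
proof -
  have "(\<lambda>x. ennreal (g (pre k (code x)) * \<omega> x) * indicator Q0 x)
      = (\<lambda>x. ennreal ((g (pre k (code x)) * indicat_real Q0 x) * \<omega> x))"
    by (auto simp: indicator_def)
  then show ?thesis by simp
qed

text \<open>The sets \<open>Nb l\<close> need not form a laminar family. Each is enclosed in a cell
  of one of the shifted grids, and \<open>muckenhoupt_laminar\<close> is applied to each grid;
  finitely many grids cost a finite factor. The bound is uniform in \<open>N\<close>, although each
  family is finite.\<close>

lemma runmax_energy:
  obtains C where "0 < C"
    "\<And>f N. f \<in> borel_measurable lebesgue \<Longrightarrow> (\<And>x. 0 \<le> f x) \<Longrightarrow>
      pnorm f < \<infinity> \<Longrightarrow>
      (\<integral>\<^sup>+x\<in>Q0. ennreal (runmax (\<lambda>i. avg f (pre i (code x))) N powr p * \<omega> x) \<partial>lebesgue)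
        \<le> ennreal C * pnorm f"
proof -
  obtain K where K: "0 < K"
    "\<And>S j x. 1 \<le> j \<Longrightarrow> enn2real (dual_of (cell S j x)) powr (p - 1) * enn2real (weight_of \<omega> (cell S j x))
      \<le> K * ((1 / 2 ^ j) ^ CARD('n)) powr p" by (rule Ap_cell) blast
  \<comment> \<open>The subtraction does not truncate, and J l \<ge> 1 as \<open>Ap_cell\<close>
    demands, both because of \<open>5 \<le> k0\<close>.\<close>
  define J where "J l = k0 + length l - 4" for l :: "'n set list"
  have J: "k0 + length l = J l + 4" "1 \<le> J l" for l using k0 by (auto simp: J_def)
  have "\<exists>S. Nb l \<subseteq> cell S (J l) (rep l)" for l
    unfolding Nb_def J(1) by (rule nbhd_subset_cell)
  then obtain Sf where Sf: "\<And>l. Nb l \<subseteq> cell (Sf l) (J l) (rep l)" by metis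
  define P where "P l = cell (Sf l) (J l) (rep l)" for l
  define F where "F N S = P ` {l. length l < N \<and> Sf l = S}" for N S
  define C0 where "C0 = K powr (p / (p - 1)) * (doob_const (p / (p - 1)) * doob_const p)"
  define C where "C = (16 ^ CARD('n)) powr p * (real (card (UNIV :: 'n set set)) * C0) + 1"
  have "1 < p / (p - 1)" using p by simp
  then have C0: "0 \<le> C0" unfolding C0_def using p by (intro mult_nonneg_nonneg doob_const_nonneg) auto
  then have C: "0 < C" by (simp add: C_def add_nonneg_pos)
  have bP: "measure lebesgue (P l) = (1 / 2 ^ J l) ^ CARD('n)" for l
    using emeasure_cell[of "Sf l" "J l" "rep l"] by (simp add: P_def measure_def)
  have eP: "emeasure lebesgue (P l) = ennreal (measure lebesgue (P l))" for l
    unfolding bP unfolding P_def by (rule emeasure_cell)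
  have bP0: "0 < measure lebesgue (P l)" for l by (simp add: bP)
  have PS [measurable]: "P l \<in> sets lebesgue" for l unfolding P_def by (rule cell_lebesgue)
  have "(\<integral>\<^sup>+x\<in>Q0. ennreal (runmax (\<lambda>i. avg f (pre i (code x))) N powr p * \<omega> x) \<partial>lebesgue)
        \<le> ennreal C * pnorm f"
    if fm [measurable]: "f \<in> borel_measurable lebesgue" and f: "\<And>x. 0 \<le> f x"
      and fin: "pnorm f < \<infinity>" for f N
  proof -
    let ?e = "pnorm f"
    define A where "A Q = enn2real (\<integral>\<^sup>+y\<in>Q. ennreal (f y) \<partial>lebesgue) / measure lebesgue Q" for Q
    have finF: "finite (F N S)" for S
    proof -
      have "{l :: 'n set list. length l < N \<and> Sf l = S} \<subseteq> (\<Union>k<N. {l. length l = k})" by auto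
      then have "finite {l :: 'n set list. length l < N \<and> Sf l = S}"
        by (rule finite_subset) (auto simp: finite_words)
      then show ?thesis unfolding F_def by simp
    qed
    have fP: "(\<integral>\<^sup>+y\<in>P l. ennreal (f y) \<partial>lebesgue) < \<infinity>" for l
      using f fin by (intro set_nn_integral_finite) (auto simp: P_def cell_bounded)
    have maxS: "(\<integral>\<^sup>+x. ennreal (lmax (F N S) A x powr p * \<omega> x) \<partial>lebesgue) \<le> ennreal C0 * ?e" for S
      unfolding C0_def
    proof (rule muckenhoupt_laminar[where b = "measure lebesgue" and w = "\<lambda>Q. enn2real (weight_of \<omega> Q)"
          and v = "\<lambda>Q. enn2real (dual_of Q)"])
      show "laminar (F N S)"
        by (rule laminar_subset[OF laminar_cells[of S "\<lambda>_ _. True"]]) (auto simp: F_def P_def)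
      show "F N S \<subseteq> sets lebesgue" by (auto simp: F_def PS)
      fix Q assume "Q \<in> F N S"
      then obtain l where l: "Q = P l" by (auto simp: F_def)
      obtain w where w: "weight_of \<omega> Q = ennreal w" "0 < w"
        unfolding l P_def by (rule weight_of_cell)
      obtain v where v: "dual_of Q = ennreal v" "0 < v"
        unfolding l P_def by (rule dual_of_cell)
      show "0 < measure lebesgue Q" by (simp add: l bP0)
      show "0 < enn2real (weight_of \<omega> Q)" "0 < enn2real (dual_of Q)" using w v by auto
      show "emeasure lebesgue Q = ennreal (measure lebesgue Q)" by (simp add: l eP del: emeasure_completion)
      show "(\<integral>\<^sup>+x\<in>Q. ennreal (\<omega> x) \<partial>lebesgue) = ennreal (enn2real (weight_of \<omega> Q))"
        using w by (simp add: weight_of_def)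
      show "(\<integral>\<^sup>+x\<in>Q. ennreal (\<omega> x powr (- 1 / (p - 1))) \<partial>lebesgue) = ennreal (enn2real (dual_of Q))"
        using v by (simp add: dual_of_def \<sigma>_def)
      show "enn2real (dual_of Q) powr (p - 1) * enn2real (weight_of \<omega> Q) \<le> K * measure lebesgue Q powr p"
        unfolding l bP unfolding P_def using J by (intro K)
      show "0 \<le> A Q" by (simp add: A_def)
      show "ennreal (A Q * measure lebesgue Q) \<le> (\<integral>\<^sup>+x\<in>Q. ennreal (f x) \<partial>lebesgue)"
        using fP[of l] bP0[of l] by (simp add: A_def l)
    qed (use p K finF f \<omega>_nonneg \<omega>_pos in auto)
    have pt: "ennreal (runmax (\<lambda>i. avg f (pre i (code x))) N powr p * \<omega> x)
        \<le> (\<Sum>S\<in>UNIV. ennreal ((16 ^ CARD('n)) powr p) * ennreal (lmax (F N S) A x powr p * \<omega> x))" if x: "x \<in> Q0" for x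
    proof -
      define a where "a i = avg f (pre i (code x))" for i
      consider "runmax a N = 0" | i where "i < N" "runmax a N = a i" using runmax_cases[of a N] by blast
      then have "ennreal (runmax a N powr p * \<omega> x)
        \<le> (\<Sum>S\<in>UNIV. ennreal ((16 ^ CARD('n)) powr p) * ennreal (lmax (F N S) A x powr p * \<omega> x))"
      proof cases
        case 1
        then show ?thesis by simp
      next
        case 2
        define l where "l = pre i (code x)"
        have "x \<in> Nb l" unfolding l_def Nb_pre[OF x] using cell_subset_nbhd[of "k0 + i" x] cell_self by blast
        then have xP: "x \<in> P l" using Sf by (auto simp: P_def)
        have PF: "P l \<in> F N (Sf l)" using 2 by (auto simp: F_def l_def)
        have "a i \<le> enn2real (\<integral>\<^sup>+y\<in>P l. ennreal (f y) \<partial>lebesgue) / side (length l) ^ CARD('n)"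
          unfolding a_def avg_def l_def[symmetric] using fP[of l] Sf[of l]
          by (intro divide_right_mono enn2real_mono set_nn_integral_mono_set) (auto simp: P_def)
        also have "\<dots> = A (P l) * (measure lebesgue (P l) / side (length l) ^ CARD('n))"
          using bP0[of l] by (simp add: A_def)
        \<comment> \<open>The enclosing cell is four levels coarser, so its side is 2^4 times the
          side by which \<open>avg\<close> normalises.\<close>
        also have "measure lebesgue (P l) / side (length l) ^ CARD('n) = 16 ^ CARD('n)"
          unfolding bP power_divide[symmetric] by (simp add: side_def J(1) power_add)
        also have "A (P l) * 16 ^ CARD('n) \<le> lmax (F N (Sf l)) A x * 16 ^ CARD('n)"
          using finF PF xP by (intro mult_right_mono lmax_ge) auto
        finally have "a i powr p \<le> (lmax (F N (Sf l)) A x * 16 ^ CARD('n)) powr p"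
          using p by (intro powr_mono2) (auto simp: a_def avg_nonneg)
        also have "\<dots> = (16 ^ CARD('n)) powr p * lmax (F N (Sf l)) A x powr p"
          using lmax_nonneg[OF finF] by (simp add: powr_mult)
        finally have "runmax a N powr p * \<omega> x \<le> (16 ^ CARD('n)) powr p * (lmax (F N (Sf l)) A x powr p * \<omega> x)"
          using \<omega>_nonneg[of x] 2 by (simp add: mult_right_mono mult.assoc[symmetric])
        then have "ennreal (runmax a N powr p * \<omega> x) \<le> ennreal ((16 ^ CARD('n)) powr p) * ennreal (lmax (F N (Sf l)) A x powr p * \<omega> x)"
          using \<omega>_nonneg[of x] by (subst ennreal_mult[symmetric]) (auto intro: ennreal_leI)
        also have "\<dots> \<le> (\<Sum>S\<in>UNIV. ennreal ((16 ^ CARD('n)) powr p) * ennreal (lmax (F N S) A x powr p * \<omega> x))"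
          by (intro member_le_sum[of "Sf l" _ "\<lambda>S. ennreal ((16 ^ CARD('n)) powr p) * ennreal (lmax (F N S) A x powr p * \<omega> x)"]) auto
        finally show ?thesis .
      qed
      then show ?thesis by (simp add: a_def[abs_def])
    qed
    have [measurable]: "lmax (F N S) A \<in> borel_measurable lebesgue" for S
      using finF PS by (intro lmax_measurable) (auto simp: F_def)
    have "(\<integral>\<^sup>+x\<in>Q0. ennreal (runmax (\<lambda>i. avg f (pre i (code x))) N powr p * \<omega> x) \<partial>lebesgue)
        \<le> (\<integral>\<^sup>+x. (\<Sum>S\<in>UNIV. ennreal ((16 ^ CARD('n)) powr p) * ennreal (lmax (F N S) A x powr p * \<omega> x)) \<partial>lebesgue)"
      using pt by (intro nn_integral_mono) (auto simp: indicator_def)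
    also have "\<dots> = (\<Sum>S\<in>UNIV. ennreal ((16 ^ CARD('n)) powr p) * (\<integral>\<^sup>+x. ennreal (lmax (F N S) A x powr p * \<omega> x) \<partial>lebesgue))"
      by (subst nn_integral_sum) (auto simp: nn_integral_cmult)
    also have "\<dots> \<le> (\<Sum>S\<in>(UNIV :: 'n set set). ennreal ((16 ^ CARD('n)) powr p) * (ennreal C0 * ?e))"
      by (intro sum_mono mult_left_mono maxS) auto
    also have "\<dots> = ennreal ((16 ^ CARD('n)) powr p * (real (card (UNIV :: 'n set set)) * C0)) * ?e"
      using C0 by (simp add: ennreal_mult ennreal_of_nat_eq_real_of_nat mult_ac)
    also have "\<dots> \<le> ennreal C * ?e"
      by (intro mult_right_mono ennreal_leI) (auto simp: C_def)
    finally show ?thesis .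
  qed
  then show ?thesis using that C by blast
qed

text \<open>The factor side^(\<alpha> p) cancels against the weight of the tree, so a level of the
  energy is the integral of incr^p \<omega>. The sum over levels is then estimated pointwise by
  superadditivity of the p-th power.\<close>

lemma energy_incr_le:
  obtains C where "0 < C"
    "\<And>f. f \<in> borel_measurable lebesgue \<Longrightarrow> (\<And>x. 0 \<le> f x) \<Longrightarrow>
      pnorm f < \<infinity> \<Longrightarrow>
      energy p wt (\<lambda>l. side (length l) powr \<alpha> * incr f l)
        \<le> ennreal C * pnorm f"
proof -
  obtain C where C: "0 < C"
    "\<And>f N. f \<in> borel_measurable lebesgue \<Longrightarrow> (\<And>x. 0 \<le> f x) \<Longrightarrow>
      pnorm f < \<infinity> \<Longrightarrow>
      (\<integral>\<^sup>+x\<in>Q0. ennreal (runmax (\<lambda>i. avg f (pre i (code x))) N powr p * \<omega> x) \<partial>lebesgue)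
        \<le> ennreal C * pnorm f"
    by (rule runmax_energy) blast
  show ?thesis
  proof (rule that[OF C(1)])
    fix f :: "real ^ 'n \<Rightarrow> real"
    assume f: "f \<in> borel_measurable lebesgue" "\<And>x. 0 \<le> f x"
      "pnorm f < \<infinity>"
    let ?c = "\<lambda>l. side (length l) powr \<alpha> * incr f l"
    have lev: "ennreal (lev p wt ?c k) = (\<integral>\<^sup>+x\<in>Q0. ennreal (incr f (pre k (code x)) powr p * \<omega> x) \<partial>lebesgue)" for k
    proof -
      have "ennreal (lev p wt ?c k) = (\<Sum>l | length l = k. ennreal (?c l powr p * wt l))"
        unfolding lev_def using wt_pos less_imp_le by (intro sum_ennreal[symmetric]) (auto simp: less_imp_le)
      also have "\<dots> = (\<Sum>l | length l = k. ennreal (incr f l powr p) * weight_of \<omega> (dyad l))"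
      proof (intro sum.cong refl)
        fix l :: "'n set list"
        have "?c l powr p * wt l = incr f l powr p * (wt l * side (length l) powr (\<alpha> * p))"
          using incr_nonneg[of f l] by (simp add: powr_mult powr_powr)
        then show "ennreal (?c l powr p * wt l) = ennreal (incr f l powr p) * weight_of \<omega> (dyad l)"
          unfolding weight_dyad using wt_pos[of l] by (simp add: ennreal_mult[symmetric])
      qed
      also have "\<dots> = (\<integral>\<^sup>+x\<in>Q0. ennreal (incr f (pre k (code x)) powr p * \<omega> x) \<partial>lebesgue)"
        by (rule sum_words_weight) simp
      finally show ?thesis .
    qed
    have "(\<Sum>k<N. ennreal (lev p wt ?c k)) \<le> ennreal C * pnorm f" for N
    proof -
      have "(\<Sum>k<N. ennreal (lev p wt ?c k))
          = (\<integral>\<^sup>+x. (\<Sum>k<N. ennreal (incr f (pre k (code x)) powr p * \<omega> x) * indicator Q0 x) \<partial>lebesgue)"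
        unfolding lev using measurable_weighted[where g = "\<lambda>l. incr f l powr p"]
        by (subst nn_integral_sum) auto
      also have "\<dots> \<le> (\<integral>\<^sup>+x\<in>Q0. ennreal (runmax (\<lambda>i. avg f (pre i (code x))) N powr p * \<omega> x) \<partial>lebesgue)"
      proof (intro nn_integral_mono)
        fix x
        have "(\<Sum>k<N. ennreal (incr f (pre k (code x)) powr p * \<omega> x)) = ennreal ((\<Sum>k<N. incr f (pre k (code x)) powr p) * \<omega> x)"
          using \<omega>_nonneg[of x] by (subst sum_ennreal) (auto simp: sum_distrib_right)
        also have "\<dots> \<le> ennreal (runmax (\<lambda>i. avg f (pre i (code x))) N powr p * \<omega> x)"
          unfolding incr_pre using \<omega>_nonneg[of x] p
          by (intro ennreal_leI mult_right_mono runmax_increments_powr) auto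
        finally show "(\<Sum>k<N. ennreal (incr f (pre k (code x)) powr p * \<omega> x) * indicator Q0 x)
            \<le> ennreal (runmax (\<lambda>i. avg f (pre i (code x))) N powr p * \<omega> x) * indicator Q0 x"
          by (simp add: indicator_def)
      qed
      also have "\<dots> \<le> ennreal C * pnorm f"
        using f by (intro C)
      finally show ?thesis .
    qed
    then show "energy p wt ?c \<le> ennreal C * pnorm f"
      unfolding energy_def by (intro suminf_le_const) auto
  qed
qed

text \<open>Small energy makes the far part at most half of the required potential, so that the tree
  has to supply the other half.\<close>

lemma far_potential_le:
  obtains e0 where "0 < e0"
    "\<And>f x. f \<in> borel_measurable lebesgue \<Longrightarrow> (\<And>x. 0 \<le> f x) \<Longrightarrow>
      pnorm f \<le> ennreal e0 \<Longrightarrow> x \<in> Q0 \<Longrightarrow>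
      ennreal (side 0 powr (\<alpha> - real CARD('n))) * (\<integral>\<^sup>+y\<in>cube \<rho> x. ennreal (f y) \<partial>lebesgue) \<le> ennreal (1 / 2)"
proof -
  define B where "B = cube (\<rho> + side 0) x0"
  have B [measurable]: "B \<in> sets lebesgue" "bounded B" by (auto simp: B_def infnorm_cube_bounded)
  have sub: "cube \<rho> x \<subseteq> B" if "x \<in> Q0" for x
  proof
    fix y assume y: "y \<in> cube \<rho> x"
    have "infnorm (x - x0) < side 0"
      using that cell_subset_cube[of "{}" k0 x0] by (auto simp: Q0_def cube_def side_def)
    moreover have "infnorm (y - x) < \<rho>" using y by (simp add: cube_def)
    ultimately have "infnorm ((y - x) + (x - x0)) < \<rho> + side 0"
      using infnorm_triangle[of "y - x" "x - x0"] by linarith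
    then show "y \<in> B" by (simp add: B_def cube_def)
  qed
  obtain v where v: "dual_of B = ennreal v" "0 \<le> v"
    using dual_of_finite[OF B(2)] by (cases "dual_of B") auto
  define L where "L = side 0 powr (\<alpha> - real CARD('n))"
  have L: "0 < L" by (simp add: L_def)
  \<comment> \<open>First \<tau> is taken so large that the dual term contributes at most 1/4; then
    \<open>e0\<close> is chosen so that the energy term contributes 1/4. The v + 1 guards against v
    = 0.\<close>
  define \<tau> where "\<tau> = (1 / (4 * L * (v + 1))) powr (- (p - 1))"
  have \<tau>: "0 < \<tau>" using L v by (simp add: \<tau>_def)
  have "- (p - 1) * (- 1 / (p - 1)) = 1" using p by (simp add: divide_simps)
  then have "\<tau> powr (- 1 / (p - 1)) = 1 / (4 * L * (v + 1))"
    unfolding \<tau>_def powr_powr using L v by simp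
  then have "L * (\<tau> powr (- 1 / (p - 1)) * v) = v / (v + 1) / 4"
    using L v by simp
  also have "\<dots> \<le> 1 / 4" using v by simp
  finally have t1: "L * (\<tau> powr (- 1 / (p - 1)) * v) \<le> 1 / 4" .
  define e0 where "e0 = 1 / (4 * L * \<tau>)"
  have e0: "0 < e0" "L * (\<tau> * e0) = 1 / 4" using L \<tau> by (auto simp: e0_def)
  show ?thesis
  proof (rule that[OF e0(1)])
    fix f :: "real ^ 'n \<Rightarrow> real" and x
    assume f [measurable]: "f \<in> borel_measurable lebesgue" and f0: "\<And>x. 0 \<le> f x"
      and e: "pnorm f \<le> ennreal e0" and x: "x \<in> Q0"
    have "(\<integral>\<^sup>+y\<in>cube \<rho> x. ennreal (f y) \<partial>lebesgue) \<le> (\<integral>\<^sup>+y\<in>B. ennreal (f y) \<partial>lebesgue)"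
      by (rule set_nn_integral_mono_set[OF sub[OF x]])
    also have "\<dots> \<le> ennreal \<tau> * (\<integral>\<^sup>+x\<in>B. ennreal (f x powr p * \<omega> x) \<partial>lebesgue) + ennreal (\<tau> powr (- 1 / (p - 1))) * dual_of B"
      using f0 \<tau> by (intro set_nn_integral_le_young) auto
    also have "\<dots> \<le> ennreal \<tau> * ennreal e0 + ennreal (\<tau> powr (- 1 / (p - 1))) * ennreal v"
      unfolding v(1) using order_trans[OF set_nn_integral_mono_set[of B UNIV] , of lebesgue "\<lambda>x. ennreal (f x powr p * \<omega> x)" "ennreal e0"] e
      by (intro add_mono mult_left_mono) auto
    also have "\<dots> = ennreal (\<tau> * e0 + \<tau> powr (- 1 / (p - 1)) * v)"
      using \<tau> e0 v by (simp add: ennreal_mult)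
    finally have "ennreal L * (\<integral>\<^sup>+y\<in>cube \<rho> x. ennreal (f y) \<partial>lebesgue) \<le> ennreal L * ennreal (\<tau> * e0 + \<tau> powr (- 1 / (p - 1)) * v)"
      by (intro mult_left_mono) auto
    also have "\<dots> = ennreal (L * (\<tau> * e0) + L * (\<tau> powr (- 1 / (p - 1)) * v))"
      using L \<tau> e0 v by (simp add: ennreal_mult[symmetric] distrib_left del: ennreal_plus)
    also have "\<dots> \<le> ennreal (1 / 2)" using t1 e0 by (intro ennreal_leI) simp
    finally show "ennreal (side 0 powr (\<alpha> - real CARD('n))) * (\<integral>\<^sup>+y\<in>cube \<rho> x. ennreal (f y) \<partial>lebesgue) \<le> ennreal (1 / 2)"
      by (simp add: L_def)
  qed
qed

text \<open>This direction of the comparison corresponds to Wolff's inequality.\<close>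

lemma tcap_le_riesz_capacity:
  obtains C where "0 < C"
    "\<And>F. F \<subseteq> Q0 \<Longrightarrow> tcap p wt (code ` F) \<le> ennreal C * riesz_capacity \<alpha> p \<rho> \<omega> F"
proof -
  obtain C1 where C1: "0 < C1"
    "\<And>f. f \<in> borel_measurable lebesgue \<Longrightarrow> (\<And>x. 0 \<le> f x) \<Longrightarrow>
      pnorm f < \<infinity> \<Longrightarrow>
      energy p wt (\<lambda>l. side (length l) powr \<alpha> * incr f l)
        \<le> ennreal C1 * pnorm f"
    by (rule energy_incr_le) blast
  obtain e0 where e0: "0 < e0"
    "\<And>f x. f \<in> borel_measurable lebesgue \<Longrightarrow> (\<And>x. 0 \<le> f x) \<Longrightarrow>
      pnorm f \<le> ennreal e0 \<Longrightarrow> x \<in> Q0 \<Longrightarrow>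
      ennreal (side 0 powr (\<alpha> - real CARD('n))) * (\<integral>\<^sup>+y\<in>cube \<rho> x. ennreal (f y) \<partial>lebesgue) \<le> ennreal (1 / 2)"
    by (rule far_potential_le) blast
  define H where "H = 2 powr (real CARD('n) - \<alpha>) / (1 - 2 powr (- \<alpha>))"
  have "2 powr (- \<alpha>) < (1 :: real)" using \<alpha> by (simp add: powr_less_one)
  then have H: "0 < H" by (simp add: H_def)
  define h where "h = 1 / (2 * H)"
  have h: "0 < h" using H by (simp add: h_def)
  \<comment> \<open>The first summand serves energies up to \<open>e0\<close>. For larger energies
    the trivial bound \<open>wt []\<close> for the tree capacity is enough, and the second summand
    covers it.\<close>
  define C where "C = C1 / h powr p + wt [] / e0"
  have C: "0 < C" using C1 h wt_pos e0 by (simp add: C_def add_pos_pos)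
  have main: "tcap p wt (code ` F) \<le> ennreal C * e"
    if F: "F \<subseteq> Q0" and f: "f \<in> borel_measurable lebesgue" "\<And>x. 0 \<le> f x"
      and e: "e = pnorm f" "e < \<infinity>"
      and pot: "\<And>x. x \<in> F \<Longrightarrow> riesz_potential \<alpha> \<rho> f x \<ge> 1" for F f e
  proof (cases "e \<le> ennreal e0")
    case True
    let ?c = "\<lambda>l. side (length l) powr \<alpha> * incr f l"
    have "ennreal (h powr p) * tcap p wt (code ` F) \<le> energy p wt ?c"
    proof (rule tcap_le_energy_scaled)
      fix s assume "s \<in> code ` F"
      then obtain x where x: "x \<in> F" "s = code x" by blast
      then have xQ: "x \<in> Q0" using F by blast
      define Y where "Y = (\<Sum>k. ennreal (side (Suc k) powr (\<alpha> - real CARD('n))) * (\<integral>\<^sup>+y\<in>cube (side k) x. ennreal (f y) \<partial>lebesgue))"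
      have "1 \<le> riesz_potential \<alpha> \<rho> f x" by (rule pot[OF x(1)])
      also have "\<dots> \<le> ennreal (1 / 2) + Y"
        unfolding Y_def using True e by (intro order_trans[OF riesz_potential_le[OF f]] add_right_mono e0(2) f xQ) auto
      finally have Y: "ennreal (1 / 2) \<le> Y"
      proof (cases Y)
        case (real y)
        assume "1 \<le> ennreal (1 / 2) + Y"
        moreover have "ennreal (1 / 2 + y) = ennreal (1 / 2) + Y"
          unfolding real(2) using real(1) by (intro ennreal_plus) auto
        ultimately have "ennreal 1 \<le> ennreal (1 / 2 + y)" by simp
        then have "1 / 2 \<le> y" using real by (subst (asm) ennreal_le_iff) auto
        then show ?thesis unfolding real(2) by (rule ennreal_leI)
      qed simp
      have "Y \<le> ennreal H * (\<Sum>k. ennreal (side k powr \<alpha> * incr f (pre k (code x))))"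
        unfolding Y_def H_def using f e xQ by (intro near_potential_le) auto
      also have "(\<Sum>k. ennreal (side k powr \<alpha> * incr f (pre k (code x)))) = pot ?c s"
        by (simp add: pot_def x)
      finally have "ennreal (1 / 2) \<le> ennreal H * pot ?c s" using Y by (rule order_trans[rotated])
      then have "ennreal (1 / H) * ennreal (1 / 2) \<le> ennreal (1 / H) * (ennreal H * pot ?c s)"
        by (rule mult_left_mono) simp
      moreover have "ennreal (1 / H) * ennreal (1 / 2) = ennreal h"
        using H by (subst ennreal_mult[symmetric]) (auto simp: h_def)
      moreover have "ennreal (1 / H) * (ennreal H * pot ?c s) = pot ?c s"
        using H by (simp add: mult.assoc[symmetric] ennreal_mult[symmetric])
      ultimately show "ennreal h \<le> pot ?c s" by simp
    qed (use h wt_pos incr_nonneg in \<open>auto simp: less_imp_le\<close>)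
    also have "\<dots> \<le> ennreal C1 * e" using f e by (simp add: C1)
    finally have "ennreal (1 / h powr p) * (ennreal (h powr p) * tcap p wt (code ` F)) \<le> ennreal (1 / h powr p) * (ennreal C1 * e)"
      by (rule mult_left_mono) simp
    then have "tcap p wt (code ` F) \<le> ennreal (C1 / h powr p) * e"
      using h C1 by (simp add: mult.assoc[symmetric] ennreal_mult[symmetric])
    also have "\<dots> \<le> ennreal C * e"
      using wt_pos[of "[]"] e0 by (intro mult_right_mono ennreal_leI) (auto simp: C_def)
    finally show ?thesis .
  next
    case False
    have "tcap p wt (code ` F) \<le> ennreal (wt [])"
      using wt_pos by (intro tcap_le_root) (auto simp: less_imp_le)
    also have "\<dots> = ennreal (wt [] / e0) * ennreal e0"
      using wt_pos[of "[]"] e0 by (simp add: ennreal_mult[symmetric])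
    also have "\<dots> \<le> ennreal C * e"
      using False C1 h by (intro mult_mono ennreal_leI) (auto simp: C_def)
    finally show ?thesis .
  qed
  show ?thesis
  proof (rule that[OF C])
    fix F assume F: "F \<subseteq> Q0"
    have "ennreal (1 / C) * tcap p wt (code ` F) \<le> riesz_capacity \<alpha> p \<rho> \<omega> F"
      unfolding riesz_capacity_def
    proof (rule Inf_greatest, clarify)
      fix f :: "real ^ 'n \<Rightarrow> real"
      assume f: "f \<in> borel_measurable lebesgue" "\<forall>x. 0 \<le> f x"
        "pnorm f < \<infinity>" "\<forall>x\<in>F. 1 \<le> riesz_potential \<alpha> \<rho> f x"
      have "ennreal (1 / C) * tcap p wt (code ` F)
          \<le> ennreal (1 / C) * (ennreal C * pnorm f)"
        using f F by (intro mult_left_mono main[of F f]) auto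
      also have "\<dots> = pnorm f"
        using C by (simp add: mult.assoc[symmetric] ennreal_mult[symmetric])
      finally show "ennreal (1 / C) * tcap p wt (code ` F) \<le> pnorm f" .
    qed
    then have "ennreal C * (ennreal (1 / C) * tcap p wt (code ` F)) \<le> ennreal C * riesz_capacity \<alpha> p \<rho> \<omega> F"
      by (rule mult_left_mono) simp
    then show "tcap p wt (code ` F) \<le> ennreal C * riesz_capacity \<alpha> p \<rho> \<omega> F"
      using C by (simp add: mult.assoc[symmetric] ennreal_mult[symmetric])
  qed
qed

end

section \<open>Sets of capacity zero\<close>

lemma ennpowr_ennreal: "0 \<le> x \<Longrightarrow> ennpowr (ennreal x) s = ennreal (x powr s)"
  by (simp add: ennpowr_def)

lemma ennpowr_mono:
  assumes "x \<le> y" "0 \<le> s"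
  shows "ennpowr x s \<le> ennpowr y s"
proof (cases "y = \<infinity>")
  case False
  then have "x \<noteq> \<infinity>" using assms(1) by (auto simp: top_unique)
  moreover have "enn2real x \<le> enn2real y" using assms(1) False by (intro enn2real_mono) (auto simp: less_top)
  ultimately show ?thesis using False assms(2) by (auto simp: ennpowr_def intro!: ennreal_leI powr_mono2)
qed (simp add: ennpowr_def)

lemma riesz_capacity_mono: "A \<subseteq> B \<Longrightarrow> riesz_capacity \<alpha> p \<rho> \<omega> A \<le> riesz_capacity \<alpha> p \<rho> \<omega> B"
  unfolding riesz_capacity_def by (intro Inf_superset_mono) auto

lemma riesz_kernel_nonneg: "0 \<le> riesz_kernel \<alpha> \<rho> x"
  by (simp add: riesz_kernel_def)

lemma riesz_potential_mono:
  assumes "AE y in lebesgue. f y \<le> g y"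
  shows "riesz_potential \<alpha> \<rho> f x \<le> riesz_potential \<alpha> \<rho> g x"
  unfolding riesz_potential_def using assms
  by (intro nn_integral_mono_AE) (auto elim!: eventually_mono intro!: ennreal_leI mult_left_mono riesz_kernel_nonneg)

lemma riesz_kernel_measurable [measurable]:
  fixes x :: "real ^ 'n"
  shows "(\<lambda>y. riesz_kernel \<alpha> \<rho> (x - y)) \<in> borel_measurable lebesgue"
proof -
  have inf: "(infnorm :: real ^ 'n \<Rightarrow> real) \<in> borel_measurable borel"
    by (intro borel_measurable_continuous_onI continuous_on_infnorm continuous_on_id)
  have k: "riesz_kernel \<alpha> \<rho> = (\<lambda>z :: real ^ 'n. infnorm z powr (\<alpha> - real CARD('n)) * (if infnorm z < \<rho> then 1 else 0))"
    by (auto simp: riesz_kernel_def indicator_def)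
  have "(\<lambda>y. riesz_kernel \<alpha> \<rho> (x - y)) \<in> borel_measurable borel"
    unfolding k using inf by measurable
  then have "(\<lambda>y. riesz_kernel \<alpha> \<rho> (x - y)) \<in> borel_measurable lborel" by simp
  then show ?thesis by (rule measurable_completion)
qed

section \<open>Countable unions of sets of capacity zero\<close>

context local_Ap
begin

text \<open>g = (\<Sum> f_i^p)^(1/p) has at most the sum of the energies and dominates all f_i.
  Where the series is infinite \<open>enn2real\<close> gives 0, so the domination holds only almost
  everywhere, which suffices for potentials.\<close>

lemma dominating_function:
  assumes [measurable]: "\<And>i. f i \<in> borel_measurable lebesgue" and f: "\<And>i x. 0 \<le> f i x"
    and e: "(\<Sum>i. \<integral>\<^sup>+x. ennreal (f i x powr p * \<omega> x) \<partial>lebesgue) \<le> ennreal e"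
  obtains g where "g \<in> borel_measurable lebesgue" "\<And>x. 0 \<le> g x"
    "pnorm g \<le> ennreal e"
    "\<And>i :: nat. AE x in lebesgue. f i x \<le> g x"
proof
  define G where "G x = (\<Sum>i. ennreal (f i x powr p))" for x
  have [measurable]: "G \<in> borel_measurable lebesgue" unfolding G_def by measurable
  define g where "g x = enn2real (G x) powr (1 / p)" for x
  show "g \<in> borel_measurable lebesgue" unfolding g_def by measurable
  show "0 \<le> g x" for x by (simp add: g_def)
  have "(\<integral>\<^sup>+x. G x * ennreal (\<omega> x) \<partial>lebesgue) = (\<integral>\<^sup>+x. (\<Sum>i. ennreal (f i x powr p * \<omega> x)) \<partial>lebesgue)"
    unfolding G_def ennreal_suminf_multc[symmetric]
    by (intro nn_integral_cong suminf_cong ennreal_mult[symmetric]) (auto simp: \<omega>_nonneg)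
  also have "\<dots> \<le> ennreal e" using e by (subst nn_integral_suminf) auto
  finally have Ge: "(\<integral>\<^sup>+x. G x * ennreal (\<omega> x) \<partial>lebesgue) \<le> ennreal e" .
  have "pnorm g \<le> (\<integral>\<^sup>+x. G x * ennreal (\<omega> x) \<partial>lebesgue)"
  proof (intro nn_integral_mono)
    fix x
    have "g x powr p = enn2real (G x)" using p by (simp add: g_def powr_powr)
    then have "ennreal (g x powr p * \<omega> x) = ennreal (enn2real (G x)) * ennreal (\<omega> x)"
      using \<omega>_nonneg[of x] by (simp add: ennreal_mult)
    also have "ennreal (enn2real (G x)) \<le> G x" by (cases "G x") auto
    then have "ennreal (enn2real (G x)) * ennreal (\<omega> x) \<le> G x * ennreal (\<omega> x)"
      by (rule mult_right_mono) simp
    finally show "ennreal (g x powr p * \<omega> x) \<le> G x * ennreal (\<omega> x)" .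
  qed
  then show "pnorm g \<le> ennreal e" using Ge by (rule order_trans)
  have "AE x in lebesgue. G x * ennreal (\<omega> x) \<noteq> \<infinity>"
    using Ge by (intro nn_integral_noteq_infinite) (auto simp: top_unique)
  then have fin: "AE x in lebesgue. G x < \<infinity>"
    using \<omega>_pos
  proof eventually_elim
    case (elim x)
    then have "G x \<noteq> top" by (auto simp: ennreal_top_mult)
    then show ?case by (simp add: top.not_eq_extremum)
  qed
  show "AE x in lebesgue. f i x \<le> g x" for i
    using fin
  proof eventually_elim
    case (elim x)
    have "(\<Sum>j\<in>{i}. ennreal (f j x powr p)) \<le> G x"
      unfolding G_def by (rule sum_le_suminf) auto
    then have "ennreal (f i x powr p) \<le> G x" by simp
    then have "f i x powr p \<le> enn2real (G x)"
      using elim by (cases "G x") auto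
    then have "(f i x powr p) powr (1 / p) \<le> g x"
      unfolding g_def using p by (intro powr_mono2) auto
    then show ?case using f[of i x] p by (simp add: powr_powr)
  qed
qed

lemma riesz_capacity_zero_UN:
  assumes "\<And>i :: nat. riesz_capacity \<alpha> p \<rho> \<omega> (A i) = 0"
  shows "riesz_capacity \<alpha> p \<rho> \<omega> (\<Union>i. A i) = 0"
proof -
  have *: "riesz_capacity \<alpha> p \<rho> \<omega> (\<Union>i. A i) \<le> 0 + ennreal \<epsilon>" if "0 < \<epsilon>" for \<epsilon>
  proof -
    have "\<exists>f. f \<in> borel_measurable lebesgue \<and> (\<forall>x. 0 \<le> f x) \<and>
        pnorm f \<le> ennreal (\<epsilon> * (1 / 2) ^ Suc i) \<and>
        (\<forall>x\<in>A i. 1 \<le> riesz_potential \<alpha> \<rho> f x)" for i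
    proof -
      have "riesz_capacity \<alpha> p \<rho> \<omega> (A i) < ennreal (\<epsilon> * (1 / 2) ^ Suc i)"
        using assms that by simp
      then show ?thesis unfolding riesz_capacity_def Inf_less_iff by (fastforce intro: less_imp_le)
    qed
    then have "\<forall>i. \<exists>f. f \<in> borel_measurable lebesgue \<and> (\<forall>x. 0 \<le> f x) \<and>
        pnorm f \<le> ennreal (\<epsilon> * (1 / 2) ^ Suc i) \<and>
        (\<forall>x\<in>A i. 1 \<le> riesz_potential \<alpha> \<rho> f x)" ..
    from choice[OF this] obtain f where f: "\<And>i. f i \<in> borel_measurable lebesgue" "\<And>i x. 0 \<le> f i x"
      "\<And>i. pnorm (f i) \<le> ennreal (\<epsilon> * (1 / 2) ^ Suc i)"
      "\<And>i x. x \<in> A i \<Longrightarrow> 1 \<le> riesz_potential \<alpha> \<rho> (f i) x" by blast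
    have "(\<Sum>i. \<integral>\<^sup>+x. ennreal (f i x powr p * \<omega> x) \<partial>lebesgue) \<le> (\<Sum>i. ennreal (\<epsilon> * (1 / 2) ^ Suc i))"
      using f(3) by (intro suminf_le) auto
    also have "\<dots> = ennreal \<epsilon>"
    proof (rule suminf_ennreal_eq)
      show "(\<lambda>i. \<epsilon> * (1 / 2) ^ Suc i) sums \<epsilon>"
        using sums_mult[OF power_half_series, of \<epsilon>] by simp
    qed (use that in auto)
    finally obtain g where g: "g \<in> borel_measurable lebesgue" "\<And>x. 0 \<le> g x"
      "pnorm g \<le> ennreal \<epsilon>" "\<And>i. AE x in lebesgue. f i x \<le> g x"
      using dominating_function[of f \<epsilon>] f(1,2) by blast
    have "1 \<le> riesz_potential \<alpha> \<rho> g x" if "x \<in> (\<Union>i. A i)" for x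
      using that f(4) riesz_potential_mono[OF g(4)] by (meson UN_E order_trans)
    then have "riesz_capacity \<alpha> p \<rho> \<omega> (\<Union>i. A i) \<le> pnorm g"
      unfolding riesz_capacity_def using g by (intro Inf_lower) (auto intro!: exI[of _ g] simp: le_less_trans)
    then show ?thesis using g(3) by simp
  qed
  have "riesz_capacity \<alpha> p \<rho> \<omega> (\<Union>i. A i) \<le> 0"
    by (rule ennreal_le_epsilon) (rule *)
  then show ?thesis by simp
qed

end

section \<open>From tree capacity zero to Riesz capacity zero\<close>

context riesz_root
begin

lemma dyad_pre_antimono:
  assumes "x \<in> Q0" "j \<le> k"
  shows "dyad (pre k (code x)) \<subseteq> dyad (pre j (code x))"
  unfolding dyad_pre[OF assms(1)] using assms(2) by (intro cell_antimono) simp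

text \<open>The cells around a point are nested, so the contributions of different levels to its
  potential are collected on disjoint differences. Halving the side leaves at most half of the
  volume to the inner cell, with equality in dimension 1.\<close>

lemma emeasure_annulus:
  assumes "x \<in> Q0"
  shows "ennreal (side k ^ CARD('n) / 2) \<le> emeasure lebesgue (dyad (pre k (code x)) - dyad (pre (Suc k) (code x)))"
proof -
  have e: "emeasure lebesgue (dyad (pre j (code x))) = ennreal (side j ^ CARD('n))" for j
    using emeasure_dyad[of "pre j (code x)"] by simp
  have "emeasure lebesgue (dyad (pre k (code x)) - dyad (pre (Suc k) (code x)))
      = emeasure lebesgue (dyad (pre k (code x))) - emeasure lebesgue (dyad (pre (Suc k) (code x)))"
    using dyad_pre_antimono[OF assms, of k "Suc k"] e[of "Suc k"] by (intro emeasure_Diff) auto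
  also have "\<dots> = ennreal (side k ^ CARD('n) - side (Suc k) ^ CARD('n))"
    unfolding e by (intro ennreal_minus) simp
  also have "\<dots> \<ge> ennreal (side k ^ CARD('n) / 2)"
  proof (intro ennreal_leI)
    have "CARD('n) = Suc (CARD('n) - 1)" by simp
    then have "(1 / 2 :: real) ^ CARD('n) \<le> (1 / 2) ^ 1" by (intro power_decreasing) auto
    then have "side k ^ CARD('n) * (1 / 2) ^ CARD('n) \<le> side k ^ CARD('n) * (1 / 2)"
      by (intro mult_left_mono) auto
    then show "side k ^ CARD('n) / 2 \<le> side k ^ CARD('n) - side (Suc k) ^ CARD('n)"
      by (simp add: side_Suc power_divide)
  qed
  finally show ?thesis .
qed

text \<open>On the annulus of level k around x the kernel is at least side^(\<alpha>-n), the
  competitor is at least 2 c side^(-\<alpha>), and the volume is at least side^n / 2. The powers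
  cancel, each annulus contributes c of its word, and the total is the tree potential.\<close>

lemma riesz_capacity_zero_of_tcap:
  assumes A: "A \<subseteq> Q0" and zero: "tcap p wt (code ` A) = 0"
  shows "riesz_capacity \<alpha> p \<rho> \<omega> A = 0"
proof -
  have *: "riesz_capacity \<alpha> p \<rho> \<omega> A \<le> 0 + ennreal \<epsilon>" if \<epsilon>: "0 < \<epsilon>" for \<epsilon>
  proof -
    define \<epsilon>' where "\<epsilon>' = \<epsilon> / 2 powr p"
    have \<epsilon>': "0 < \<epsilon>'" using \<epsilon> by (simp add: \<epsilon>'_def)
    obtain c where c: "\<And>l. 0 \<le> c l" "\<And>s. s \<in> code ` A \<Longrightarrow> 1 \<le> pot c s"
      "energy p wt c \<le> tcap p wt (code ` A) + ennreal \<epsilon>'"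
      using tcap_near[of p wt "code ` A" \<epsilon>'] \<epsilon>' zero by auto
    \<comment> \<open>The factor 2 compensates for the half of the volume lost in
      \<open>emeasure_annulus\<close>; \<epsilon>' was divided by 2^p to pay for it in the
      energy.\<close>
    define d where "d l = 2 * (c l * side (length l) powr (- \<alpha>))" for l
    have d0: "0 \<le> d l" for l using c by (simp add: d_def)
    define f where "f k x = d (pre k (code x)) * indicat_real Q0 x" for k x
    have fm: "f k \<in> borel_measurable lebesgue" for k unfolding f_def by measurable
    have f0: "0 \<le> f k x" for k x by (simp add: f_def d0)
    have "pnorm (f k) = ennreal (2 powr p) * ennreal (lev p wt c k)" for k
    proof -
      have "pnorm (f k) = (\<integral>\<^sup>+x\<in>Q0. ennreal (d (pre k (code x)) powr p * \<omega> x) \<partial>lebesgue)"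
        using p by (intro nn_integral_cong) (auto simp: f_def indicator_def)
      also have "\<dots> = (\<Sum>l | length l = k. ennreal (d l powr p) * weight_of \<omega> (dyad l))"
        by (rule sum_words_weight[symmetric]) simp
      also have "\<dots> = (\<Sum>l | length l = k. ennreal (2 powr p) * ennreal (c l powr p * wt l))"
      proof (intro sum.cong refl)
        fix l :: "'n set list"
        have "side (length l) powr (- \<alpha> * p) * side (length l) powr (\<alpha> * p) = 1"
          by (simp add: powr_add[symmetric])
        then have "d l powr p * (wt l * side (length l) powr (\<alpha> * p)) = 2 powr p * (c l powr p * wt l)"
          using c(1)[of l] by (simp add: d_def powr_mult powr_powr mult_ac)
        then show "ennreal (d l powr p) * weight_of \<omega> (dyad l) = ennreal (2 powr p) * ennreal (c l powr p * wt l)"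
          unfolding weight_dyad using wt_pos[of l] by (simp add: ennreal_mult[symmetric])
      qed
      also have "\<dots> = ennreal (2 powr p) * ennreal (lev p wt c k)"
        unfolding lev_def sum_distrib_left[symmetric] using wt_pos by (subst sum_ennreal) (auto simp: less_imp_le)
      finally show ?thesis .
    qed
    then have "(\<Sum>k. \<integral>\<^sup>+x. ennreal (f k x powr p * \<omega> x) \<partial>lebesgue) = ennreal (2 powr p) * energy p wt c"
      by (simp add: energy_def)
    also have "\<dots> \<le> ennreal (2 powr p) * ennreal \<epsilon>'"
      using c(3) zero by (intro mult_left_mono) auto
    also have "\<dots> = ennreal \<epsilon>" using \<epsilon> by (simp add: \<epsilon>'_def ennreal_mult[symmetric])
    finally obtain g where g: "g \<in> borel_measurable lebesgue" "\<And>x. 0 \<le> g x"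
      "pnorm g \<le> ennreal \<epsilon>" "\<And>i. AE x in lebesgue. f i x \<le> g x"
      using dominating_function[of f \<epsilon>] fm f0 by blast
    have "1 \<le> riesz_potential \<alpha> \<rho> g x" if "x \<in> A" for x
    proof -
      have x: "x \<in> Q0" using that A by blast
      let ?Q = "\<lambda>k. dyad (pre k (code x))"
      define D where "D k = ?Q k - ?Q (Suc k)" for k
      have D_sets [measurable]: "D k \<in> sets lebesgue" for k unfolding D_def by measurable
      have disj: "disjoint_family D"
      proof -
        have "D i \<inter> D j = {}" if "i < j" for i j
          using dyad_pre_antimono[OF x, of "Suc i" j] that by (auto simp: D_def)
        then show ?thesis unfolding disjoint_family_on_def by (metis Int_commute linorder_neqE_nat)
      qed
      let ?h = "\<lambda>y. ennreal (riesz_kernel \<alpha> \<rho> (x - y) * g y)"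
      have hm [measurable]: "?h \<in> borel_measurable lebesgue" using g(1) by measurable
      have piece: "ennreal (c (pre k (code x))) \<le> (\<integral>\<^sup>+y\<in>D k. ?h y \<partial>lebesgue)" for k
      proof -
        define v where "v = side k powr (\<alpha> - real CARD('n)) * d (pre k (code x))"
        have v0: "0 \<le> v" by (simp add: v_def d0)
        have "v * (side k ^ CARD('n) / 2) = (side k powr (\<alpha> - real CARD('n)) * side k powr (- \<alpha>) * side k powr (real CARD('n))) * c (pre k (code x))"
          by (simp add: v_def d_def powr_realpow)
        also have "\<dots> = c (pre k (code x))" by (simp add: powr_add[symmetric])
        finally have "ennreal (c (pre k (code x))) = ennreal v * ennreal (side k ^ CARD('n) / 2)"
          using v0 by (simp add: ennreal_mult[symmetric])
        also have "\<dots> \<le> ennreal v * emeasure lebesgue (D k)"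
          unfolding D_def by (intro mult_left_mono emeasure_annulus x) auto
        also have "\<dots> = (\<integral>\<^sup>+y. ennreal v * indicator (D k) y \<partial>lebesgue)"
          by (rule nn_integral_cmult_indicator[symmetric]) (rule D_sets)
        also have "\<dots> \<le> (\<integral>\<^sup>+y\<in>D k. ?h y \<partial>lebesgue)"
        proof (rule nn_integral_mono_AE)
          show "AE y in lebesgue. ennreal v * indicator (D k) y \<le> ?h y * indicator (D k) y"
            using g(4)[of k]
          proof eventually_elim
            case (elim y)
            show ?case
            proof (cases "y \<in> D k")
              case True
              then have y: "y \<in> Q0" "pre k (code y) = pre k (code x)" "y \<in> ?Q k" "y \<notin> ?Q (Suc k)"
                by (auto simp: D_def dyad_def)
              have "y \<noteq> x" using y(4) mem_dyad_pre[OF x] by blast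
              then have t0: "0 < infnorm (x - y)" by (simp add: infnorm_pos_lt)
              have "y \<in> cube (side k) x"
                using y(3) cell_subset_cube[of "{}" "k0 + k" x] unfolding dyad_pre[OF x] by (auto simp: side_def)
              then have t1: "infnorm (x - y) < side k" by (simp add: cube_def infnorm_sub)
              then have "infnorm (x - y) < \<rho>" using side_decreasing[of 0 k] k0(2) by (simp add: side_def)
              then have "riesz_kernel \<alpha> \<rho> (x - y) = infnorm (x - y) powr (\<alpha> - real CARD('n))"
                by (simp add: riesz_kernel_def)
              also have "\<dots> \<ge> side k powr (\<alpha> - real CARD('n))"
                using t0 t1 \<alpha> by (intro powr_mono2') auto
              finally have "v \<le> riesz_kernel \<alpha> \<rho> (x - y) * f k y"
                unfolding v_def using d0 y by (simp add: f_def mult_right_mono)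
              also have "\<dots> \<le> riesz_kernel \<alpha> \<rho> (x - y) * g y"
                using elim by (intro mult_left_mono riesz_kernel_nonneg)
              finally show ?thesis using True by (simp add: ennreal_leI)
            qed simp
          qed
        qed
        finally show ?thesis .
      qed
      have "1 \<le> pot c (code x)" using that c(2) by blast
      also have "\<dots> \<le> (\<Sum>k. \<integral>\<^sup>+y\<in>D k. ?h y \<partial>lebesgue)"
        unfolding pot_def by (intro suminf_le piece) auto
      also have "\<dots> = (\<integral>\<^sup>+y\<in>(\<Union>k. D k). ?h y \<partial>lebesgue)"
        by (rule nn_integral_disjoint_family[symmetric]) (use hm D_sets disj in auto)
      also have "\<dots> \<le> riesz_potential \<alpha> \<rho> g x"
        unfolding riesz_potential_def by (intro nn_integral_mono) (auto simp: indicator_def)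
      finally show ?thesis .
    qed
    then have "riesz_capacity \<alpha> p \<rho> \<omega> A \<le> pnorm g"
      unfolding riesz_capacity_def using g by (intro Inf_lower) (auto intro!: exI[of _ g] simp: le_less_trans)
    then show ?thesis using g(3) by simp
  qed
  have "riesz_capacity \<alpha> p \<rho> \<omega> A \<le> 0"
    by (rule ennreal_le_epsilon) (rule *)
  then show ?thesis by simp
qed

end

section \<open>Thin points\<close>

context riesz_root
begin

definition shell :: "nat \<Rightarrow> real set" where
  "shell k = {side (Suc k)..<side k}"

lemma shell_disjoint: "disjoint_family shell"
proof -
  have "shell i \<inter> shell j = {}" if "i < j" for i j
    using side_decreasing[of "Suc i" j] that by (auto simp: shell_def)
  then show ?thesis unfolding disjoint_family_on_def by (metis Int_commute linorder_neqE_nat)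
qed

lemma shell_sets [measurable]: "shell k \<in> sets lebesgue"
  by (simp add: shell_def)

lemma emeasure_shell: "emeasure lebesgue (shell k) = ennreal (side (Suc k))"
  by (simp add: shell_def side_Suc)

lemma nn_integral_shells:
  "(\<integral>\<^sup>+t. (\<Sum>k. ennreal (m k) * indicator (shell k) t) \<partial>lebesgue) = (\<Sum>k. ennreal (m k) * ennreal (side (Suc k)))"
proof -
  have "(\<integral>\<^sup>+t. (\<Sum>k. ennreal (m k) * indicator (shell k) t) \<partial>lebesgue)
      = (\<Sum>k. \<integral>\<^sup>+t. ennreal (m k) * indicator (shell k) t \<partial>lebesgue)"
    by (rule nn_integral_suminf) measurable
  also have "\<dots> = (\<Sum>k. ennreal (m k) * emeasure lebesgue (shell k))"
    by (intro suminf_cong nn_integral_cmult_indicator shell_sets)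
  finally show ?thesis by (simp only: emeasure_shell)
qed

lemma shell_cases:
  assumes "0 < t" "t < side 0"
  obtains k where "t \<in> shell k"
  using side_between[OF assms] by (auto simp: shell_def)

lemma weight_of_cube:
  assumes "0 < t"
  obtains u where "weight_of \<omega> (cube t a) = ennreal u" "0 < u"
proof -
  have "emeasure lebesgue (cube t a) \<noteq> 0" using assms emeasure_cube[of t a] by simp
  then have "0 < weight_of \<omega> (cube t a)" by (intro weight_of_pos) auto
  moreover have "weight_of \<omega> (cube t a) < \<infinity>" by (intro weight_of_finite infnorm_cube_bounded)
  ultimately show ?thesis using that by (cases "weight_of \<omega> (cube t a)") auto
qed

lemma cube_mono: "s \<le> t \<Longrightarrow> cube s a \<subseteq> cube t a"
  by (auto simp: cube_def)

lemma dyad_subset_cube: "a \<in> Q0 \<Longrightarrow> side k \<le> t \<Longrightarrow> dyad (pre k (code a)) \<subseteq> cube t a"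
  using cell_subset_cube[of "{}" "k0 + k" a] cube_mono[of "side k" t a] by (auto simp: dyad_pre side_def)

text \<open>If the series converged, the integral would be finite: for t in shell k the cube
  contains the dyadic cube of level k + 1, which bounds the integrand by a multiple of wt^(-q) /
  side. The range from \<open>side 0\<close> to \<rho> contributes a finite amount.\<close>

lemma divergent_weights:
  assumes a: "a \<in> Q0"
    and inf: "(\<integral>\<^sup>+t\<in>{0<..<\<rho>}. ennpowr (ennreal (t powr (\<alpha> * p)) / weight_of \<omega> (cube t a)) (conj_exp p - 1)
          / ennreal t \<partial>lebesgue) = \<infinity>"
  shows "\<not> summable (\<lambda>k. wt (pre k (code a)) powr (- (1 / (p - 1))))"
proof
  assume sm: "summable (\<lambda>k. wt (pre k (code a)) powr (- (1 / (p - 1))))"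
  define q where "q = 1 / (p - 1)"
  have q: "0 < q" "conj_exp p - 1 = q" using p by (auto simp: q_def conj_exp_def field_simps)
  obtain u0 where u0: "weight_of \<omega> (cube (side 0) a) = ennreal u0" "0 < u0"
    using weight_of_cube[of "side 0" a] by auto
  define cf where "cf = (\<rho> powr (\<alpha> * p) / u0) powr q / side 0"
  define m where "m k = (2 powr (\<alpha> * p) / wt (pre (Suc k) (code a))) powr q / side (Suc k)" for k
  have m0: "0 \<le> m k" for k by (simp add: m_def)
  have \<alpha>p: "0 < \<alpha> * p" using \<alpha> p by simp
  have [measurable]: "{0<..<\<rho>} \<in> sets lebesgue" by simp
  let ?Y = "\<lambda>t. ennpowr (ennreal (t powr (\<alpha> * p)) / weight_of \<omega> (cube t a)) q / ennreal t"
  have "?Y t * indicator {0<..<\<rho>} t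
      \<le> ennreal cf * indicator {0<..<\<rho>} t + (\<Sum>k. ennreal (m k) * indicator (shell k) t)" for t
  proof (cases "t \<in> {0<..<\<rho>}")
    case True
    then have t: "0 < t" "t < \<rho>" by auto
    obtain u where u: "weight_of \<omega> (cube t a) = ennreal u" "0 < u" using weight_of_cube[OF t(1)] .
    have Y: "?Y t = ennreal ((t powr (\<alpha> * p) / u) powr q / t)"
      using t u by (simp add: divide_ennreal ennpowr_ennreal)
    show ?thesis
    proof (cases "side 0 \<le> t")
      case far: True
      have "weight_of \<omega> (cube (side 0) a) \<le> weight_of \<omega> (cube t a)" by (intro weight_of_mono cube_mono far)
      then have "u0 \<le> u" using u u0 by simp
      then have "(t powr (\<alpha> * p) / u) powr q / t \<le> cf"
        unfolding cf_def using t u0 far q \<alpha>p by (intro frac_le powr_mono2) auto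
      then have "?Y t \<le> ennreal cf" unfolding Y by (rule ennreal_leI)
      then show ?thesis using True by (simp add: add_increasing2)
    next
      case False
      then have "t < side 0" by simp
      then obtain k where k: "t \<in> shell k" using shell_cases[OF t(1)] by blast
      then have kt: "side (Suc k) \<le> t" "t < side k" by (auto simp: shell_def)
      let ?l = "pre (Suc k) (code a)"
      have "weight_of \<omega> (dyad ?l) \<le> weight_of \<omega> (cube t a)"
        by (intro weight_of_mono dyad_subset_cube a kt)
      then have le: "wt ?l * side (Suc k) powr (\<alpha> * p) \<le> u"
        unfolding weight_dyad using u by simp
      have "t powr (\<alpha> * p) / u \<le> side k powr (\<alpha> * p) / (wt ?l * side (Suc k) powr (\<alpha> * p))"
        using kt t le wt_pos[of ?l] \<alpha>p by (intro frac_le powr_mono2) auto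
      also have "side k powr (\<alpha> * p) = 2 powr (\<alpha> * p) * side (Suc k) powr (\<alpha> * p)"
        by (simp add: side_Suc powr_divide)
      also have "2 powr (\<alpha> * p) * side (Suc k) powr (\<alpha> * p) / (wt ?l * side (Suc k) powr (\<alpha> * p)) = 2 powr (\<alpha> * p) / wt ?l"
        by simp
      finally have le': "t powr (\<alpha> * p) / u \<le> 2 powr (\<alpha> * p) / wt ?l" .
      have "(t powr (\<alpha> * p) / u) powr q \<le> (2 powr (\<alpha> * p) / wt ?l) powr q"
        by (rule powr_mono2) (use q u le' in auto)
      then have "(t powr (\<alpha> * p) / u) powr q / t \<le> m k"
        unfolding m_def using kt by (intro frac_le) auto
      then have "?Y t \<le> ennreal (m k)" unfolding Y by (rule ennreal_leI)
      also have "ennreal (m k) = (\<Sum>k. ennreal (m k) * indicator (shell k) t)"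
        using suminf_cmult_indicator[OF shell_disjoint k, of "\<lambda>k. ennreal (m k)"] by simp
      finally show ?thesis using True by (simp add: add_increasing)
    qed
  qed simp
  then have "(\<integral>\<^sup>+t\<in>{0<..<\<rho>}. ?Y t \<partial>lebesgue)
     \<le> (\<integral>\<^sup>+t. ennreal cf * indicator {0<..<\<rho>} t + (\<Sum>k. ennreal (m k) * indicator (shell k) t) \<partial>lebesgue)"
    by (rule nn_integral_mono)
  also have "\<dots> = (\<integral>\<^sup>+t. ennreal cf * indicator {0<..<\<rho>} t \<partial>lebesgue) + (\<integral>\<^sup>+t. (\<Sum>k. ennreal (m k) * indicator (shell k) t) \<partial>lebesgue)"
    by (rule nn_integral_add) auto
  also have "(\<integral>\<^sup>+t. ennreal cf * indicator {0<..<\<rho>} t \<partial>lebesgue) = ennreal cf * ennreal \<rho>"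
    using \<rho> by (simp add: nn_integral_cmult_indicator)
  also have "(\<integral>\<^sup>+t. (\<Sum>k. ennreal (m k) * indicator (shell k) t) \<partial>lebesgue)
      = (\<Sum>k. ennreal ((2 powr (\<alpha> * p)) powr q * wt (pre (Suc k) (code a)) powr (- q)))"
    unfolding nn_integral_shells
  proof (intro suminf_cong)
    fix k
    have "m k * side (Suc k) = (2 powr (\<alpha> * p)) powr q * wt (pre (Suc k) (code a)) powr (- q)"
      using wt_pos[of "pre (Suc k) (code a)"] by (simp add: m_def powr_divide powr_minus_divide)
    then show "ennreal (m k) * ennreal (side (Suc k)) = ennreal ((2 powr (\<alpha> * p)) powr q * wt (pre (Suc k) (code a)) powr (- q))"
      using m0[of k] by (simp add: ennreal_mult[symmetric])
  qed
  also have "\<dots> = ennreal (\<Sum>k. (2 powr (\<alpha> * p)) powr q * wt (pre (Suc k) (code a)) powr (- q))"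
  proof (intro suminf_ennreal_eq summable_sums summable_mult)
    show "summable (\<lambda>k. wt (pre (Suc k) (code a)) powr (- q))"
      using sm by (simp add: q_def summable_Suc_iff[of "\<lambda>k. wt (pre k (code a)) powr (- (1 / (p - 1)))"])
  qed auto
  finally have "(\<integral>\<^sup>+t\<in>{0<..<\<rho>}. ?Y t \<partial>lebesgue)
     \<le> ennreal cf * ennreal \<rho> + ennreal (\<Sum>k. (2 powr (\<alpha> * p)) powr q * wt (pre (Suc k) (code a)) powr (- q))" .
  also have "\<dots> < \<infinity>" by (simp add: ennreal_mult_less_top)
  finally show False using inf by (simp add: q)
qed

text \<open>The opposite estimate, a lower bound for the integrand. It requires \<omega>(cube t a)
  to be bounded above by the weight of a dyadic cube inside it, hence doubling, and the capacity of
  the cube to be bounded below, hence \<open>tcap_le_riesz_capacity\<close>.\<close>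

lemma summable_capacities:
  assumes a: "a \<in> Q0"
    and fin: "(\<integral>\<^sup>+t\<in>{0<..<\<rho>}. ennpowr (ennreal (t powr (\<alpha> * p)) * riesz_capacity \<alpha> p \<rho> \<omega> (E \<inter> cube t a)
                   / weight_of \<omega> (cube t a)) (conj_exp p - 1) / ennreal t \<partial>lebesgue) < \<infinity>"
  shows "summable (\<lambda>k. (rcap p wt (code ` (E \<inter> dyad (pre k (code a)))) / wt (pre k (code a))) powr (1 / (p - 1)))"
proof -
  define q where "q = 1 / (p - 1)"
  have q: "0 < q" "conj_exp p - 1 = q" using p by (auto simp: q_def conj_exp_def field_simps)
  have \<alpha>p: "0 < \<alpha> * p" using \<alpha> p by simp
  obtain C where C: "0 < C"
    "\<And>F. F \<subseteq> Q0 \<Longrightarrow> tcap p wt (code ` F) \<le> ennreal C * riesz_capacity \<alpha> p \<rho> \<omega> F"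
    by (rule tcap_le_riesz_capacity) blast
  \<comment> \<open>4^n is the volume ratio between \<open>cube (side k) a\<close>, of side 2 * side
    k, and a dyadic cube of side side k / 2.\<close>
  obtain D where D: "0 < D"
    "\<And>r x Q. 0 < r \<Longrightarrow> 2 * r \<le> 1 \<Longrightarrow> Q \<in> sets lebesgue \<Longrightarrow> Q \<subseteq> cube r x \<Longrightarrow>
      emeasure lebesgue (cube r x) \<le> ennreal (4 ^ CARD('n)) * emeasure lebesgue Q \<Longrightarrow>
      weight_of \<omega> (cube r x) \<le> ennreal D * weight_of \<omega> Q"
    by (rule doubling[of "4 ^ CARD('n)"]) auto
  define l where "l k = pre k (code a)" for k
  define r where "r k = rcap p wt (code ` (E \<inter> dyad (l k)))" for k
  have r0: "0 \<le> r k" for k by (simp add: r_def)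
  have tr: "tcap p wt (code ` (E \<inter> dyad (l k))) = ennreal (r k)" for k
    unfolding r_def using wt_pos by (intro ennreal_rcap[symmetric]) (auto simp: less_imp_le)
  \<comment> \<open>On shell k the integrand is at least \<open>v k / t\<close>, hence at least
    \<open>v k / side k\<close>; the shell has length side k / 2, so it contributes at least v k /
    2.\<close>
  define v where "v k = (r (Suc k) / (C * D * wt (l (Suc k)))) powr q" for k
  have v0: "0 \<le> v k" for k by (simp add: v_def)
  let ?Y = "\<lambda>t. ennpowr (ennreal (t powr (\<alpha> * p)) * riesz_capacity \<alpha> p \<rho> \<omega> (E \<inter> cube t a)
                   / weight_of \<omega> (cube t a)) q / ennreal t"
  have "(\<Sum>k. ennreal (v k / side k) * indicator (shell k) t) \<le> ?Y t * indicator {0<..<\<rho>} t" for t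
  proof (cases "\<exists>k. t \<in> shell k")
    case False
    then have "(\<lambda>k. ennreal (v k / side k) * indicator (shell k) t) = (\<lambda>_. 0)" by auto
    then show ?thesis by simp
  next
    case True
    then obtain k where k: "t \<in> shell k" ..
    then have kt: "side (Suc k) \<le> t" "t < side k" by (auto simp: shell_def)
    have t: "0 < t" "t < \<rho>"
    proof -
      show "0 < t" using kt(1) side_pos[of "Suc k"] by linarith
      have "side 0 < \<rho>" using k0(2) by (simp add: side_def)
      then show "t < \<rho>" using kt(2) side_decreasing[of 0 k] by simp
    qed
    obtain u where u: "weight_of \<omega> (cube t a) = ennreal u" "0 < u" using weight_of_cube[OF t(1)] .
    have "(2 :: real) ^ 1 \<le> 2 ^ (k0 + k)" using k0 by (intro power_increasing) auto
    then have side2: "2 * side k \<le> 1" by (simp add: side_def field_simps)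
    have "weight_of \<omega> (cube (side k) a) \<le> ennreal D * weight_of \<omega> (dyad (l (Suc k)))"
    proof (rule D(2))
      show "dyad (l (Suc k)) \<subseteq> cube (side k) a"
        unfolding l_def using side_decreasing[of k "Suc k"] by (intro dyad_subset_cube a) auto
      have "emeasure lebesgue (cube (side k) a) = ennreal ((2 * side k) ^ CARD('n))" by (intro emeasure_cube) simp
      also have "(2 * side k) ^ CARD('n) = 4 ^ CARD('n) * side (Suc k) ^ CARD('n)"
      proof -
        have "2 * side k = 4 * side (Suc k)" by (simp add: side_Suc)
        then show ?thesis by (simp only: power_mult_distrib)
      qed
      also have "ennreal \<dots> = ennreal (4 ^ CARD('n)) * emeasure lebesgue (dyad (l (Suc k)))"
        unfolding emeasure_dyad by (subst ennreal_mult) (auto simp: l_def)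
      finally show "emeasure lebesgue (cube (side k) a) \<le> ennreal (4 ^ CARD('n)) * emeasure lebesgue (dyad (l (Suc k)))"
        by (rule eq_refl)
    qed (use side2 in auto)
    then have "weight_of \<omega> (cube t a) \<le> ennreal D * weight_of \<omega> (dyad (l (Suc k)))"
      using weight_of_mono[OF cube_mono[of t "side k" a]] kt by (meson less_imp_le order_trans)
    then have uD: "u \<le> D * (wt (l (Suc k)) * side (Suc k) powr (\<alpha> * p))"
      unfolding weight_dyad u using D wt_pos[of "l (Suc k)"] by (simp add: ennreal_mult[symmetric] l_def)
    have "ennreal (r (Suc k)) \<le> ennreal C * riesz_capacity \<alpha> p \<rho> \<omega> (E \<inter> dyad (l (Suc k)))"
      unfolding tr[symmetric] using dyad_Q0 by (intro C) auto
    also have "\<dots> \<le> ennreal C * riesz_capacity \<alpha> p \<rho> \<omega> (E \<inter> cube t a)"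
      unfolding l_def using dyad_subset_cube[OF a kt(1)] by (intro mult_left_mono riesz_capacity_mono) auto
    finally have "ennreal (1 / C) * ennreal (r (Suc k)) \<le> ennreal (1 / C) * (ennreal C * riesz_capacity \<alpha> p \<rho> \<omega> (E \<inter> cube t a))"
      by (rule mult_left_mono) simp
    moreover have "ennreal (1 / C) * (ennreal C * riesz_capacity \<alpha> p \<rho> \<omega> (E \<inter> cube t a)) = riesz_capacity \<alpha> p \<rho> \<omega> (E \<inter> cube t a)"
      using C by (simp add: mult.assoc[symmetric] ennreal_mult[symmetric])
    moreover have "ennreal (1 / C) * ennreal (r (Suc k)) = ennreal (r (Suc k) / C)"
      using C r0 by (simp add: ennreal_mult[symmetric])
    ultimately have R: "ennreal (r (Suc k) / C) \<le> riesz_capacity \<alpha> p \<rho> \<omega> (E \<inter> cube t a)" by simp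
    have "r (Suc k) / (C * D * wt (l (Suc k))) = side (Suc k) powr (\<alpha> * p) * (r (Suc k) / C) / (D * (wt (l (Suc k)) * side (Suc k) powr (\<alpha> * p)))"
      by simp
    also have "\<dots> \<le> t powr (\<alpha> * p) * (r (Suc k) / C) / u"
      using uD u r0[of "Suc k"] C kt \<alpha>p by (intro frac_le mult_mono powr_mono2) auto
    finally have "ennreal (r (Suc k) / (C * D * wt (l (Suc k)))) \<le> ennreal (t powr (\<alpha> * p) * (r (Suc k) / C) / u)"
      by (rule ennreal_leI)
    also have "\<dots> = ennreal (t powr (\<alpha> * p)) * ennreal (r (Suc k) / C) / weight_of \<omega> (cube t a)"
      using u C r0[of "Suc k"] by (simp add: divide_ennreal ennreal_mult[symmetric])
    also have "\<dots> \<le> ennreal (t powr (\<alpha> * p)) * riesz_capacity \<alpha> p \<rho> \<omega> (E \<inter> cube t a) / weight_of \<omega> (cube t a)"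
      using R by (intro divide_right_mono_ennreal mult_left_mono) auto
    finally have "ennpowr (ennreal (r (Suc k) / (C * D * wt (l (Suc k))))) q
        \<le> ennpowr (ennreal (t powr (\<alpha> * p)) * riesz_capacity \<alpha> p \<rho> \<omega> (E \<inter> cube t a) / weight_of \<omega> (cube t a)) q"
      using q by (intro ennpowr_mono) auto
    moreover have "ennpowr (ennreal (r (Suc k) / (C * D * wt (l (Suc k))))) q = ennreal (v k)"
      unfolding v_def using r0[of "Suc k"] C D wt_pos[of "l (Suc k)"]
      by (intro ennpowr_ennreal divide_nonneg_nonneg mult_nonneg_nonneg) auto
    ultimately have "ennreal (v k) / ennreal t \<le> ?Y t"
      by (intro divide_right_mono_ennreal) simp
    moreover have "ennreal (v k / side k) \<le> ennreal (v k) / ennreal t"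
      using v0[of k] t kt by (subst divide_ennreal) (auto intro!: ennreal_leI divide_left_mono)
    ultimately have "ennreal (v k / side k) \<le> ?Y t" by simp
    moreover have "(\<Sum>k. ennreal (v k / side k) * indicator (shell k) t) = ennreal (v k / side k)"
      by (rule suminf_cmult_indicator[OF shell_disjoint k])
    ultimately show ?thesis using t by simp
  qed
  then have "(\<integral>\<^sup>+t. (\<Sum>k. ennreal (v k / side k) * indicator (shell k) t) \<partial>lebesgue) \<le> (\<integral>\<^sup>+t\<in>{0<..<\<rho>}. ?Y t \<partial>lebesgue)"
    by (rule nn_integral_mono)
  also have "\<dots> < \<infinity>" using fin q by simp
  finally have "(\<Sum>k. ennreal (v k / side k) * ennreal (side (Suc k))) < \<infinity>"
    unfolding nn_integral_shells .
  also have "(\<lambda>k. ennreal (v k / side k) * ennreal (side (Suc k))) = (\<lambda>k. ennreal (v k / 2))"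
    using v0 by (intro ext) (simp add: ennreal_mult[symmetric] side_Suc)
  finally have "summable (\<lambda>k. v k / 2)"
    using v0 by (intro summable_suminf_not_top) auto
  then have "summable (\<lambda>k. 2 * (C * D) powr q * (v k / 2))" by (rule summable_mult)
  moreover have "2 * (C * D) powr q * (v k / 2) = (r (Suc k) / wt (l (Suc k))) powr q" for k
    using C D r0[of "Suc k"] wt_pos[of "l (Suc k)"] by (simp add: v_def powr_divide powr_mult)
  ultimately have "summable (\<lambda>k. (r (Suc k) / wt (l (Suc k))) powr q)" by (simp only:)
  then have "summable (\<lambda>k. (r k / wt (l k)) powr q)"
    by (subst (asm) summable_Suc_iff)
  then show ?thesis by (simp add: r_def l_def q_def)
qed

text \<open>The lower bound for \<open>res\<close> depends on the point, so the thin points of the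
  root cell are sorted by the bound 1 / (j + 1), and \<open>tcap_res_ge\<close> is applied to each
  class.\<close>

lemma thin_points_null_cover:
  "\<exists>A. (\<forall>j :: nat. riesz_capacity \<alpha> p \<rho> \<omega> (A j) = 0) \<and> E \<inter> thin_points \<alpha> p \<rho> \<omega> E \<inter> cell {} k0 x0 \<subseteq> (\<Union>j. A j)"
proof -
  interpret word_tree p wt "code ` (E \<inter> Q0)"
    using p wt_pos by unfold_locales
  define A where "A j = {a \<in> E \<inter> Q0. \<forall>k. 1 / real (Suc j) \<le> res (pre k (code a))}" for j
  have "riesz_capacity \<alpha> p \<rho> \<omega> (A j) = 0" for j
  proof (rule riesz_capacity_zero_of_tcap)
    have "tcap p wt (code ` A j) \<le> tcap p wt {s \<in> code ` (E \<inter> Q0). \<forall>k. 1 / real (Suc j) \<le> res (pre k s)}"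
      by (intro tcap_mono) (auto simp: A_def)
    also have "\<dots> = 0" by (rule tcap_res_ge) simp
    finally show "tcap p wt (code ` A j) = 0" by simp
  qed (auto simp: A_def)
  moreover have "\<exists>j. a \<in> A j" if a: "a \<in> E" "a \<in> thin_points \<alpha> p \<rho> \<omega> E" "a \<in> Q0" for a
  proof -
    have eq: "{s' \<in> code ` (E \<inter> Q0). pre k s' = pre k (code a)} = code ` (E \<inter> dyad (pre k (code a)))" for k
      by (auto simp: dyad_def)
    have thin: "thin_at \<alpha> p \<rho> \<omega> E a" using a by (simp add: thin_points_def)
    have "\<exists>\<delta>>0. \<forall>k. \<delta> \<le> res (pre k (code a))"
    proof (rule res_bounded_below)
      show "summable (\<lambda>k. (rcap p wt {s' \<in> code ` (E \<inter> Q0). pre k s' = pre k (code a)} / wt (pre k (code a))) powr q)"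
        unfolding eq q_def using thin by (intro summable_capacities a) (auto simp: thin_at_def)
      show "\<not> summable (\<lambda>k. wt (pre k (code a)) powr (- q))"
        unfolding q_def using thin by (intro divergent_weights a) (auto simp: thin_at_def)
    qed
    then obtain \<delta> where \<delta>: "0 < \<delta>" "\<And>k. \<delta> \<le> res (pre k (code a))" by blast
    then obtain j where "1 / real (Suc j) < \<delta>" using nat_approx_posE by blast
    then have "a \<in> A j" using a \<delta> by (auto simp: A_def intro: order_trans less_imp_le)
    then show ?thesis ..
  qed
  ultimately show ?thesis by (intro exI[of _ A]) (auto simp: Q0_def)
qed

end

theorem theorem4p4p5:
  fixes \<alpha> p \<rho> :: real and \<omega> :: "real ^ 'n \<Rightarrow> real" and E :: "(real ^ 'n) set"
  assumes "0 < \<alpha>" and "\<alpha> < real CARD('n)"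
    and "1 < p"
    and "0 < \<rho>"
    and "\<omega> \<in> Ap_loc p"
  shows "riesz_capacity \<alpha> p \<rho> \<omega> (E \<inter> thin_points \<alpha> p \<rho> \<omega> E) = 0"
proof -
  interpret local_Ap p \<omega> using assms by unfold_locales
  obtain k1 where k1: "(1 / 2) ^ k1 < \<rho>" using real_arch_pow_inv[of \<rho> "1 / 2"] assms by auto
  define k0 where "k0 = max 5 k1"
  have "(1 / 2 :: real) ^ k0 \<le> (1 / 2) ^ k1" by (intro power_decreasing) (auto simp: k0_def)
  then have k0: "5 \<le> k0" "1 / 2 ^ k0 < \<rho>" using k1 by (auto simp: k0_def power_one_over)
  \<comment> \<open>The lower corners of the cells of level k0. They are indexed by integer vectors,
    so the cells cover the space and are countably many.\<close>
  define c where "c m = (\<chi> i. real_of_int (m $ i) / 2 ^ k0)" for m :: "int ^ 'n"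
  have "\<exists>A. (\<forall>j :: nat. riesz_capacity \<alpha> p \<rho> \<omega> (A j) = 0) \<and>
      E \<inter> thin_points \<alpha> p \<rho> \<omega> E \<inter> cell {} k0 (c m) \<subseteq> (\<Union>j. A j)" for m
  proof -
    interpret riesz_root p \<omega> \<alpha> \<rho> k0 "c m" using assms k0 by unfold_locales
    show ?thesis by (rule thin_points_null_cover)
  qed
  then obtain A where A: "\<And>m j. riesz_capacity \<alpha> p \<rho> \<omega> (A m j) = 0"
    "\<And>m. E \<inter> thin_points \<alpha> p \<rho> \<omega> E \<inter> cell {} k0 (c m) \<subseteq> (\<Union>j :: nat. A m j)" by metis
  define B where "B i = (case from_nat i of (m, j) \<Rightarrow> A m j)" for i
  have "riesz_capacity \<alpha> p \<rho> \<omega> (\<Union>i. B i) = 0"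
    by (rule riesz_capacity_zero_UN) (simp add: B_def A split: prod.split)
  moreover have "E \<inter> thin_points \<alpha> p \<rho> \<omega> E \<subseteq> (\<Union>i. B i)"
  proof
    fix a assume a: "a \<in> E \<inter> thin_points \<alpha> p \<rho> \<omega> E"
    define m :: "int ^ 'n" where "m = (\<chi> i. \<lfloor>2 ^ k0 * a $ i\<rfloor>)"
    have "a \<in> cell {} k0 (c m)" by (simp add: cell_def grid_shift_def c_def m_def)
    then obtain j where "a \<in> A m j" using A(2)[of m] a by blast
    then have "a \<in> B (to_nat (m, j))" by (simp add: B_def)
    then show "a \<in> (\<Union>i. B i)" by blast
  qed
  ultimately show ?thesis using riesz_capacity_mono[of _ "\<Union>i. B i"] by (metis le_zero_eq)
qed

end
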